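(* Suppose that \[ \sup_{x\in S} q_n(x)=o(n/m_n),\qquad n\to\infty. \tag{L} \] Then the following two properties are equivalent: (a) (Lindeberg condition) for every $\delta>0$, \[ P\big[(\varepsilon_n/\sigma_n)^2\,\mathbf 1\{|\varepsilon_n/\sigma_n|>\delta\sqrt n\}\big]=o(1),\qquad n\to\infty; \] (b) (asymptotic normality) \[ \frac{\sqrt n}{\sigma_n}\left(\hat\mu_n^{\mathrm{OLS}}-\mu_n\right)\rightsquigarrow\mathcal N(0,1),\qquad n\to\infty . \] Moreover, under (L) and (a), the variance estimator is consistent in the sense that \[ \hat\sigma_{n,\mathrm{OLS}}^2/\sigma_n^2\rightsquigarrow 1,\qquad n\to\infty, \] and (b) thus remains true if $\sigma_n$ is replaced by $\hat\sigma_{n,\mathrm{OLS}}$.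
   Context: Let $(S,\mathcal S,P)$ be a probability space; for a (scalar-, vector- or matrix-valued) function $g$ on $S$ write $P(g)=\int_S g\,\mathrm dP$ (componentwise). For each $n$, $X_1,\dots,X_n$ is an independent random sample from $P$ defined on a probability space $(\Omega,\mathcal A,\mathbb P)$, and $P_n(g)=n^{-1}\sum_{i=1}^n g(X_i)$. A prime denotes transposition, $\mathbf 1\{\cdot\}$ an indicator, and $\rightsquigarrow$ convergence in distribution (weak convergence). Let $(m_n)$ be a sequence of positive integers with $m_n\to\infty$. For each $n$ let $h_n=(h_{n,1},\dots,h_{n,m_n})'$ be a column vector of real functions (control functions) $h_{n,j}\in L^2(P)$ with $P(h_{n,j})=0$ for all $j$, such that $h_{n,1},\dots,h_{n,m_n}$ are linearly independent in $L^2(P)$; equivalently, the $m_n\times m_n$ Gram matrix $P(h_nh_n')=(P(h_{n,j}h_{n,k}))_{j,k}$ is invertible. The leverage function is $q_n(x)=h_n(x)'\,P(h_nh_n')^{-1}\,h_n(x)$, $x\in S$. For each $n$ let $f_n\in L^2(P)$ be a real function (integrand) and $\mu_n=P(f_n)$. Write $f_n=\mu_n+\beta_n'h_n+\varepsilon_n$, where $\beta_n\in\mathbb R^{m_n}$ is determined by $P(\varepsilon_nh_{n,j})=0$ for all $j=1,\dots,m_n$. Then $P(\varepsilon_n)=0$. Let $\sigma_n^2=P(\varepsilon_n^2)$ and assume $\sigma_n^2>0$ for all $n$ ($\sigma_n>0$ is its square root). The ordinary least squares Monte Carlo (OLSMC) estimator $\hat\mu_n^{\mathrm{OLS}}$ of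 $\mu_n$ is the $\alpha$-component of a minimizer of $\sum_{i=1}^n\{f_n(X_i)-\alpha-\beta'h_n(X_i)\}^2$ over $(\alpha,\beta)\in\mathbb R\times\mathbb R^{m_n}$. It is well-defined when this $\alpha$-component is unique, i.e. when the vector $1_n=(1,\dots,1)'\in\mathbb R^n$ is not in the column space of the $n\times m_n$ matrix $(h_{n,j}(X_i))_{i,j}$; its value on the complementary event (say $0$) is immaterial for the asymptotic statements (under (L) this event has probability tending to zero). The OLSMC variance estimator is \[ \hat\sigma_{n,\mathrm{OLS}}^2=\frac1n\min_{(\alpha,\beta)\in\mathbb R\times\mathbb R^{m_n}}\sum_{i=1}^n\{f_n(X_i)-\alpha-\beta'h_n(X_i)\}^2, \] and $\hat\sigma_{n,\mathrm{OLS}}\ge 0$ is its square root. *)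

theory Defs
  imports
    "HOL-Probability.Probability"
    "HOL-Library.Landau_Symbols"
    "Jordan_Normal_Form.Gauss_Jordan_Elimination"
begin

text \<open>Jordan_Normal_Form vectors and matrices are used because the number of control functions
  varies with the sample size. Coordinates are counted from 0, so the control functions
  of a family \<open>h\<close> of size \<open>m\<close> are \<open>h 0, \<dots>, h (m - 1)\<close> and the sample of size \<open>n\<close>
  is \<open>X 0, \<dots>, X (n - 1)\<close>.\<close>

text \<open>Elements of \<open>L\<^sup>2(P)\<close> are represented by functions, not by equivalence classes.\<close>

definition L2_fun :: "'s measure \<Rightarrow> ('s \<Rightarrow> real) \<Rightarrow> bool" where
  "L2_fun P g \<longleftrightarrow> g \<in> borel_measurable P \<and> integrable P (\<lambda>x. (g x)\<^sup>2)"

definition lin_indep_L2 :: "'s measure \<Rightarrow> nat \<Rightarrow> (nat \<Rightarrow> 's \<Rightarrow> real) \<Rightarrow> bool" where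
  "lin_indep_L2 P m h \<longleftrightarrow>
     (\<forall>c. (AE x in P. (\<Sum>j<m. c j * h j x) = 0) \<longrightarrow> (\<forall>j<m. c j = 0))"

definition iid_sample :: "'s measure \<Rightarrow> 'w measure \<Rightarrow> nat \<Rightarrow> (nat \<Rightarrow> 'w \<Rightarrow> 's) \<Rightarrow> bool" where
  "iid_sample P M n X \<longleftrightarrow>
     prob_space.indep_vars M (\<lambda>_. P) X {..<n} \<and> (\<forall>i<n. distr M P (X i) = P)"

definition control_vec :: "nat \<Rightarrow> (nat \<Rightarrow> 's \<Rightarrow> real) \<Rightarrow> 's \<Rightarrow> real Matrix.vec" where
  "control_vec m h x = Matrix.vec m (\<lambda>j. h j x)"

definition gram_matrix :: "'s measure \<Rightarrow> nat \<Rightarrow> (nat \<Rightarrow> 's \<Rightarrow> real) \<Rightarrow> real Matrix.mat" where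
  "gram_matrix P m h = Matrix.mat m m (\<lambda>(j, k). \<integral>x. h j x * h k x \<partial>P)"

text \<open>\<open>mat_inverse\<close> returns an option; the value is \<open>Some\<close> for an invertible Gram
  matrix, i.e. for square-integrable control functions that are linearly independent in \<open>L\<^sup>2(P)\<close>.\<close>

definition leverage :: "'s measure \<Rightarrow> nat \<Rightarrow> (nat \<Rightarrow> 's \<Rightarrow> real) \<Rightarrow> 's \<Rightarrow> real" where
  "leverage P m h x =
     scalar_prod (control_vec m h x) (the (mat_inverse (gram_matrix P m h)) *\<^sub>v control_vec m h x)"

text \<open>In the following, \<open>x :: nat \<Rightarrow> 's\<close> is a realised sample \<open>x 0, \<dots>, x (n - 1)\<close>.\<close>

definition ols_objective ::
  "('s \<Rightarrow> real) \<Rightarrow> nat \<Rightarrow> (nat \<Rightarrow> 's \<Rightarrow> real) \<Rightarrow> nat \<Rightarrow> (nat \<Rightarrow> 's) \<Rightarrow> real \<times> real Matrix.vec \<Rightarrow> real"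
where
  "ols_objective f m h n x =
     (\<lambda>(a, b). \<Sum>i<n. (f (x i) - a - scalar_prod b (control_vec m h (x i)))\<^sup>2)"

definition ols_minimizer ::
  "('s \<Rightarrow> real) \<Rightarrow> nat \<Rightarrow> (nat \<Rightarrow> 's \<Rightarrow> real) \<Rightarrow> nat \<Rightarrow> (nat \<Rightarrow> 's) \<Rightarrow> real \<times> real Matrix.vec \<Rightarrow> bool"
where
  "ols_minimizer f m h n x p \<longleftrightarrow>
     is_arg_min (ols_objective f m h n x) (\<lambda>(a, b). b \<in> carrier_vec m) p"

text \<open>The estimator is set to 0 where the first component of a minimizer is not unique.\<close>

definition ols_estimator ::
  "('s \<Rightarrow> real) \<Rightarrow> nat \<Rightarrow> (nat \<Rightarrow> 's \<Rightarrow> real) \<Rightarrow> nat \<Rightarrow> (nat \<Rightarrow> 's) \<Rightarrow> real"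
where
  "ols_estimator f m h n x =
     (if \<exists>!a. \<exists>b. ols_minimizer f m h n x (a, b)
      then THE a. \<exists>b. ols_minimizer f m h n x (a, b) else 0)"

text \<open>\<open>LEAST\<close> expresses that the minimum is attained; \<open>Min\<close> only applies to finite sets.\<close>

definition ols_variance ::
  "('s \<Rightarrow> real) \<Rightarrow> nat \<Rightarrow> (nat \<Rightarrow> 's \<Rightarrow> real) \<Rightarrow> nat \<Rightarrow> (nat \<Rightarrow> 's) \<Rightarrow> real"
where
  "ols_variance f m h n x =
     1 / real n * (LEAST v. \<exists>a. \<exists>b\<in>carrier_vec m. v = ols_objective f m h n x (a, b))"

end

theory Submission
  imports Defs "Jordan_Normal_Form.Determinant"
begin

text \<open>
  Why the theorem is true. Replace the controls by an \<open>L\<^sup>2(P)\<close>-orthonormal basis \<open>g\<^sub>1, \<dots>, g\<^sub>m\<close> of their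
  span: the column space of the sample design does not change, and the leverage function becomes
  \<open>q = g\<^sub>1\<^sup>2 + \<dots> + g\<^sub>m\<^sup>2\<close> (\<open>leverage_orthonormal_basis\<close>). Let \<open>p\<close> be the orthogonal projection of the
  vector \<open>1\<close> on the column space and \<open>E\<close> the vector of the sampled residuals \<open>\<epsilon>(X\<^sub>i)\<close>. Ordinary least squares gives
  \<open>\<mu>\<^sub>O\<^sub>L\<^sub>S - \<mu> = \<langle>E, 1 - p\<rangle> / |1 - p|\<^sup>2\<close>, so the normalised error is \<open>(T - w) / (1 - v)\<close>, where
  \<open>T = \<Sum> \<epsilon>(X\<^sub>i) / (\<sigma> \<surd>n)\<close> is the oracle error, \<open>v = |p|\<^sup>2 / n\<close> and \<open>w = \<langle>E, p\<rangle> / (\<sigma> \<surd>n)\<close>.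

  Three averages control \<open>v\<close> and \<open>w\<close>: the squared Frobenius distance \<open>D\<close> of the empirical Gram matrix
  of \<open>g\<close> to the identity, \<open>a = |P\<^sub>n(g)|\<^sup>2\<close> and \<open>c = |P\<^sub>n(\<epsilon> g)|\<^sup>2 / \<sigma>\<^sup>2\<close>. As soon as \<open>D \<le> 1/4\<close>, the empirical Gram
  matrix is bounded below by \<open>1/2\<close>, whence \<open>v \<le> 2 a\<close> and \<open>w\<^sup>2 \<le> 4 n a c\<close> (\<open>ols_stochastic_expansion\<close>).
  Independence gives \<open>E D \<le> m sup q / n\<close>, \<open>E a \<le> m / n\<close> and \<open>E c \<le> sup q / n\<close>. The leverage
  condition says \<open>m sup q / n \<rightarrow> 0\<close>; since \<open>m = P(q) \<le> sup q\<close>, all three quantities and \<open>n a c\<close> tend to \<open>0\<close> in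
  probability, the last because \<open>n a / m\<close> has mean at most \<open>1\<close> while \<open>m c\<close> vanishes. Hence the
  normalised error differs from \<open>T\<close> by a null sequence.

  By Slutsky the equivalence reduces to one for \<open>T\<close>, a sum over an array with i.i.d. rows:
  \<open>T\<close> is asymptotically standard normal if and only if the Lindeberg condition holds
  (\<open>lindeberg_feller_iid_rows\<close>). For the Feller half it is enough that the terms of a
  row have the same law with variance \<open>1\<close>: this makes \<open>\<phi>(t / \<surd>n) - 1\<close> of order \<open>1 / n\<close>, where \<open>\<phi>\<close> is their
  characteristic function.

  The variance estimator equals \<open>P\<^sub>n(\<epsilon>\<^sup>2)\<close> minus two projection terms that are
  negligible for the same reason, and \<open>P\<^sub>n(\<epsilon>\<^sup>2) / \<sigma>\<^sup>2 \<rightarrow> 1\<close> by truncation under the Lindeberg condition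
  (\<open>mean_of_squares_consistent\<close>).

  Convergence in distribution presupposes measurable estimators, also on the event where the least
  squares problem is degenerate. Gram-Schmidt orthogonalisation in which \<open>x / 0 = 0\<close> produces the correct
  residuals for every design, so that both estimators are rational expressions in the data
  (\<open>ols_via_residuals\<close>).
\<close>

section \<open>Gram-Schmidt orthogonalisation of real functions\<close>

text \<open>The residual of \<open>v\<close> after projection on \<open>H 0, \<dots>, H (k - 1)\<close>. The inner product is a parameter because
  the recursion is used twice: on samples, and in \<open>L\<^sup>2(P)\<close>. A vector \<open>H k\<close> that depends on its predecessors
  has a residual of norm zero, and the convention \<open>x / 0 = 0\<close> then skips it, so the recursion is also right for dependent vectors.\<close>

primrec gs_residual ::
  "(('a \<Rightarrow> real) \<Rightarrow> ('a \<Rightarrow> real) \<Rightarrow> real) \<Rightarrow> (nat \<Rightarrow> 'a \<Rightarrow> real) \<Rightarrow> nat \<Rightarrow> ('a \<Rightarrow> real) \<Rightarrow> 'a \<Rightarrow> real"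
where
  "gs_residual ip H 0 v = v"
| "gs_residual ip H (Suc k) v =
     (let r = gs_residual ip H k (H k) in
       (\<lambda>x. gs_residual ip H k v x - ip (gs_residual ip H k v) r / ip r r * r x))"

text \<open>The inner product is only semidefinite: two functions that agree on the sample, or almost
  everywhere, are not identified.\<close>

locale semi_inner_functions =
  fixes V :: "('a \<Rightarrow> real) set"
    and ip :: "('a \<Rightarrow> real) \<Rightarrow> ('a \<Rightarrow> real) \<Rightarrow> real"
  assumes zero_closed: "(\<lambda>_. 0) \<in> V"
    and comb_closed: "u \<in> V \<Longrightarrow> v \<in> V \<Longrightarrow> (\<lambda>x. u x + c * v x) \<in> V"
    and ip_commute: "u \<in> V \<Longrightarrow> v \<in> V \<Longrightarrow> ip u v = ip v u"
    and ip_comb: "u \<in> V \<Longrightarrow> v \<in> V \<Longrightarrow> w \<in> V \<Longrightarrow> ip (\<lambda>x. u x + c * v x) w = ip u w + c * ip v w"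
    and ip_nonneg: "u \<in> V \<Longrightarrow> 0 \<le> ip u u"
begin

lemma ip_comb_right:
  "u \<in> V \<Longrightarrow> v \<in> V \<Longrightarrow> w \<in> V \<Longrightarrow> ip w (\<lambda>x. u x + c * v x) = ip w u + c * ip w v"
  by (simp add: ip_commute[of w] comb_closed ip_comb)

lemma ip_zero: "w \<in> V \<Longrightarrow> ip (\<lambda>_. 0) w = 0"
  using ip_comb[of "\<lambda>_. 0" "\<lambda>_. 0" w 1] zero_closed by simp

lemma diff_closed: "u \<in> V \<Longrightarrow> v \<in> V \<Longrightarrow> (\<lambda>x. u x - c * v x) \<in> V"
  using comb_closed[of u v "- c"] by simp

lemma ip_diff: "u \<in> V \<Longrightarrow> v \<in> V \<Longrightarrow> w \<in> V \<Longrightarrow> ip (\<lambda>x. u x - c * v x) w = ip u w - c * ip v w"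
  using ip_comb[of u v w "- c"] by simp

lemma sum_closed:
  assumes "\<And>j. j < k \<Longrightarrow> H j \<in> V"
  shows "(\<lambda>x. \<Sum>j<k::nat. c j * H j x) \<in> V"
  using assms
proof (induction k)
  case (Suc k)
  then show ?case using comb_closed[of "\<lambda>x. \<Sum>j<k. c j * H j x" "H k" "c k"] by simp
qed (simp add: zero_closed)

lemma ip_sum:
  assumes "\<And>j. j < k \<Longrightarrow> H j \<in> V" "w \<in> V"
  shows "ip (\<lambda>x. \<Sum>j<k::nat. c j * H j x) w = (\<Sum>j<k. c j * ip (H j) w)"
  using assms
proof (induction k)
  case (Suc k)
  then show ?case
    using ip_comb[of "\<lambda>x. \<Sum>j<k. c j * H j x" "H k" w "c k"] sum_closed[of k H c] by simp
qed (simp add: ip_zero)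

text \<open>The degenerate case of the Cauchy-Schwarz inequality. It makes the convention
  \<open>x / 0 = 0\<close> in the Gram-Schmidt step harmless: the numerator vanishes together with the denominator.\<close>

lemma ip_null:
  assumes "v \<in> V" "w \<in> V" "ip v v = 0"
  shows "ip w v = 0"
proof (rule ccontr)
  assume ne: "ip w v \<noteq> 0"
  \<comment> \<open>The choice of \<open>t\<close> makes the squared norm of \<open>w + t v\<close> equal to \<open>-1\<close>.\<close>
  define t where "t = - (ip w w + 1) / (2 * ip w v)"
  have "ip (\<lambda>x. w x + t * v x) (\<lambda>x. w x + t * v x) = ip w w + t * ip w v + t * (ip w v + t * ip v v)"
    using assms by (simp add: ip_comb ip_comb_right comb_closed ip_commute[of v w])
  also have "\<dots> = ip w w + 2 * t * ip w v" using assms by simp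
  also have "2 * t * ip w v = - (ip w w + 1)" using ne by (simp add: t_def)
  finally have "ip (\<lambda>x. w x + t * v x) (\<lambda>x. w x + t * v x) = -1" by simp
  then show False using ip_nonneg[OF comb_closed[of w v t]] assms by simp
qed

lemma gs_residual_closed:
  assumes "\<And>j. j < k \<Longrightarrow> H j \<in> V" "v \<in> V"
  shows "gs_residual ip H k v \<in> V"
  using assms
proof (induction k arbitrary: v)
  case (Suc k)
  have "gs_residual ip H k v \<in> V" "gs_residual ip H k (H k) \<in> V"
    using Suc.prems by (simp_all add: Suc.IH)
  from diff_closed[OF this] show ?case by (simp only: gs_residual.simps Let_def)
qed simp

lemma gs_residual_orthogonal_residuals:
  assumes "\<And>j. j < k \<Longrightarrow> H j \<in> V" "v \<in> V" "j < k"
  shows "ip (gs_residual ip H k v) (gs_residual ip H j (H j)) = 0"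
  using assms
proof (induction k arbitrary: v)
  case (Suc k)
  let ?r = "gs_residual ip H k (H k)" and ?s = "gs_residual ip H k v"
  have V: "?s \<in> V" "?r \<in> V" using Suc.prems by (auto intro!: gs_residual_closed)
  have Vj: "gs_residual ip H j (H j) \<in> V" using Suc.prems by (auto intro!: gs_residual_closed)
  have eq: "ip (gs_residual ip H (Suc k) v) (gs_residual ip H j (H j)) =
      ip ?s (gs_residual ip H j (H j)) - ip ?s ?r / ip ?r ?r * ip ?r (gs_residual ip H j (H j))"
    by (simp only: gs_residual.simps Let_def ip_diff[OF V Vj])
  show ?case
  proof (cases "j = k")
    case True
    then show ?thesis using eq ip_null[OF V(2) V(1)] by (cases "ip ?r ?r = 0") auto
  next
    case False
    then have "j < k" using Suc.prems by simp
    then show ?thesis using eq Suc.IH[of v] Suc.IH[of "H k"] Suc.prems by simp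
  qed
qed simp

text \<open>The next two lemmas hold pointwise and not merely up to null functions. This matters for the leverage
  function, which is evaluated at single points.\<close>

lemma gs_residual_expansion:
  "\<exists>c. \<forall>x. v x = gs_residual ip H k v x + (\<Sum>i<k. c i * gs_residual ip H i (H i) x)"
proof (induction k)
  case (Suc k)
  then obtain c where c: "\<And>x. v x = gs_residual ip H k v x + (\<Sum>i<k. c i * gs_residual ip H i (H i) x)"
    by auto
  define q where "q = ip (gs_residual ip H k v) (gs_residual ip H k (H k)) /
      ip (gs_residual ip H k (H k)) (gs_residual ip H k (H k))"
  have "v x = gs_residual ip H (Suc k) v x +
      (\<Sum>i<Suc k. (c(k := q)) i * gs_residual ip H i (H i) x)" for x
    using c[of x] by (simp add: Let_def q_def)
  then show ?case by blast
qed auto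

lemma gs_residual_span:
  "\<exists>b. \<forall>x. gs_residual ip H k v x = v x - (\<Sum>j<k. b j * H j x)"
proof (induction k arbitrary: v)
  case (Suc k)
  obtain b b' where b: "\<And>x. gs_residual ip H k v x = v x - (\<Sum>j<k. b j * H j x)"
    and b': "\<And>x. gs_residual ip H k (H k) x = H k x - (\<Sum>j<k. b' j * H j x)"
    using Suc by meson
  define q where "q = ip (gs_residual ip H k v) (gs_residual ip H k (H k)) /
      ip (gs_residual ip H k (H k)) (gs_residual ip H k (H k))"
  have "gs_residual ip H (Suc k) v x = v x - (\<Sum>j<Suc k. ((\<lambda>j. b j - q * b' j)(k := q)) j * H j x)" for x
  proof -
    have "gs_residual ip H (Suc k) v x = gs_residual ip H k v x - q * gs_residual ip H k (H k) x"
      by (simp add: Let_def q_def)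
    also have "\<dots> = v x - (\<Sum>j<k. b j * H j x) - q * (H k x - (\<Sum>j<k. b' j * H j x))"
      using b b' by simp
    also have "\<dots> = v x - (\<Sum>j<Suc k. ((\<lambda>j. b j - q * b' j)(k := q)) j * H j x)"
      by (simp add: algebra_simps sum_subtractf sum_distrib_left sum_distrib_right)
    finally show ?thesis .
  qed
  then show ?case by blast
qed auto

lemma gs_residual_orthogonal:
  assumes H: "\<And>j. j < k \<Longrightarrow> H j \<in> V" and v: "v \<in> V" and j: "j < k"
  shows "ip (gs_residual ip H k v) (H j) = 0"
proof -
  obtain c where c: "\<And>x. H j x = gs_residual ip H j (H j) x + (\<Sum>i<j. c i * gs_residual ip H i (H i) x)"
    using gs_residual_expansion by meson
  let ?r = "\<lambda>i. gs_residual ip H i (H i)" and ?s = "gs_residual ip H k v"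
  have r: "?r i \<in> V" if "i < k" for i using that H by (auto intro!: gs_residual_closed)
  have s: "?s \<in> V" using H v by (auto intro!: gs_residual_closed)
  have z: "ip (?r i) ?s = 0" if "i < k" for i
    using gs_residual_orthogonal_residuals[of k H v i] H v that ip_commute[OF r[OF that] s] by simp
  have sc: "(\<lambda>x. \<Sum>i<j. c i * ?r i x) \<in> V" using r j by (intro sum_closed) auto
  have "ip ?s (H j) = ip (H j) ?s" using ip_commute s H j by simp
  also have "\<dots> = ip (\<lambda>x. ?r j x + 1 * (\<Sum>i<j. c i * ?r i x)) ?s"
    by (rule arg_cong[where f = "\<lambda>z. ip z ?s"]) (rule ext, subst c, simp)
  also have "\<dots> = ip (?r j) ?s + 1 * ip (\<lambda>x. \<Sum>i<j. c i * ?r i x) ?s"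
    by (rule ip_comb[OF r[OF j] sc s])
  also have "\<dots> = 0" using z j r s by (subst ip_sum) auto
  finally show ?thesis .
qed

text \<open>The normalised Gram-Schmidt residuals. The change of basis is recorded by pointwise identities in both
  directions, with coefficient matrices \<open>A\<close> and \<open>B\<close>.\<close>

lemma orthonormal_basis:
  fixes m :: nat
  assumes H: "\<And>j. j < m \<Longrightarrow> H j \<in> V"
    and indep: "\<And>c. ip (\<lambda>x. \<Sum>j<m. c j * H j x) (\<lambda>x. \<Sum>j<m. c j * H j x) = 0 \<Longrightarrow> \<forall>j<m. c j = 0"
  obtains g A B where
    "\<And>k. k < m \<Longrightarrow> g k \<in> V"
    "\<And>k l. k < m \<Longrightarrow> l < m \<Longrightarrow> ip (g k) (g l) = (if k = l then 1 else 0)"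
    "\<And>k x. k < m \<Longrightarrow> g k x = (\<Sum>j<m. A k j * H j x)"
    "\<And>j x. j < m \<Longrightarrow> H j x = (\<Sum>k<m. B j k * g k x)"
proof -
  let ?r = "\<lambda>i. gs_residual ip H i (H i)"
  have r: "?r i \<in> V" if "i < m" for i using that H by (auto intro!: gs_residual_closed)
  have "\<forall>k. \<exists>b. \<forall>x. ?r k x = H k x - (\<Sum>j<k. b j * H j x)"
    by (rule allI, rule gs_residual_span)
  from choice[OF this] obtain b where b: "\<And>k x. ?r k x = H k x - (\<Sum>j<k. b k j * H j x)" by blast
  have "\<forall>k. \<exists>c. \<forall>x. H k x = ?r k x + (\<Sum>j<k. c j * ?r j x)"
    by (rule allI, rule gs_residual_expansion)
  from choice[OF this] obtain c where c: "\<And>k x. H k x = ?r k x + (\<Sum>j<k. c k j * ?r j x)" by blast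
  define A' where "A' k j = (if j < k then - b k j else if j = k then 1 else 0)" for k j
  define B' where "B' k j = (if j < k then c k j else if j = k then 1 else 0)" for k j
  have split: "(\<Sum>j<m. (if j < k then u j else if j = k then 1 else 0) * w j) =
      w k + (\<Sum>j<k. u j * w j)" if "k < m" for k and u w :: "nat \<Rightarrow> real"
  proof -
    have "(\<Sum>j<m. (if j < k then u j else if j = k then 1 else 0) * w j) =
       (\<Sum>j<m. if j < k then u j * w j else 0) + (\<Sum>j<m. if j = k then w j else 0)"
      unfolding sum.distrib[symmetric] by (rule sum.cong) auto
    also have "(\<Sum>j<m. if j < k then u j * w j else 0) = (\<Sum>j<k. u j * w j)"
      using that by (intro sum.mono_neutral_cong_right) auto
    finally show ?thesis using that by simp
  qed
  have A': "?r k x = (\<Sum>j<m. A' k j * H j x)" if "k < m" for k x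
    using split[OF that, of "\<lambda>j. - b k j" "\<lambda>j. H j x"] b[of k x] unfolding A'_def
    by (simp add: sum_negf)
  have B': "H k x = (\<Sum>j<m. B' k j * ?r j x)" if "k < m" for k x
    using split[OF that, of "c k" "\<lambda>j. ?r j x"] c[of k x] unfolding B'_def by simp
  have ne: "ip (?r k) (?r k) > 0" if "k < m" for k
  proof -
    have "ip (?r k) (?r k) \<noteq> 0"
    proof
      assume 0: "ip (?r k) (?r k) = 0"
      have eq: "?r k = (\<lambda>x. \<Sum>j<m. A' k j * H j x)" by (rule ext) (rule A'[OF that])
      have "\<forall>j<m. A' k j = 0" using 0 unfolding eq by (rule indep)
      with that show False by (auto simp: A'_def)
    qed
    with ip_nonneg[OF r[OF that]] show ?thesis by linarith
  qed
  define s where "s k = sqrt (ip (?r k) (?r k))" for k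
  have s: "s k > 0" "s k * s k = ip (?r k) (?r k)" if "k < m" for k
    using ne[OF that] by (auto simp: s_def)
  define g where "g k = (\<lambda>x. 0 + (1 / s k) * ?r k x)" for k
  have scale: "ip (g k) w = (1 / s k) * ip (?r k) w" if "k < m" "w \<in> V" for k w
    unfolding g_def using ip_comb[OF zero_closed r[OF that(1)] that(2), of "1 / s k"] ip_zero[OF that(2)]
    by simp
  have gV: "g k \<in> V" if "k < m" for k
    unfolding g_def using comb_closed[OF zero_closed r[OF that]] .
  have on: "ip (?r k) (?r l) = 0" if "k < m" "l < m" "k \<noteq> l" for k l
  proof (cases "l < k")
    case True
    then show ?thesis using gs_residual_orthogonal_residuals[of k H "H k" l] H that by auto
  next
    case False
    then have "k < l" using that by simp
    then have "ip (?r l) (?r k) = 0"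
      using gs_residual_orthogonal_residuals[of l H "H l" k] H that by auto
    then show ?thesis by (simp only: ip_commute[OF r[OF that(1)] r[OF that(2)]])
  qed
  have gg: "ip (g k) (g l) = (1 / s k) * ((1 / s l) * ip (?r k) (?r l))" if "k < m" "l < m" for k l
    unfolding scale[OF that(1) gV[OF that(2)]] ip_commute[OF r[OF that(1)] gV[OF that(2)]]
      scale[OF that(2) r[OF that(1)]] ip_commute[OF r[OF that(2)] r[OF that(1)]] ..
  show ?thesis
  proof (rule that[of g "\<lambda>k j. A' k j / s k" "\<lambda>j k. B' j k * s k"])
    show "ip (g k) (g l) = (if k = l then 1 else 0)" if "k < m" "l < m" for k l
      using gg[OF that] on[OF that] s[OF that(1)] s(1)[OF that(2)] by (auto simp: divide_simps)
    show "g k x = (\<Sum>j<m. A' k j / s k * H j x)" if "k < m" for k x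
      unfolding g_def using A'[OF that] by (simp add: sum_divide_distrib)
    show "H j x = (\<Sum>k<m. B' j k * s k * g k x)" if "j < m" for j x
    proof -
      have "(\<Sum>k<m. B' j k * s k * g k x) = (\<Sum>k<m. B' j k * ?r k x)"
      proof (rule sum.cong)
        fix k assume "k \<in> {..<m}"
        then have "s k \<noteq> 0" using s(1)[of k] by simp
        then show "B' j k * s k * g k x = B' j k * ?r k x" by (simp add: g_def)
      qed simp
      then show ?thesis using B'[OF that] by simp
    qed
  qed (fact gV)
qed

end

section \<open>Least squares as orthogonal projection\<close>

definition sample_ip :: "nat \<Rightarrow> (nat \<Rightarrow> real) \<Rightarrow> (nat \<Rightarrow> real) \<Rightarrow> real" where
  "sample_ip n u v = (\<Sum>i<n. u i * v i)"

interpretation sample: semi_inner_functions UNIV "sample_ip n" for n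
  by unfold_locales
    (auto simp: sample_ip_def algebra_simps sum.distrib sum_distrib_left intro!: sum_nonneg)

lemma sample_ip_self_eq_0: "sample_ip n u u = 0 \<longleftrightarrow> (\<forall>i<n. u i = 0)"
  by (subst sample_ip_def, subst sum_nonneg_eq_0_iff) auto

lemma sample_ip_combination:
  assumes p: "\<And>i. i < n \<Longrightarrow> p i = (\<Sum>k<m. b k * G k i)"
  shows "sample_ip n z p = (\<Sum>k<m. b k * sample_ip n z (G k))"
proof -
  have "sample_ip n z p = (\<Sum>i<n. \<Sum>k<m. b k * (z i * G k i))"
    using p by (simp add: sample_ip_def sum_distrib_left mult_ac)
  also have "\<dots> = (\<Sum>k<m. b k * sample_ip n z (G k))"
    by (subst sum.swap) (simp add: sample_ip_def sum_distrib_left)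
  finally show ?thesis .
qed

text \<open>Pythagoras: \<open>e\<close> is the residual of the regression on the constant and the controls. This lemma and
  the next three take \<open>e\<close> as given, so that they apply to any construction of the projection.\<close>

lemma ols_objective_decomposition:
  assumes dec: "\<And>i. i < n \<Longrightarrow> f (x i) = e i + a0 + (\<Sum>j<m. b0 j * h j (x i))"
    and e1: "sample_ip n e (\<lambda>_. 1) = 0"
    and eh: "\<And>j. j < m \<Longrightarrow> sample_ip n e (\<lambda>i. h j (x i)) = 0"
    and b: "b \<in> carrier_vec m"
  shows "ols_objective f m h n x (a, b) =
    sample_ip n e e + (\<Sum>i<n. ((a0 - a) + (\<Sum>j<m. (b0 j - vec_index b j) * h j (x i)))\<^sup>2)"
proof -
  define w where "w i = (a0 - a) + (\<Sum>j<m. (b0 j - vec_index b j) * h j (x i))" for i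
  have w: "f (x i) - a - scalar_prod b (control_vec m h (x i)) = e i + w i" if "i < n" for i
    using dec[OF that] b
    by (simp add: scalar_prod_def control_vec_def atLeast0LessThan w_def left_diff_distrib sum_subtractf)
  have "sample_ip n e w = (a0 - a) * sample_ip n e (\<lambda>_. 1)
      + (\<Sum>j<m. (b0 j - vec_index b j) * sample_ip n e (\<lambda>i. h j (x i)))"
    unfolding sample_ip_def w_def
    by (simp add: distrib_left sum.distrib sum_distrib_left sum_distrib_right mult.assoc mult.left_commute
      sum.swap[of _ "{..<m}"] mult.commute)
  then have ew: "(\<Sum>i<n. e i * w i) = 0" using e1 eh by (simp add: sample_ip_def)
  have "ols_objective f m h n x (a, b) = (\<Sum>i<n. (e i + w i)\<^sup>2)"
    unfolding ols_objective_def using w by simp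
  also have "\<dots> = (\<Sum>i<n. e i * e i) + 2 * (\<Sum>i<n. e i * w i) + (\<Sum>i<n. (w i)\<^sup>2)"
    by (simp add: power2_eq_square algebra_simps sum.distrib sum_distrib_left)
  finally show ?thesis using ew by (simp add: sample_ip_def w_def)
qed

lemma ols_variance_eq:
  assumes dec: "\<And>i. i < n \<Longrightarrow> f (x i) = e i + a0 + (\<Sum>j<m. b0 j * h j (x i))"
    and e1: "sample_ip n e (\<lambda>_. 1) = 0"
    and eh: "\<And>j. j < m \<Longrightarrow> sample_ip n e (\<lambda>i. h j (x i)) = 0"
  shows "ols_variance f m h n x = sample_ip n e e / real n"
proof -
  have D: "ols_objective f m h n x (a, b) =
      sample_ip n e e + (\<Sum>i<n. ((a0 - a) + (\<Sum>j<m. (b0 j - vec_index b j) * h j (x i)))\<^sup>2)"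
    if "b \<in> carrier_vec m" for a b
    by (rule ols_objective_decomposition) (use assms that in auto)
  have "(LEAST v. \<exists>a. \<exists>b\<in>carrier_vec m. v = ols_objective f m h n x (a, b)) = sample_ip n e e"
  proof (rule Least_equality)
    have "ols_objective f m h n x (a0, Matrix.vec m b0) = sample_ip n e e"
      by (subst D) auto
    then show "\<exists>a. \<exists>b\<in>carrier_vec m. sample_ip n e e = ols_objective f m h n x (a, b)"
      by (intro exI[of _ a0] bexI[of _ "Matrix.vec m b0"]) auto
    show "sample_ip n e e \<le> v" if "\<exists>a. \<exists>b\<in>carrier_vec m. v = ols_objective f m h n x (a, b)" for v
      using that D by (auto intro!: sum_nonneg)
  qed
  then show ?thesis by (simp add: ols_variance_def)
qed

lemma ols_minimizer_iff:
  assumes dec: "\<And>i. i < n \<Longrightarrow> f (x i) = e i + a0 + (\<Sum>j<m. b0 j * h j (x i))"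
    and e1: "sample_ip n e (\<lambda>_. 1) = 0"
    and eh: "\<And>j. j < m \<Longrightarrow> sample_ip n e (\<lambda>i. h j (x i)) = 0"
  shows "ols_minimizer f m h n x (a, b) \<longleftrightarrow>
    b \<in> carrier_vec m \<and> (\<forall>i<n. (a0 - a) + (\<Sum>j<m. (b0 j - vec_index b j) * h j (x i)) = 0)"
proof (cases "b \<in> carrier_vec m")
  case True
  have D: "ols_objective f m h n x (a, b) =
      sample_ip n e e + (\<Sum>i<n. ((a0 - a) + (\<Sum>j<m. (b0 j - vec_index b j) * h j (x i)))\<^sup>2)"
    if "b \<in> carrier_vec m" for a b
    by (rule ols_objective_decomposition) (use assms that in auto)
  have D0: "ols_objective f m h n x (a0, Matrix.vec m b0) = sample_ip n e e"
    by (subst D) auto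
  have ge: "sample_ip n e e \<le> ols_objective f m h n x (a', b')" if "b' \<in> carrier_vec m" for a' b'
    using D that by (auto intro!: sum_nonneg)
  have "ols_minimizer f m h n x (a, b) \<longleftrightarrow> ols_objective f m h n x (a, b) \<le> sample_ip n e e"
  proof
    assume "ols_minimizer f m h n x (a, b)"
    then have "\<not> ols_objective f m h n x (a0, Matrix.vec m b0) < ols_objective f m h n x (a, b)"
      unfolding ols_minimizer_def is_arg_min_def by auto
    then show "ols_objective f m h n x (a, b) \<le> sample_ip n e e" using D0 by simp
  next
    assume "ols_objective f m h n x (a, b) \<le> sample_ip n e e"
    then show "ols_minimizer f m h n x (a, b)"
      unfolding ols_minimizer_def is_arg_min_def using True ge
      by (auto simp: not_less) (meson dual_order.trans not_less)
  qed
  also have "\<dots> \<longleftrightarrow> (\<Sum>i<n. ((a0 - a) + (\<Sum>j<m. (b0 j - vec_index b j) * h j (x i)))\<^sup>2) \<le> 0"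
    using D[OF True] by auto
  also have "\<dots> \<longleftrightarrow> (\<Sum>i<n. ((a0 - a) + (\<Sum>j<m. (b0 j - vec_index b j) * h j (x i)))\<^sup>2) = 0"
    by (intro order_antisym_conv[THEN sym] iffI antisym sum_nonneg) auto
  also have "\<dots> \<longleftrightarrow> (\<forall>i<n. (a0 - a) + (\<Sum>j<m. (b0 j - vec_index b j) * h j (x i)) = 0)"
    by (subst sum_nonneg_eq_0_iff) auto
  finally show ?thesis using True by simp
qed (auto simp: ols_minimizer_def is_arg_min_def)

text \<open>Here \<open>u\<close> is the residual of the constant vector \<open>1\<close> on the controls. Testing the normal equations with \<open>u\<close>
  isolates the intercept. If \<open>u\<close> vanishes on the sample, the intercept is arbitrary and both sides
  are \<open>0\<close>, the left one by definition of the estimator and the right one by division by zero.\<close>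

lemma ols_estimator_eq:
  assumes dec: "\<And>i. i < n \<Longrightarrow> f (x i) = e i + a0 + (\<Sum>j<m. b0 j * h j (x i))"
    and e1: "sample_ip n e (\<lambda>_. 1) = 0"
    and eh: "\<And>j. j < m \<Longrightarrow> sample_ip n e (\<lambda>i. h j (x i)) = 0"
    and u: "\<And>i. i < n \<Longrightarrow> u i = 1 - (\<Sum>j<m. c j * h j (x i))"
    and uh: "\<And>j. j < m \<Longrightarrow> sample_ip n u (\<lambda>i. h j (x i)) = 0"
  shows "ols_estimator f m h n x = sample_ip n u (\<lambda>i. f (x i)) / sample_ip n u u"
proof -
  have Min: "ols_minimizer f m h n x (a, b) \<longleftrightarrow>
      b \<in> carrier_vec m \<and> (\<forall>i<n. (a0 - a) + (\<Sum>j<m. (b0 j - vec_index b j) * h j (x i)) = 0)" for a b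
    by (rule ols_minimizer_iff) (use dec e1 eh in auto)
  have lin: "sample_ip n u (\<lambda>i. t i + (\<Sum>j<m. d j * h j (x i))) = sample_ip n u t" for d t
  proof -
    have "sample_ip n u (\<lambda>i. t i + (\<Sum>j<m. d j * h j (x i))) =
        sample_ip n u t + (\<Sum>j<m. d j * sample_ip n u (\<lambda>i. h j (x i)))"
      unfolding sample_ip_def
      by (simp add: distrib_left sum.distrib sum_distrib_left mult.left_commute sum.swap[of _ "{..<m}"])
    then show ?thesis using uh by simp
  qed
  have ue: "sample_ip n u e = 0"
  proof -
    have "sample_ip n u e = (\<Sum>i<n. (1 - (\<Sum>j<m. c j * h j (x i))) * e i)"
      unfolding sample_ip_def using u by simp
    also have "\<dots> = sample_ip n e (\<lambda>_. 1) - (\<Sum>j<m. c j * sample_ip n e (\<lambda>i. h j (x i)))"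
      unfolding sample_ip_def sum_distrib_left
      by (subst sum.swap)
        (simp add: algebra_simps sum_subtractf sum_distrib_left)
    finally show ?thesis using e1 eh by simp
  qed
  have u1: "sample_ip n u (\<lambda>_. 1) = sample_ip n u u"
  proof -
    have "sample_ip n u u = sample_ip n u (\<lambda>i. 1 + (\<Sum>j<m. (- c j) * h j (x i)))"
      unfolding sample_ip_def using u by (intro sum.cong) (auto simp: sum_negf)
    also have "\<dots> = sample_ip n u (\<lambda>_. 1)" by (rule lin)
    finally show ?thesis by simp
  qed
  have const: "sample_ip n u (\<lambda>_. t) = t * sample_ip n u u" for t
    using u1 by (simp add: sample_ip_def sum_distrib_left[symmetric] mult.commute[of _ t])
  have uf: "sample_ip n u (\<lambda>i. f (x i)) = a0 * sample_ip n u u"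
  proof -
    have "sample_ip n u (\<lambda>i. f (x i)) = sample_ip n u (\<lambda>i. (e i + a0) + (\<Sum>j<m. b0 j * h j (x i)))"
      unfolding sample_ip_def using dec by simp
    also have "\<dots> = sample_ip n u (\<lambda>i. e i + a0)" by (rule lin)
    also have "\<dots> = sample_ip n u e + sample_ip n u (\<lambda>_. a0)"
      by (simp add: sample_ip_def distrib_left sum.distrib)
    finally show ?thesis using ue const by simp
  qed
  show ?thesis
  proof (cases "sample_ip n u u = 0")
    case False
    have "(\<exists>b. ols_minimizer f m h n x (a, b)) \<longleftrightarrow> a = a0" for a
    proof
      assume "\<exists>b. ols_minimizer f m h n x (a, b)"
      then obtain b where z: "\<forall>i<n. (a0 - a) + (\<Sum>j<m. (b0 j - vec_index b j) * h j (x i)) = 0"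
        using Min by auto
      have "0 = sample_ip n u (\<lambda>i. (a0 - a) + (\<Sum>j<m. (b0 j - vec_index b j) * h j (x i)))"
        using z by (simp add: sample_ip_def)
      also have "\<dots> = (a0 - a) * sample_ip n u u" by (simp add: lin const)
      finally show "a = a0" using False by simp
    next
      assume "a = a0"
      then show "\<exists>b. ols_minimizer f m h n x (a, b)" using Min
        by (intro exI[of _ "Matrix.vec m b0"]) auto
    qed
    then have "ols_estimator f m h n x = a0" by (simp add: ols_estimator_def)
    then show ?thesis using uf False by simp
  next
    case True
    then have u0: "1 = (\<Sum>j<m. c j * h j (x i))" if "i < n" for i
      using u that by (simp add: sample_ip_self_eq_0)
    \<comment> \<open>The constant lies in the column space, so every intercept can be compensated by the slopes.\<close>
    have "\<exists>b. ols_minimizer f m h n x (a, b)" for a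
    proof (intro exI)
      show "ols_minimizer f m h n x (a, Matrix.vec m (\<lambda>j. b0 j + (a0 - a) * c j))"
        unfolding Min
      proof (intro conjI allI impI)
        fix i assume i: "i < n"
        have "(\<Sum>j<m. (b0 j - Matrix.vec m (\<lambda>j. b0 j + (a0 - a) * c j) $ j) * h j (x i)) =
           (\<Sum>j<m. - (a0 - a) * (c j * h j (x i)))"
          by (intro sum.cong) (auto simp: algebra_simps)
        also have "\<dots> = - (a0 - a)" using u0[OF i] by (simp add: sum_distrib_left[symmetric])
        finally show "a0 - a + (\<Sum>j<m. (b0 j - Matrix.vec m (\<lambda>j. b0 j + (a0 - a) * c j) $ j) * h j (x i)) = 0"
          by simp
      qed simp
    qed
    then have "\<not> (\<exists>!a. \<exists>b. ols_minimizer f m h n x (a, b))"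
      using zero_neq_one[where 'a = real] by blast
    then show ?thesis using True by (simp add: ols_estimator_def)
  qed
qed

definition ols_residual :: "nat \<Rightarrow> (nat \<Rightarrow> 's \<Rightarrow> real) \<Rightarrow> nat \<Rightarrow> (nat \<Rightarrow> 's) \<Rightarrow> (nat \<Rightarrow> real) \<Rightarrow> nat \<Rightarrow> real" where
  "ols_residual m h n x = gs_residual (sample_ip n) (\<lambda>j i. h j (x i)) m"

lemma ols_residual_span: "\<exists>b. \<forall>i. ols_residual m h n x v i = v i - (\<Sum>j<m. b j * h j (x i))"
  unfolding ols_residual_def by (rule sample.gs_residual_span)

lemma ols_residual_orthogonal:
  "j < m \<Longrightarrow> sample_ip n (ols_residual m h n x v) (\<lambda>i. h j (x i)) = 0"
  unfolding ols_residual_def by (rule sample.gs_residual_orthogonal) auto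

text \<open>The projection on the orthogonal complement of the column space is self-adjoint and idempotent.\<close>

lemma ols_residual_ip:
  "sample_ip n (ols_residual m h n x v) (ols_residual m h n x w) = sample_ip n (ols_residual m h n x v) w"
proof -
  let ?r = "ols_residual m h n x v"
  obtain b where b: "\<And>i. ols_residual m h n x w i = w i - (\<Sum>j<m. b j * h j (x i))"
    using ols_residual_span by blast
  have "sample_ip n ?r (ols_residual m h n x w) =
      sample_ip n ?r w - sample_ip n ?r (\<lambda>i. \<Sum>j<m. b j * h j (x i))"
    unfolding sample_ip_def b by (simp add: right_diff_distrib sum_subtractf)
  also have "sample_ip n ?r (\<lambda>i. \<Sum>j<m. b j * h j (x i)) = 0"
    by (subst sample_ip_combination[where b=b and G="\<lambda>j i. h j (x i)"]) (auto simp: ols_residual_orthogonal)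
  finally show ?thesis by simp
qed

text \<open>Both estimators through two residual vectors: \<open>U\<close>, that of the constant, and that of the
  errors \<open>E\<close>. The second regression, on the constant, is one more Gram-Schmidt step with the vector
  \<open>U\<close>. Taking \<open>\<mu> = 0\<close>, \<open>b = 0\<close> and \<open>E = f\<close> expresses the estimators by observable quantities,
  which is how their measurability is obtained below.\<close>

lemma ols_via_residuals:
  assumes f: "\<And>i. i < n \<Longrightarrow> f (x i) = \<mu> + (\<Sum>j<m. b j * h j (x i)) + E i"
  defines "U \<equiv> ols_residual m h n x (\<lambda>_. 1)"
  shows "ols_estimator f m h n x = sample_ip n U (\<lambda>i. f (x i)) / sample_ip n U U"
    and "sample_ip n U U \<noteq> 0 \<Longrightarrow> ols_estimator f m h n x - \<mu> = sample_ip n U E / sample_ip n U U"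
    and "ols_variance f m h n x =
      (sample_ip n (ols_residual m h n x E) (ols_residual m h n x E)
        - (sample_ip n U E)\<^sup>2 / sample_ip n U U) / real n"
proof -
  define E' where "E' = ols_residual m h n x E"
  define q where "q = sample_ip n U E / sample_ip n U U"
  define e where "e = (\<lambda>i. E' i - q * U i)"
  obtain c where c: "\<And>i. U i = 1 - (\<Sum>j<m. c j * h j (x i))"
    unfolding U_def using ols_residual_span by blast
  obtain d where d: "\<And>i. E' i = E i - (\<Sum>j<m. d j * h j (x i))"
    unfolding E'_def using ols_residual_span by blast
  have Uh: "sample_ip n U (\<lambda>i. h j (x i)) = 0" if "j < m" for j
    unfolding U_def by (rule ols_residual_orthogonal[OF that])
  have E'h: "sample_ip n E' (\<lambda>i. h j (x i)) = 0" if "j < m" for j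
    unfolding E'_def by (rule ols_residual_orthogonal[OF that])
  have U1: "sample_ip n U (\<lambda>_. 1) = sample_ip n U U"
    unfolding U_def by (rule ols_residual_ip[symmetric])
  have UE: "sample_ip n U E' = sample_ip n U E"
    unfolding U_def E'_def by (rule ols_residual_ip)
  have E'1: "sample_ip n E' (\<lambda>_. 1) = sample_ip n U E"
    using ols_residual_ip[of n m h x E "\<lambda>_. 1"] UE sample.ip_commute[of E' U n]
    unfolding U_def E'_def by simp
  have UE0: "sample_ip n U E = 0" if "sample_ip n U U = 0"
    using sample.ip_null[of U E n] that sample.ip_commute[of U E n] by simp
  have qU: "q * sample_ip n U U = sample_ip n U E"
    using UE0 by (cases "sample_ip n U U = 0") (auto simp: q_def)
  have dec: "f (x i) = e i + (\<mu> + q) + (\<Sum>j<m. (b j + d j - q * c j) * h j (x i))" if "i < n" for i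
  proof -
    have "(\<Sum>j<m. (b j + d j - q * c j) * h j (x i)) =
        (\<Sum>j<m. b j * h j (x i)) + (\<Sum>j<m. d j * h j (x i)) - q * (\<Sum>j<m. c j * h j (x i))"
      by (simp add: distrib_right left_diff_distrib sum.distrib sum_subtractf sum_distrib_left mult.assoc)
    also have "(\<Sum>j<m. c j * h j (x i)) = 1 - U i" using c[of i] by simp
    finally show ?thesis
      using f[OF that] d[of i] by (simp add: e_def right_diff_distrib)
  qed
  have e1: "sample_ip n e (\<lambda>_. 1) = 0"
    unfolding e_def using sample.ip_diff[of E' U "\<lambda>_. 1" n q] E'1 U1 qU by simp
  have eh: "sample_ip n e (\<lambda>i. h j (x i)) = 0" if "j < m" for j
    unfolding e_def using sample.ip_diff[of E' U "\<lambda>i. h j (x i)" n q] E'h[OF that] Uh[OF that] by simp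
  show est: "ols_estimator f m h n x = sample_ip n U (\<lambda>i. f (x i)) / sample_ip n U U"
    by (rule ols_estimator_eq[where e = e and ?a0.0 = "\<mu> + q" and ?b0.0 = "\<lambda>j. b j + d j - q * c j" and c = c])
      (erule dec, rule e1, erule eh, rule c, erule Uh)
  have Uf: "sample_ip n U (\<lambda>i. f (x i)) = \<mu> * sample_ip n U U + sample_ip n U E"
  proof -
    have "sample_ip n U (\<lambda>i. f (x i)) =
        \<mu> * sample_ip n U (\<lambda>_. 1) + sample_ip n U (\<lambda>i. \<Sum>j<m. b j * h j (x i)) + sample_ip n U E"
      unfolding sample_ip_def using f
      by (simp add: distrib_left sum.distrib sum_distrib_left mult.commute[of _ \<mu>])
    moreover have "sample_ip n U (\<lambda>i. \<Sum>j<m. b j * h j (x i)) = 0"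
      by (subst sample_ip_combination[where b=b and G="\<lambda>j i. h j (x i)"]) (auto simp: Uh)
    ultimately show ?thesis using U1 by simp
  qed
  show "ols_estimator f m h n x - \<mu> = sample_ip n U E / sample_ip n U U" if "sample_ip n U U \<noteq> 0"
    unfolding est Uf using that by (simp add: add_divide_distrib)
  have "ols_variance f m h n x = sample_ip n e e / real n"
    by (rule ols_variance_eq[where e = e and ?a0.0 = "\<mu> + q" and ?b0.0 = "\<lambda>j. b j + d j - q * c j"])
      (erule dec, rule e1, erule eh)
  also have "sample_ip n e e = sample_ip n E' E' - 2 * q * sample_ip n U E' + q * (q * sample_ip n U U)"
    unfolding e_def using sample.ip_commute[of E' U n]
    by (simp add: sample_ip_def algebra_simps sum.distrib sum_subtractf sum_distrib_left)
  also have "\<dots> = sample_ip n E' E' - (sample_ip n U E)\<^sup>2 / sample_ip n U U"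
    unfolding qU UE by (simp add: q_def power2_eq_square)
  finally show "ols_variance f m h n x =
      (sample_ip n (ols_residual m h n x E) (ols_residual m h n x E)
        - (sample_ip n U E)\<^sup>2 / sample_ip n U U) / real n"
    by (simp add: E'_def)
qed

lemma gs_residual_measurable:
  assumes H: "\<And>j i. j < k \<Longrightarrow> i < n \<Longrightarrow> (\<lambda>\<omega>. H \<omega> j i) \<in> borel_measurable M"
    and v: "\<And>i. i < n \<Longrightarrow> (\<lambda>\<omega>. v \<omega> i) \<in> borel_measurable M" and i: "i < n"
  shows "(\<lambda>\<omega>. gs_residual (sample_ip n) (H \<omega>) k (v \<omega>) i) \<in> borel_measurable M"
  using assms
proof (induction k arbitrary: v i)
  case (Suc k)
  have [measurable]: "(\<lambda>\<omega>. gs_residual (sample_ip n) (H \<omega>) k (v \<omega>) i) \<in> borel_measurable M" if "i < n" for i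
    using Suc.prems that by (intro Suc.IH) auto
  have [measurable]: "(\<lambda>\<omega>. gs_residual (sample_ip n) (H \<omega>) k (H \<omega> k) i) \<in> borel_measurable M" if "i < n" for i
    using Suc.prems that by (intro Suc.IH) auto
  show ?case
    using Suc.prems(3) unfolding gs_residual.simps Let_def sample_ip_def
    by (intro borel_measurable_diff borel_measurable_times borel_measurable_divide borel_measurable_sum)
      (auto simp flip: sample_ip_def)
qed simp

lemma sample_ip_measurable:
  assumes "\<And>i. i < n \<Longrightarrow> (\<lambda>\<omega>. u \<omega> i) \<in> borel_measurable M" "\<And>i. i < n \<Longrightarrow> (\<lambda>\<omega>. v \<omega> i) \<in> borel_measurable M"
  shows "(\<lambda>\<omega>. sample_ip n (u \<omega>) (v \<omega>)) \<in> borel_measurable M"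
  unfolding sample_ip_def using assms by (intro borel_measurable_sum borel_measurable_times) auto

lemma ols_measurable:
  assumes f: "f \<in> borel_measurable P" and h: "\<And>j. j < m \<Longrightarrow> h j \<in> borel_measurable P"
    and X: "\<And>i. i < n \<Longrightarrow> X i \<in> measurable M P"
  shows "(\<lambda>\<omega>. ols_estimator f m h n (\<lambda>i. X i \<omega>)) \<in> borel_measurable M"
    and "(\<lambda>\<omega>. ols_variance f m h n (\<lambda>i. X i \<omega>)) \<in> borel_measurable M"
proof -
  have hX: "(\<lambda>\<omega>. h j (X i \<omega>)) \<in> borel_measurable M" if "j < m" "i < n" for i j
    using measurable_compose[OF X h] that by auto
  have fX: "(\<lambda>\<omega>. f (X i \<omega>)) \<in> borel_measurable M" if "i < n" for i
    using measurable_compose[OF X f] that by auto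
  have U: "(\<lambda>\<omega>. ols_residual m h n (\<lambda>i. X i \<omega>) (\<lambda>_. 1) i) \<in> borel_measurable M"
    and F: "(\<lambda>\<omega>. ols_residual m h n (\<lambda>i. X i \<omega>) (\<lambda>i. f (X i \<omega>)) i) \<in> borel_measurable M" if "i < n" for i
    unfolding ols_residual_def by (rule gs_residual_measurable; use hX fX that in simp)+
  note resid = ols_via_residuals[where \<mu> = 0 and b = "\<lambda>_. 0" and f = f and m = m and h = h and n = n
      and x = "\<lambda>i. X i \<omega>" and E = "\<lambda>i. f (X i \<omega>)" for \<omega>]
  have est: "ols_estimator f m h n (\<lambda>i. X i \<omega>) =
      sample_ip n (ols_residual m h n (\<lambda>i. X i \<omega>) (\<lambda>_. 1)) (\<lambda>i. f (X i \<omega>)) /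
      sample_ip n (ols_residual m h n (\<lambda>i. X i \<omega>) (\<lambda>_. 1)) (ols_residual m h n (\<lambda>i. X i \<omega>) (\<lambda>_. 1))" for \<omega>
    by (rule resid(1)) simp
  have var: "ols_variance f m h n (\<lambda>i. X i \<omega>) =
      (sample_ip n (ols_residual m h n (\<lambda>i. X i \<omega>) (\<lambda>i. f (X i \<omega>))) (ols_residual m h n (\<lambda>i. X i \<omega>) (\<lambda>i. f (X i \<omega>)))
        - (sample_ip n (ols_residual m h n (\<lambda>i. X i \<omega>) (\<lambda>_. 1)) (\<lambda>i. f (X i \<omega>)))\<^sup>2 /
          sample_ip n (ols_residual m h n (\<lambda>i. X i \<omega>) (\<lambda>_. 1)) (ols_residual m h n (\<lambda>i. X i \<omega>) (\<lambda>_. 1))) / real n" for \<omega>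
    by (rule resid(3)) simp
  show "(\<lambda>\<omega>. ols_estimator f m h n (\<lambda>i. X i \<omega>)) \<in> borel_measurable M"
    unfolding est
    using U fX by (intro borel_measurable_divide sample_ip_measurable) auto
  show "(\<lambda>\<omega>. ols_variance f m h n (\<lambda>i. X i \<omega>)) \<in> borel_measurable M"
    unfolding var
    using U F fX by (intro borel_measurable_divide borel_measurable_diff borel_measurable_power
      borel_measurable_const sample_ip_measurable) auto
qed

section \<open>Leverage and orthonormal bases\<close>

lemma L2_fun_prod_integrable:
  assumes "L2_fun P u" "L2_fun P v"
  shows "integrable P (\<lambda>x. u x * v x)"
proof (rule Bochner_Integration.integrable_bound)
  show "integrable P (\<lambda>x. (u x)\<^sup>2 + (v x)\<^sup>2)" using assms by (simp add: L2_fun_def)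
  show "(\<lambda>x. u x * v x) \<in> borel_measurable P"
    using assms by (intro borel_measurable_times) (auto simp: L2_fun_def)
  have "\<bar>u x * v x\<bar> \<le> (u x)\<^sup>2 + (v x)\<^sup>2" for x
  proof -
    have "2 * (\<bar>u x\<bar> * \<bar>v x\<bar>) \<le> (u x)\<^sup>2 + (v x)\<^sup>2"
      using sum_squares_bound[of "\<bar>u x\<bar>" "\<bar>v x\<bar>"] by simp
    moreover have "0 \<le> \<bar>u x\<bar> * \<bar>v x\<bar>" by simp
    ultimately show ?thesis unfolding abs_mult by linarith
  qed
  then show "AE x in P. norm (u x * v x) \<le> norm ((u x)\<^sup>2 + (v x)\<^sup>2)" by simp
qed

lemma L2_fun_comb:
  assumes "L2_fun P u" "L2_fun P v"
  shows "L2_fun P (\<lambda>x. u x + c * v x)"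
proof -
  have "(u x + c * v x)\<^sup>2 = (u x)\<^sup>2 + (2 * c * (u x * v x) + c\<^sup>2 * (v x)\<^sup>2)" for x
    by (simp add: power2_eq_square algebra_simps)
  then have "integrable P (\<lambda>x. (u x + c * v x)\<^sup>2)"
    using assms L2_fun_prod_integrable[OF assms] by (simp add: L2_fun_def)
  moreover have [measurable]: "u \<in> borel_measurable P" "v \<in> borel_measurable P"
    using assms by (simp_all add: L2_fun_def)
  have "(\<lambda>x. u x + c * v x) \<in> borel_measurable P" by measurable
  ultimately show ?thesis by (simp add: L2_fun_def)
qed

lemma L2_semi_inner: "semi_inner_functions {u. L2_fun P u} (\<lambda>u v. \<integral>x. u x * v x \<partial>P)"
proof
  fix u v w :: "'a \<Rightarrow> real" and c :: real
  assume "u \<in> {u. L2_fun P u}" "v \<in> {u. L2_fun P u}" "w \<in> {u. L2_fun P u}"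
  then show "(\<integral>x. (u x + c * v x) * w x \<partial>P) = (\<integral>x. u x * w x \<partial>P) + c * (\<integral>x. v x * w x \<partial>P)"
    using L2_fun_prod_integrable[of P u w] L2_fun_prod_integrable[of P v w]
    by (simp add: distrib_right mult.assoc)
qed (auto simp: L2_fun_comb mult.commute, simp add: L2_fun_def)

lemma L2_null_AE:
  assumes "L2_fun P u" "(\<integral>x. u x * u x \<partial>P) = 0"
  shows "AE x in P. u x = 0"
  using assms integral_nonneg_eq_0_iff_AE[of P "\<lambda>x. u x * u x"] L2_fun_prod_integrable[of P u u] by simp

definition orthonormal_L2 :: "'s measure \<Rightarrow> nat \<Rightarrow> (nat \<Rightarrow> 's \<Rightarrow> real) \<Rightarrow> bool" where
  "orthonormal_L2 P m g \<longleftrightarrow> (\<forall>k<m. L2_fun P (g k)) \<and>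
     (\<forall>k<m. \<forall>l<m. (\<integral>x. g k x * g l x \<partial>P) = (if k = l then 1 else 0))"

text \<open>Linear independence up to null sets is exactly definiteness of the Gram form.\<close>

lemma lin_indep_L2_null:
  assumes h: "\<And>j. j < m \<Longrightarrow> L2_fun P (h j)" and ind: "lin_indep_L2 P m h"
    and 0: "(\<integral>x. (\<Sum>j<m. c j * h j x) * (\<Sum>j<m. c j * h j x) \<partial>P) = 0"
  shows "\<forall>j<m. c j = 0"
proof -
  interpret semi_inner_functions "{u. L2_fun P u}" "\<lambda>u v. \<integral>x. u x * v x \<partial>P" by (rule L2_semi_inner)
  have "L2_fun P (\<lambda>x. \<Sum>j<m. c j * h j x)" using sum_closed[of m h c] h by simp
  from L2_null_AE[OF this 0] ind show ?thesis by (simp add: lin_indep_L2_def)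
qed

lemma gram_matrix_inverse:
  assumes h: "\<And>j. j < m \<Longrightarrow> L2_fun P (h j)" and ind: "lin_indep_L2 P m h"
  obtains R where "mat_inverse (gram_matrix P m h) = Some R" "R \<in> carrier_mat m m"
    "gram_matrix P m h * R = 1\<^sub>m m"
proof -
  interpret semi_inner_functions "{u. L2_fun P u}" "\<lambda>u v. \<integral>x. u x * v x \<partial>P" by (rule L2_semi_inner)
  let ?G = "gram_matrix P m h"
  have G: "?G \<in> carrier_mat m m" by (simp add: gram_matrix_def)
  have "det ?G \<noteq> 0"
  proof
    assume "det ?G = 0"
    then obtain v where v: "v \<in> carrier_vec m" "v \<noteq> 0\<^sub>v m" "?G *\<^sub>v v = 0\<^sub>v m"
      using det_0_iff_vec_prod_zero_field[OF G] by auto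
    define s where "s = (\<lambda>x. \<Sum>k<m. vec_index v k * h k x)"
    have s: "L2_fun P s" using sum_closed[of m h "vec_index v"] h by (simp add: s_def)
    have hs: "(\<integral>x. h j x * s x \<partial>P) = 0" if j: "j < m" for j
    proof -
      have "(\<integral>x. h j x * s x \<partial>P) = (\<integral>x. s x * h j x \<partial>P)" by (simp add: mult.commute)
      also have "\<dots> = (\<Sum>k<m. vec_index v k * (\<integral>x. h k x * h j x \<partial>P))"
        unfolding s_def using ip_sum[of m h "h j" "vec_index v"] h j by simp
      also have "\<dots> = vec_index (?G *\<^sub>v v) j"
        using j v(1) by (simp add: gram_matrix_def scalar_prod_def atLeast0LessThan mult.commute)
      finally show ?thesis using v(3) j by simp
    qed
    have "(\<integral>x. s x * s x \<partial>P) = (\<Sum>k<m. vec_index v k * (\<integral>x. h k x * s x \<partial>P))"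
      using ip_sum[of m h s "vec_index v"] h s unfolding s_def by simp
    also have "\<dots> = 0" using hs by simp
    finally have "\<forall>j<m. vec_index v j = 0"
      unfolding s_def by (intro lin_indep_L2_null[OF h ind])
    then have "v = 0\<^sub>v m" using v(1) by (intro eq_vecI) auto
    with v(2) show False by simp
  qed
  then have unit: "?G \<in> Units (ring_mat TYPE(real) m ())" by (rule det_non_zero_imp_unit[OF G])
  then obtain R where R: "mat_inverse ?G = Some R"
    using mat_inverse(1)[OF G, where b = "()"] by (cases "mat_inverse ?G") auto
  with mat_inverse(2)[OF G R] show thesis using that by blast
qed

text \<open>For fixed \<open>x\<close> let \<open>K = \<Sum> c\<^sub>j h\<^sub>j\<close> with \<open>c = R h(x)\<close>, \<open>R\<close> the inverse Gram matrix. This is the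
  reproducing kernel of the span at \<open>x\<close>: integrating it against an element of the span evaluates that element at \<open>x\<close>.
  Its coordinates in the orthonormal basis are therefore \<open>g\<^sub>k(x)\<close>, and the leverage
  is \<open>K(x)\<close>.\<close>

lemma leverage_orthonormal_basis:
  assumes h: "\<And>j. j < m \<Longrightarrow> L2_fun P (h j)" and ind: "lin_indep_L2 P m h"
    and g: "orthonormal_L2 P m g"
    and A: "\<And>k x. k < m \<Longrightarrow> g k x = (\<Sum>j<m. A k j * h j x)"
    and B: "\<And>j x. j < m \<Longrightarrow> h j x = (\<Sum>k<m. B j k * g k x)"
  shows "leverage P m h x = (\<Sum>k<m. (g k x)\<^sup>2)"
proof -
  interpret semi_inner_functions "{u. L2_fun P u}" "\<lambda>u v. \<integral>x. u x * v x \<partial>P" by (rule L2_semi_inner)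
  let ?G = "gram_matrix P m h" and ?ip = "\<lambda>u v. \<integral>x. u x * v x \<partial>P"
  have G: "?G \<in> carrier_mat m m" by (simp add: gram_matrix_def)
  obtain R where R: "mat_inverse ?G = Some R" "R \<in> carrier_mat m m" "?G * R = 1\<^sub>m m"
    using gram_matrix_inverse[OF h ind] by metis
  define hv where "hv = control_vec m h x"
  define cv where "cv = R *\<^sub>v hv"
  define c where "c = vec_index cv"
  have hv: "hv \<in> carrier_vec m" "\<And>j. j < m \<Longrightarrow> vec_index hv j = h j x"
    by (auto simp: hv_def control_vec_def)
  have cv: "cv \<in> carrier_vec m" using R(2) hv by (simp add: cv_def)
  have Gc: "?G *\<^sub>v cv = hv"
    unfolding cv_def using assoc_mult_mat_vec[OF G R(2) hv(1)] R(3) hv(1) by simp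
  define K where "K = (\<lambda>y. \<Sum>j<m. c j * h j y)"
  have K: "L2_fun P K" using sum_closed[of m h c] h by (simp add: K_def)
  have hK: "?ip (h j) K = h j x" if j: "j < m" for j
  proof -
    have "?ip (h j) K = ?ip K (h j)" by (simp add: mult.commute)
    also have "\<dots> = (\<Sum>k<m. c k * ?ip (h k) (h j))"
      unfolding K_def using ip_sum[of m h "h j" c] h j by simp
    also have "\<dots> = vec_index (?G *\<^sub>v cv) j"
      using j cv by (simp add: gram_matrix_def scalar_prod_def atLeast0LessThan mult.commute c_def)
    finally show ?thesis using Gc hv(2)[OF j] by simp
  qed
  have gK: "?ip (g k) K = g k x" if k: "k < m" for k
  proof -
    have "g k = (\<lambda>y. \<Sum>j<m. A k j * h j y)" using A[OF k] by auto
    then have "?ip (g k) K = (\<Sum>j<m. A k j * ?ip (h j) K)"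
      using ip_sum[of m h K "A k"] h K by simp
    also have "\<dots> = g k x" using hK A[OF k] by simp
    finally show ?thesis .
  qed
  define d where "d k = (\<Sum>j<m. c j * B j k)" for k
  have Kd: "K y = (\<Sum>k<m. d k * g k y)" for y
  proof -
    have "K y = (\<Sum>j<m. \<Sum>k<m. c j * B j k * g k y)"
      using B by (simp add: K_def sum_distrib_left mult.assoc)
    also have "\<dots> = (\<Sum>k<m. \<Sum>j<m. c j * B j k * g k y)" by (rule sum.swap)
    finally show ?thesis by (simp add: d_def sum_distrib_right)
  qed
  have dg: "d k = g k x" if k: "k < m" for k
  proof -
    have "g k x = ?ip K (g k)" using gK[OF k] by (simp add: mult.commute)
    also have "K = (\<lambda>y. \<Sum>l<m. d l * g l y)" using Kd by auto
    also have "?ip \<dots> (g k) = (\<Sum>l<m. d l * ?ip (g l) (g k))"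
      using ip_sum[of m g "g k" d] g k by (simp add: orthonormal_L2_def)
    also have "\<dots> = (\<Sum>l<m. if l = k then d l else 0)"
      using g k by (intro sum.cong) (auto simp: orthonormal_L2_def)
    also have "\<dots> = d k" using k by simp
    finally show ?thesis by simp
  qed
  have "leverage P m h x = scalar_prod hv cv"
    by (simp add: leverage_def R(1) hv_def cv_def)
  also have "\<dots> = K x"
    using cv hv by (simp add: scalar_prod_def atLeast0LessThan K_def c_def mult.commute)
  also have "\<dots> = (\<Sum>k<m. (g k x)\<^sup>2)"
    using Kd[of x] dg by (simp add: power2_eq_square)
  finally show ?thesis .
qed

lemma control_orthonormal_basis:
  assumes h: "\<And>j. j < m \<Longrightarrow> L2_fun P (h j)" and ind: "lin_indep_L2 P m h"
  obtains g A B where "orthonormal_L2 P m g"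
    "\<And>k x. k < m \<Longrightarrow> g k x = (\<Sum>j<m. A k j * h j x)"
    "\<And>j x. j < m \<Longrightarrow> h j x = (\<Sum>k<m. B j k * g k x)"
    "\<And>x. leverage P m h x = (\<Sum>k<m. (g k x)\<^sup>2)"
proof -
  interpret semi_inner_functions "{u. L2_fun P u}" "\<lambda>u v. \<integral>x. u x * v x \<partial>P" by (rule L2_semi_inner)
  obtain g A B where g: "\<And>k. k < m \<Longrightarrow> g k \<in> {u. L2_fun P u}"
    "\<And>k l. k < m \<Longrightarrow> l < m \<Longrightarrow> (\<integral>x. g k x * g l x \<partial>P) = (if k = l then 1 else 0)"
    and A: "\<And>k x. k < m \<Longrightarrow> g k x = (\<Sum>j<m. A k j * h j x)"
    and B: "\<And>j x. j < m \<Longrightarrow> h j x = (\<Sum>k<m. B j k * g k x)"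
  proof (rule orthonormal_basis[of m h], goal_cases)
    case (1 j) show ?case using h[OF 1(2)] by simp
  next
    case (2 c) show ?case by (rule lin_indep_L2_null[OF h ind 2(2)])
  next
    case (3 g A B) show ?case by (rule 3(1)[OF 3(2-5)])
  qed
  have "orthonormal_L2 P m g" using g by (auto simp: orthonormal_L2_def)
  from that[OF this A B leverage_orthonormal_basis[OF h ind this A B]] show thesis .
qed

section \<open>Projections under a nearly orthonormal design\<close>

text \<open>The squared Frobenius distance between the empirical Gram matrix of \<open>G\<close> and the identity; the index \<open>k\<close>
  of \<open>G k i\<close> is the function and \<open>i\<close> the observation.\<close>

definition gram_deviation :: "nat \<Rightarrow> nat \<Rightarrow> (nat \<Rightarrow> nat \<Rightarrow> real) \<Rightarrow> real" where
  "gram_deviation n m G =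
     (\<Sum>(k, l)\<in>{..<m} \<times> {..<m}. (sample_ip n (G k) (G l) / real n - (if k = l then 1 else 0))\<^sup>2)"

definition cross_moments :: "nat \<Rightarrow> nat \<Rightarrow> (nat \<Rightarrow> nat \<Rightarrow> real) \<Rightarrow> (nat \<Rightarrow> real) \<Rightarrow> real" where
  "cross_moments n m G z = (\<Sum>k<m. (sample_ip n z (G k) / real n)\<^sup>2)"

lemma cross_moments_nonneg: "0 \<le> cross_moments n m G z"
  by (simp add: cross_moments_def sum_nonneg)

lemma gram_deviation_nonneg: "0 \<le> gram_deviation n m G"
  by (auto simp: gram_deviation_def intro!: sum_nonneg)

text \<open>The Frobenius norm dominates the operator norm, so the smallest eigenvalue of the empirical Gram matrix is at
  least \<open>1 - 1/2\<close>.\<close>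

lemma gram_lower_bound:
  assumes n: "0 < n" and dev: "gram_deviation n m G \<le> 1 / 4"
    and p: "\<And>i. i < n \<Longrightarrow> p i = (\<Sum>k<m. b k * G k i)"
  shows "real n * (\<Sum>k<m. (b k)\<^sup>2) \<le> 2 * sample_ip n p p"
proof -
  define d :: "nat \<Rightarrow> nat \<Rightarrow> real" where "d k l = (if k = l then 1 else 0)" for k l
  define N where "N k l = sample_ip n (G k) (G l) / real n - d k l" for k l
  define s where "s = (\<Sum>k<m. (b k)\<^sup>2)"
  let ?I = "{..<m} \<times> {..<m}"
  have s0: "0 \<le> s" by (simp add: s_def sum_nonneg)
  have "(\<Sum>(k, l)\<in>?I. (b k * b l) * N k l)\<^sup>2 \<le> (\<Sum>(k, l)\<in>?I. (b k * b l)\<^sup>2) * (\<Sum>(k, l)\<in>?I. (N k l)\<^sup>2)"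
    using Cauchy_Schwarz_ineq_sum[of "\<lambda>(k, l). b k * b l" "\<lambda>(k, l). N k l" ?I]
    by (simp add: case_prod_unfold)
  also have "(\<Sum>(k, l)\<in>?I. (N k l)\<^sup>2) = gram_deviation n m G"
    by (simp add: gram_deviation_def N_def d_def)
  also have "(\<Sum>(k, l)\<in>?I. (b k * b l)\<^sup>2) = s\<^sup>2"
    by (simp add: s_def power2_eq_square[of "sum _ _"] sum_product sum.cartesian_product power_mult_distrib)
  also have "s\<^sup>2 * gram_deviation n m G \<le> s\<^sup>2 * (1 / 4)"
    by (rule mult_left_mono[OF dev]) simp
  also have "\<dots> = (s / 2)\<^sup>2" by (simp add: power_divide)
  finally have "\<bar>\<Sum>(k, l)\<in>?I. (b k * b l) * N k l\<bar> \<le> \<bar>s / 2\<bar>"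
    by (simp only: abs_le_square_iff)
  then have "\<bar>\<Sum>(k, l)\<in>?I. (b k * b l) * N k l\<bar> \<le> s / 2"
    using s0 by simp
  moreover have "sample_ip n p p / real n = s + (\<Sum>(k, l)\<in>?I. (b k * b l) * N k l)"
  proof -
    have "sample_ip n p (G k) = (\<Sum>l<m. b l * sample_ip n (G k) (G l))" for k
      using sample_ip_combination[where z = "G k", OF p] sample.ip_commute[of p "G k"] by simp
    then have "sample_ip n p p = (\<Sum>k<m. b k * (\<Sum>l<m. b l * sample_ip n (G k) (G l)))"
      using sample_ip_combination[where z = p, OF p] by simp
    then have "sample_ip n p p / real n = (\<Sum>k<m. \<Sum>l<m. (b k * b l) * (d k l + N k l))"
      by (simp add: N_def sum_divide_distrib sum_distrib_left mult.assoc)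
    also have "\<dots> = (\<Sum>k<m. \<Sum>l<m. (b k * b l) * d k l) + (\<Sum>(k, l)\<in>?I. (b k * b l) * N k l)"
      by (simp add: distrib_left sum.distrib sum.cartesian_product)
    also have "(\<Sum>k<m. \<Sum>l<m. (b k * b l) * d k l) = s"
      by (simp add: d_def s_def power2_eq_square if_distrib[of "\<lambda>t. _ * t"] cong: if_cong)
    finally show ?thesis .
  qed
  ultimately have "s / 2 \<le> sample_ip n p p / real n" by linarith
  with n show ?thesis by (simp add: s_def field_simps)
qed

lemma projection_cross_bound:
  assumes n: "0 < n" and dev: "gram_deviation n m G \<le> 1 / 4"
    and p: "\<And>i. i < n \<Longrightarrow> p i = (\<Sum>k<m. b k * G k i)"
  shows "(sample_ip n z p)\<^sup>2 \<le> 2 * real n * sample_ip n p p * cross_moments n m G z"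
proof -
  have "sample_ip n z p = real n * (\<Sum>k<m. b k * (sample_ip n z (G k) / real n))"
    using sample_ip_combination[where z = z, OF p] n by (simp add: sum_distrib_left)
  then have "(sample_ip n z p)\<^sup>2 = (real n)\<^sup>2 * (\<Sum>k<m. b k * (sample_ip n z (G k) / real n))\<^sup>2"
    by (simp add: power_mult_distrib)
  also have "\<dots> \<le> (real n)\<^sup>2 * ((\<Sum>k<m. (b k)\<^sup>2) * cross_moments n m G z)"
    unfolding cross_moments_def by (intro mult_left_mono Cauchy_Schwarz_ineq_sum) simp
  also have "\<dots> = real n * cross_moments n m G z * (real n * (\<Sum>k<m. (b k)\<^sup>2))"
    by (simp add: power2_eq_square mult_ac)
  also have "\<dots> \<le> real n * cross_moments n m G z * (2 * sample_ip n p p)"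
    by (intro mult_left_mono gram_lower_bound[OF n dev p]) (simp_all add: cross_moments_nonneg)
  finally show ?thesis by (simp add: mult_ac)
qed

text \<open>If \<open>p\<close> is the projection of \<open>z\<close>, the previous bound applied to \<open>z\<close> itself reads
  \<open>|p|\<^sup>4 \<le> 2 n |p|\<^sup>2 \<cdot> |P\<^sub>n(z g)|\<^sup>2\<close>, and a factor \<open>|p|\<^sup>2\<close> cancels.\<close>

lemma projection_norm_bound:
  assumes n: "0 < n" and dev: "gram_deviation n m G \<le> 1 / 4"
    and p: "\<And>i. i < n \<Longrightarrow> p i = (\<Sum>k<m. b k * G k i)"
    and proj: "sample_ip n z p = sample_ip n p p"
  shows "sample_ip n p p \<le> 2 * real n * cross_moments n m G z"
proof (cases "sample_ip n p p = 0")
  case True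
  then show ?thesis by (simp add: cross_moments_nonneg)
next
  case False
  then have pos: "sample_ip n p p > 0" using sample.ip_nonneg[of p n] by simp
  have "sample_ip n p p * sample_ip n p p \<le> sample_ip n p p * (2 * real n * cross_moments n m G z)"
    using projection_cross_bound[where z = z, OF n dev p] proj by (simp add: power2_eq_square mult_ac)
  with pos show ?thesis by (simp only: mult_le_cancel_left_pos)
qed

text \<open>The numbers \<open>v\<close>, \<open>w\<close>, \<open>r\<close> are \<open>|p|\<^sup>2 / n\<close>, \<open>\<langle>E, p\<rangle> / (\<sigma> \<surd>n)\<close> and the normalised squared length of the projection
  of \<open>E\<close>, where \<open>p\<close> projects the constant on the column space. The statement is deterministic; the bound
  \<open>a \<le> 1/4\<close> keeps \<open>1 - v\<close> above \<open>1/2\<close> and so excludes the degenerate design.\<close>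

lemma ols_stochastic_expansion:
  assumes f: "\<And>i. i < n \<Longrightarrow> f (x i) = \<mu> + (\<Sum>j<m. b j * h j (x i)) + E i"
    and n: "0 < n" and \<sigma>: "0 < \<sigma>"
    and B: "\<And>j i. j < m \<Longrightarrow> i < n \<Longrightarrow> h j (x i) = (\<Sum>k<m. B j k * G k i)"
    and dev: "gram_deviation n m G \<le> 1 / 4"
  defines "a \<equiv> cross_moments n m G (\<lambda>_. 1)" and "c \<equiv> cross_moments n m G (\<lambda>i. E i / \<sigma>)"
    and "T \<equiv> (\<Sum>i<n. E i) / (\<sigma> * sqrt n)"
  assumes a: "a \<le> 1 / 4"
  obtains v w r where "0 \<le> v" "v \<le> 2 * a" "w\<^sup>2 \<le> 4 * (real n * a * c)" "0 \<le> r" "r \<le> 2 * c"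
    "sqrt n / \<sigma> * (ols_estimator f m h n x - \<mu>) = (T - w) / (1 - v)"
    "ols_variance f m h n x / \<sigma>\<^sup>2 =
      (\<Sum>i<n. (E i / \<sigma>)\<^sup>2) / real n - r - (T - w)\<^sup>2 / (real n * (1 - v))"
proof -
  have in_span: "\<exists>\<gamma>. \<forall>i<n. z i - ols_residual m h n x z i = (\<Sum>k<m. \<gamma> k * G k i)" for z
  proof -
    obtain d where d: "\<And>i. ols_residual m h n x z i = z i - (\<Sum>j<m. d j * h j (x i))"
      using ols_residual_span by blast
    have "z i - ols_residual m h n x z i = (\<Sum>k<m. (\<Sum>j<m. d j * B j k) * G k i)" if "i < n" for i
    proof -
      have "z i - ols_residual m h n x z i = (\<Sum>j<m. \<Sum>k<m. d j * B j k * G k i)"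
        using d B that by (simp add: sum_distrib_left mult.assoc)
      also have "\<dots> = (\<Sum>k<m. (\<Sum>j<m. d j * B j k) * G k i)"
        by (subst sum.swap) (simp add: sum_distrib_right)
      finally show ?thesis .
    qed
    then show ?thesis by (intro exI[of _ "\<lambda>k. \<Sum>j<m. d j * B j k"]) blast
  qed
  define P where "P z = (\<lambda>i. z i - ols_residual m h n x z i)" for z
  have PP: "sample_ip n z (P z) = sample_ip n (P z) (P z)"
    and Pyth: "sample_ip n (ols_residual m h n x z) (ols_residual m h n x z) = sample_ip n z z - sample_ip n (P z) (P z)"
    and Pdiff: "sample_ip n (ols_residual m h n x z) y = sample_ip n y z - sample_ip n y (P z)" for z y
  proof -
    let ?r = "ols_residual m h n x z"
    have rr: "sample_ip n ?r ?r = sample_ip n z ?r"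
      using ols_residual_ip[of n m h x z z] sample.ip_commute[of ?r z n] by simp
    have zP: "sample_ip n z (P z) = sample_ip n z z - sample_ip n z ?r"
      by (simp add: P_def sample_ip_def right_diff_distrib sum_subtractf)
    have "sample_ip n (P z) (P z) = sample_ip n z z - 2 * sample_ip n z ?r + sample_ip n ?r ?r"
      by (simp add: P_def sample_ip_def algebra_simps sum.distrib sum_subtractf sum_distrib_left)
    then show "sample_ip n z (P z) = sample_ip n (P z) (P z)"
      "sample_ip n ?r ?r = sample_ip n z z - sample_ip n (P z) (P z)"
      using rr zP by simp_all
    show "sample_ip n ?r y = sample_ip n y z - sample_ip n y (P z)"
      by (simp add: P_def sample_ip_def algebra_simps sum_subtractf)
  qed
  have norm_bound: "sample_ip n (P z) (P z) \<le> 2 * real n * cross_moments n m G z" for z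
  proof -
    obtain \<gamma> where "\<And>i. i < n \<Longrightarrow> P z i = (\<Sum>k<m. \<gamma> k * G k i)"
      using in_span[of z] unfolding P_def by blast
    from projection_norm_bound[OF n dev this PP] show ?thesis .
  qed
  have scale: "cross_moments n m G E = \<sigma>\<^sup>2 * c"
    unfolding c_def cross_moments_def sum_distrib_left
    using \<sigma> by (intro sum.cong) (simp_all add: sample_ip_def sum_divide_distrib[symmetric] power_divide power_mult_distrib)
  define p where "p = P (\<lambda>_. 1)"
  obtain \<gamma> where \<gamma>: "\<And>i. i < n \<Longrightarrow> p i = (\<Sum>k<m. \<gamma> k * G k i)"
    using in_span[of "\<lambda>_. 1"] unfolding p_def P_def by blast
  define U where "U = ols_residual m h n x (\<lambda>_. 1)"
  define v where "v = sample_ip n p p / real n"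
  define w where "w = sample_ip n E p / (\<sigma> * sqrt n)"
  define r where "r = sample_ip n (P E) (P E) / (real n * \<sigma>\<^sup>2)"
  have sn: "sqrt n > 0" "sqrt n * sqrt n = real n" using n by auto
  have v0: "0 \<le> v" by (simp add: v_def sample.ip_nonneg)
  have va: "v \<le> 2 * a" using norm_bound[of "\<lambda>_. 1"] n by (simp add: v_def p_def a_def field_simps)
  have v1: "v < 1" using va a by simp
  have UU: "sample_ip n U U = real n * (1 - v)"
  proof -
    have "sample_ip n (\<lambda>_. 1) (\<lambda>_. 1) = real n" by (simp add: sample_ip_def)
    then show ?thesis using Pyth[of "\<lambda>_. 1"] n by (simp add: U_def v_def p_def right_diff_distrib)
  qed
  have UE: "sample_ip n U E = \<sigma> * sqrt n * (T - w)"
    using Pdiff[of "\<lambda>_. 1" E] \<sigma> sn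
    by (simp add: U_def w_def p_def T_def right_diff_distrib) (simp add: sample_ip_def)
  have UU0: "sample_ip n U U \<noteq> 0" using UU v1 n by simp
  have "(sample_ip n E p)\<^sup>2 \<le> 2 * real n * sample_ip n p p * cross_moments n m G E"
    by (rule projection_cross_bound[OF n dev \<gamma>])
  also have "\<dots> = 2 * real n * (real n * v) * (\<sigma>\<^sup>2 * c)" using n by (simp add: v_def scale)
  finally have "w\<^sup>2 * (\<sigma>\<^sup>2 * real n) \<le> 2 * real n * v * c * (\<sigma>\<^sup>2 * real n)"
    using \<sigma> sn by (simp add: w_def power_divide power_mult_distrib mult_ac)
  then have "w\<^sup>2 \<le> 2 * real n * v * c" using \<sigma> n by (simp add: mult_ac)
  also have "\<dots> \<le> 2 * real n * (2 * a) * c"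
    using va by (intro mult_right_mono mult_left_mono) (auto simp: c_def cross_moments_nonneg)
  finally have w2: "w\<^sup>2 \<le> 4 * (real n * a * c)" by (simp add: mult_ac)
  have r0: "0 \<le> r" by (simp add: r_def sample.ip_nonneg)
  have rc: "r \<le> 2 * c" using norm_bound[of E] n \<sigma> by (simp add: r_def scale field_simps)
  note resid = ols_via_residuals[where f = f and x = x and \<mu> = \<mu> and b = b and h = h and m = m
      and E = E and n = n, OF f, folded U_def]
  have est: "sqrt n / \<sigma> * (ols_estimator f m h n x - \<mu>) = (T - w) / (1 - v)"
    using resid(2) UU0 \<sigma> sn v1
    by (simp add: UU UE) (simp add: field_simps)
  have "ols_variance f m h n x / \<sigma>\<^sup>2 =
     (sample_ip n E E - sample_ip n (P E) (P E) - (\<sigma> * sqrt n * (T - w))\<^sup>2 / (real n * (1 - v))) / real n / \<sigma>\<^sup>2"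
    using resid(3) by (simp add: Pyth UU UE)
  also have "(\<sigma> * sqrt n * (T - w))\<^sup>2 = \<sigma>\<^sup>2 * real n * (T - w)\<^sup>2"
    by (simp add: power_mult_distrib)
  also have "(sample_ip n E E - sample_ip n (P E) (P E) - \<sigma>\<^sup>2 * real n * (T - w)\<^sup>2 / (real n * (1 - v))) / real n / \<sigma>\<^sup>2
     = sample_ip n E E / \<sigma>\<^sup>2 / real n - r - (T - w)\<^sup>2 / (real n * (1 - v))"
    using \<sigma> n v1 by (simp add: r_def diff_divide_distrib) (simp add: field_simps)
  also have "sample_ip n E E / \<sigma>\<^sup>2 = (\<Sum>i<n. (E i / \<sigma>)\<^sup>2)"
    by (simp add: sample_ip_def power2_eq_square sum_divide_distrib)
  finally show thesis using that[OF v0 va w2 r0 rc est] by simp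
qed

text \<open>The expansion with its auxiliary quantities eliminated: the remainder of the estimator against the oracle error
  \<open>T\<close>, and that of the variance estimator against the mean of squares.\<close>

lemma ols_linearization:
  assumes f: "\<And>i. i < n \<Longrightarrow> f (x i) = \<mu> + (\<Sum>j<m. b j * h j (x i)) + E i"
    and n: "0 < n" and \<sigma>: "0 < \<sigma>"
    and B: "\<And>j i. j < m \<Longrightarrow> i < n \<Longrightarrow> h j (x i) = (\<Sum>k<m. B j k * G k i)"
    and dev: "gram_deviation n m G \<le> 1 / 4"
  defines "a \<equiv> cross_moments n m G (\<lambda>_. 1)" and "c \<equiv> cross_moments n m G (\<lambda>i. E i / \<sigma>)"
    and "T \<equiv> (\<Sum>i<n. E i / \<sigma>) / sqrt n"
  assumes a: "a \<le> 1 / 4"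
  shows "\<bar>sqrt n / \<sigma> * (ols_estimator f m h n x - \<mu>) - T\<bar> \<le> 4 * (\<bar>T * a\<bar> + sqrt (real n * a * c))"
    and "\<bar>ols_variance f m h n x / \<sigma>\<^sup>2 - 1\<bar> \<le>
      \<bar>(\<Sum>i<n. (E i / \<sigma>)\<^sup>2) / real n - 1\<bar> + 6 * c + 4 * (T\<^sup>2 / real n)"
proof -
  have T: "T = (\<Sum>i<n. E i) / (\<sigma> * sqrt n)" by (simp add: T_def sum_divide_distrib[symmetric])
  have a0: "0 \<le> a" and c0: "0 \<le> c" by (simp_all add: a_def c_def cross_moments_nonneg)
  obtain v w r where v: "0 \<le> v" "v \<le> 2 * a" and w: "w\<^sup>2 \<le> 4 * (real n * a * c)" and r: "0 \<le> r" "r \<le> 2 * c"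
    and est: "sqrt n / \<sigma> * (ols_estimator f m h n x - \<mu>) = (T - w) / (1 - v)"
    and var: "ols_variance f m h n x / \<sigma>\<^sup>2 =
      (\<Sum>i<n. (E i / \<sigma>)\<^sup>2) / real n - r - (T - w)\<^sup>2 / (real n * (1 - v))"
    unfolding T a_def c_def
    by (rule ols_stochastic_expansion[where f=f and x=x and \<mu>=\<mu> and b=b and h=h and E=E and n=n and m=m and G=G
        and \<sigma>=\<sigma> and B=B]) (use f n \<sigma> B dev a in \<open>auto simp: a_def\<close>)
  have v1: "1 / 2 \<le> 1 - v" using v a by simp
  have "\<bar>w\<bar> \<le> sqrt (4 * (real n * a * c))" using w real_le_rsqrt[of "\<bar>w\<bar>"] by simp
  then have w': "\<bar>w\<bar> \<le> 2 * sqrt (real n * a * c)" by (simp add: real_sqrt_mult)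
  have "(T - w) / (1 - v) - T = (T * v - w) / (1 - v)" using v1 by (simp add: field_simps)
  then have "\<bar>(T - w) / (1 - v) - T\<bar> = \<bar>T * v - w\<bar> / (1 - v)" using v1 by simp
  also have "\<dots> \<le> \<bar>T * v - w\<bar> / (1 / 2)" using v1 by (intro divide_left_mono) auto
  also have "\<bar>T * v - w\<bar> \<le> \<bar>T\<bar> * v + \<bar>w\<bar>" using v(1) abs_triangle_ineq4[of "T * v" w] by (simp add: abs_mult)
  also have "\<bar>T\<bar> * v + \<bar>w\<bar> \<le> \<bar>T\<bar> * (2 * a) + 2 * sqrt (real n * a * c)"
    using v(2) w' by (intro add_mono mult_left_mono) auto
  finally show "\<bar>sqrt n / \<sigma> * (ols_estimator f m h n x - \<mu>) - T\<bar> \<le> 4 * (\<bar>T * a\<bar> + sqrt (real n * a * c))"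
    unfolding est using a0 by (simp add: abs_mult)
  have "(T - w)\<^sup>2 \<le> 2 * T\<^sup>2 + 2 * w\<^sup>2"
    using zero_le_power2[of "T + w"] by (simp add: power2_eq_square algebra_simps)
  also have "\<dots> \<le> 2 * T\<^sup>2 + 2 * (real n * c)"
  proof -
    have "4 * (real n * a * c) \<le> 4 * (real n * (1 / 4) * c)"
      using a c0 by (intro mult_left_mono mult_right_mono) auto
    with w show ?thesis by simp
  qed
  finally have tw: "(T - w)\<^sup>2 \<le> 2 * T\<^sup>2 + 2 * (real n * c)" .
  have "(T - w)\<^sup>2 / (real n * (1 - v)) \<le> (T - w)\<^sup>2 / (real n * (1 / 2))"
    using v1 n by (intro divide_left_mono mult_left_mono) auto
  also have "\<dots> \<le> (2 * T\<^sup>2 + 2 * (real n * c)) / (real n * (1 / 2))"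
    using tw by (intro divide_right_mono) auto
  also have "\<dots> = 4 * (T\<^sup>2 / real n) + 4 * c" using n by (simp add: field_simps)
  finally have q: "(T - w)\<^sup>2 / (real n * (1 - v)) \<le> 4 * (T\<^sup>2 / real n) + 4 * c" .
  moreover have "0 \<le> (T - w)\<^sup>2 / (real n * (1 - v))" using v1 by simp
  ultimately show "\<bar>ols_variance f m h n x / \<sigma>\<^sup>2 - 1\<bar> \<le>
      \<bar>(\<Sum>i<n. (E i / \<sigma>)\<^sup>2) / real n - 1\<bar> + 6 * c + 4 * (T\<^sup>2 / real n)"
    unfolding var using r by linarith
qed

section \<open>Null sequences in probability and weak convergence\<close>

text \<open>Convergence to \<open>0\<close> in probability, with the probability space depending on \<open>n\<close>.\<close>

definition null_in_prob :: "(nat \<Rightarrow> 'w measure) \<Rightarrow> (nat \<Rightarrow> 'w \<Rightarrow> real) \<Rightarrow> bool" where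
  "null_in_prob M Z \<longleftrightarrow>
     (\<forall>e>0. (\<lambda>n. measure (M n) {\<omega> \<in> space (M n). e < \<bar>Z n \<omega>\<bar>}) \<longlonglongrightarrow> 0)"

text \<open>A sample of size \<open>0\<close> carries no information, so the array starts at index \<open>1\<close>.\<close>

locale prob_array =
  fixes M :: "nat \<Rightarrow> 'w measure"
  assumes prob: "1 \<le> n \<Longrightarrow> prob_space (M n)"
begin

lemma eventually_ge_1: "(\<And>n. 1 \<le> n \<Longrightarrow> Q n) \<Longrightarrow> \<forall>\<^sub>F n in sequentially. Q n"
  using eventually_ge_at_top[of "1::nat"] by (rule eventually_mono)

text \<open>The continuous mapping principle at \<open>0\<close>, in the form used for all remainder terms: \<open>Z\<close> is null if it is small
  whenever finitely many null sequences are small. The union bound over the exceptional events of these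
  sequences proves it.\<close>

lemma null_in_prob_dominated:
  assumes F: "finite F" "\<And>W. W \<in> F \<Longrightarrow> null_in_prob M W"
    and rv: "\<And>W n. W \<in> F \<Longrightarrow> 1 \<le> n \<Longrightarrow> W n \<in> borel_measurable (M n)"
    and dom: "\<And>e. 0 < e \<Longrightarrow> \<exists>d>0. \<forall>n\<ge>1. \<forall>\<omega>\<in>space (M n). (\<forall>W\<in>F. \<bar>W n \<omega>\<bar> \<le> d) \<longrightarrow> \<bar>Z n \<omega>\<bar> \<le> e"
  shows "null_in_prob M Z"
  unfolding null_in_prob_def
proof (intro allI impI)
  fix e :: real assume "0 < e"
  from dom[OF this] obtain d where d: "0 < d"
    "\<forall>n\<ge>1. \<forall>\<omega>\<in>space (M n). (\<forall>W\<in>F. \<bar>W n \<omega>\<bar> \<le> d) \<longrightarrow> \<bar>Z n \<omega>\<bar> \<le> e"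
    by (elim exE conjE)
  let ?A = "\<lambda>W n. {\<omega> \<in> space (M n). d < \<bar>W n \<omega>\<bar>}"
  have "\<forall>\<^sub>F n in sequentially. norm (measure (M n) {\<omega> \<in> space (M n). e < \<bar>Z n \<omega>\<bar>})
      \<le> (\<Sum>W\<in>F. measure (M n) (?A W n))"
  proof (rule eventually_ge_1)
    fix n :: nat assume n: "1 \<le> n"
    interpret prob_space "M n" by (rule prob[OF n])
    have A: "?A W n \<in> sets (M n)" if "W \<in> F" for W
    proof -
      have [measurable]: "W n \<in> borel_measurable (M n)" using rv[OF that n] .
      show ?thesis by measurable
    qed
    have "measure (M n) {\<omega> \<in> space (M n). e < \<bar>Z n \<omega>\<bar>} \<le> measure (M n) (\<Union>W\<in>F. ?A W n)"
    proof (rule finite_measure_mono)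
      show "{\<omega> \<in> space (M n). e < \<bar>Z n \<omega>\<bar>} \<subseteq> (\<Union>W\<in>F. ?A W n)"
      proof
        fix \<omega> assume "\<omega> \<in> {\<omega> \<in> space (M n). e < \<bar>Z n \<omega>\<bar>}"
        then have \<omega>: "\<omega> \<in> space (M n)" "\<not> \<bar>Z n \<omega>\<bar> \<le> e" by auto
        then have "\<not> (\<forall>W\<in>F. \<bar>W n \<omega>\<bar> \<le> d)" using d(2) n \<omega>(1) by blast
        with \<omega>(1) show "\<omega> \<in> (\<Union>W\<in>F. ?A W n)" by (auto simp: not_le)
      qed
    qed (use F(1) A in auto)
    also have "\<dots> \<le> (\<Sum>W\<in>F. measure (M n) (?A W n))"
      using F(1) A by (intro finite_measure_subadditive_finite) auto
    finally show "norm (measure (M n) {\<omega> \<in> space (M n). e < \<bar>Z n \<omega>\<bar>}) \<le> \<dots>" by simp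
  qed
  moreover have "(\<lambda>n. \<Sum>W\<in>F. measure (M n) (?A W n)) \<longlonglongrightarrow> 0"
    using F(2) d(1) by (intro tendsto_null_sum) (simp add: null_in_prob_def)
  ultimately show "(\<lambda>n. measure (M n) {\<omega> \<in> space (M n). e < \<bar>Z n \<omega>\<bar>}) \<longlonglongrightarrow> 0"
    by (rule Lim_null_comparison)
qed

lemma null_in_prob_L1:
  assumes "\<forall>\<^sub>F n in sequentially. integrable (M n) (Z n) \<and> (\<integral>\<omega>. \<bar>Z n \<omega>\<bar> \<partial>M n) \<le> B n"
    and B: "B \<longlonglongrightarrow> 0"
  shows "null_in_prob M Z"
  unfolding null_in_prob_def
proof (intro allI impI)
  fix e :: real assume e: "0 < e"
  have "\<forall>\<^sub>F n in sequentially. norm (measure (M n) {\<omega> \<in> space (M n). e < \<bar>Z n \<omega>\<bar>}) \<le> B n / e"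
    using assms(1) eventually_ge_at_top[of "1::nat"]
  proof eventually_elim
    case (elim n)
    interpret prob_space "M n" using elim prob by simp
    have i: "integrable (M n) (Z n)" using elim by simp
    then have [measurable]: "Z n \<in> borel_measurable (M n)" by simp
    have "measure (M n) {\<omega> \<in> space (M n). e < \<bar>Z n \<omega>\<bar>} \<le> measure (M n) {\<omega> \<in> space (M n). \<bar>Z n \<omega>\<bar> \<ge> e}"
      by (intro finite_measure_mono) auto
    also have "\<dots> \<le> (\<integral>\<omega>. \<bar>Z n \<omega>\<bar> \<partial>M n) / e"
      using i e by (intro integral_Markov_inequality_measure[where A = "space (M n)"]) auto
    also have "\<dots> \<le> B n / e" using elim e by (simp add: divide_right_mono)
    finally show ?case by simp
  qed
  moreover have "(\<lambda>n. B n / e) \<longlonglongrightarrow> 0" using tendsto_divide_zero[OF B] .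
  ultimately show "(\<lambda>n. measure (M n) {\<omega> \<in> space (M n). e < \<bar>Z n \<omega>\<bar>}) \<longlonglongrightarrow> 0"
    by (rule Lim_null_comparison)
qed

text \<open>A sequence bounded in \<open>L\<^sup>2\<close> is tight, by Chebyshev, and a tight sequence times a null sequence is null.\<close>

lemma null_in_prob_mult_L2_bounded:
  assumes T: "\<And>n. 1 \<le> n \<Longrightarrow> T n \<in> borel_measurable (M n) \<and> integrable (M n) (\<lambda>\<omega>. (T n \<omega>)\<^sup>2) \<and> (\<integral>\<omega>. (T n \<omega>)\<^sup>2 \<partial>M n) \<le> C"
    and W: "null_in_prob M W" and rv: "\<And>n. 1 \<le> n \<Longrightarrow> W n \<in> borel_measurable (M n)"
  shows "null_in_prob M (\<lambda>n \<omega>. T n \<omega> * W n \<omega>)"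
  unfolding null_in_prob_def
proof (intro allI impI)
  fix e :: real assume e: "0 < e"
  have "0 \<le> (\<integral>\<omega>. (T 1 \<omega>)\<^sup>2 \<partial>M 1)" by simp
  then have C: "0 \<le> C" using T[of 1] by linarith
  show "(\<lambda>n. measure (M n) {\<omega> \<in> space (M n). e < \<bar>T n \<omega> * W n \<omega>\<bar>}) \<longlonglongrightarrow> 0"
  proof (rule LIMSEQ_I)
    fix r :: real assume r: "0 < r"
    \<comment> \<open>Chebyshev at level \<open>K\<close> leaves at most \<open>C / K\<^sup>2 < r / 2\<close>.\<close>
    define K where "K = sqrt (2 * (C + 1) / r)"
    have K: "0 < K" "C / K\<^sup>2 < r / 2"
      using C r by (auto simp: K_def field_simps)
    have "(\<lambda>n. measure (M n) {\<omega> \<in> space (M n). e / K < \<bar>W n \<omega>\<bar>}) \<longlonglongrightarrow> 0"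
      using W e K by (simp add: null_in_prob_def)
    from order_tendstoD(2)[OF this, of "r / 2"] r
    have "\<forall>\<^sub>F n in sequentially. measure (M n) {\<omega> \<in> space (M n). e / K < \<bar>W n \<omega>\<bar>} < r / 2" by simp
    then have "\<forall>\<^sub>F n in sequentially. norm (measure (M n) {\<omega> \<in> space (M n). e < \<bar>T n \<omega> * W n \<omega>\<bar>} - 0) < r"
      using eventually_ge_at_top[of "1::nat"]
    proof eventually_elim
      case (elim n)
      interpret prob_space "M n" using elim prob by simp
      have [measurable]: "W n \<in> borel_measurable (M n)" "T n \<in> borel_measurable (M n)" using elim rv T by auto
      have "measure (M n) {\<omega> \<in> space (M n). e < \<bar>T n \<omega> * W n \<omega>\<bar>} \<le>
        measure (M n) ({\<omega> \<in> space (M n). \<bar>T n \<omega>\<bar> \<ge> K} \<union> {\<omega> \<in> space (M n). e / K < \<bar>W n \<omega>\<bar>})"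
      proof (intro finite_measure_mono subsetI)
        fix \<omega> assume \<omega>: "\<omega> \<in> {\<omega> \<in> space (M n). e < \<bar>T n \<omega> * W n \<omega>\<bar>}"
        have "e / K < \<bar>W n \<omega>\<bar>" if "\<bar>T n \<omega>\<bar> < K"
        proof -
          have "e < \<bar>T n \<omega>\<bar> * \<bar>W n \<omega>\<bar>" using \<omega> by (simp add: abs_mult)
          also have "\<dots> \<le> K * \<bar>W n \<omega>\<bar>" using that by (intro mult_right_mono) auto
          finally show ?thesis using K(1) by (simp add: field_simps)
        qed
        then show "\<omega> \<in> {\<omega> \<in> space (M n). \<bar>T n \<omega>\<bar> \<ge> K} \<union> {\<omega> \<in> space (M n). e / K < \<bar>W n \<omega>\<bar>}"
          using \<omega> by (cases "\<bar>T n \<omega>\<bar> < K") auto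
      qed measurable
      also have "\<dots> \<le> measure (M n) {\<omega> \<in> space (M n). \<bar>T n \<omega>\<bar> \<ge> K} + measure (M n) {\<omega> \<in> space (M n). e / K < \<bar>W n \<omega>\<bar>}"
        by (intro measure_Un_le) measurable
      also have "measure (M n) {\<omega> \<in> space (M n). \<bar>T n \<omega>\<bar> \<ge> K} \<le> (\<integral>\<omega>. (T n \<omega>)\<^sup>2 \<partial>M n) / K\<^sup>2"
        using T[OF elim(2)] K(1) by (intro second_moment_method) auto
      also have "\<dots> \<le> C / K\<^sup>2" using T[OF elim(2)] by (simp add: divide_right_mono)
      finally have "measure (M n) {\<omega> \<in> space (M n). e < \<bar>T n \<omega> * W n \<omega>\<bar>} < r"
        using K(2) elim(1) by linarith
      then show ?case by simp
    qed
    then show "\<exists>N. \<forall>n\<ge>N. norm (measure (M n) {\<omega> \<in> space (M n). e < \<bar>T n \<omega> * W n \<omega>\<bar>} - 0) < r"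
      by (simp add: eventually_sequentially)
  qed
qed

text \<open>The exponential is Lipschitz for nearby arguments and bounded for distant ones; both bounds
  are needed to compare characteristic functions of random variables close in probability.\<close>

lemma norm_iexp_diff_le:
  "cmod (iexp a - iexp b) \<le> \<bar>a - b\<bar>" "cmod (iexp a - iexp b) \<le> 2"
proof -
  have "iexp b * iexp (a - b) = iexp a"
    unfolding exp_add[symmetric] by (simp add: algebra_simps)
  then have "iexp a - iexp b = iexp b * (iexp (a - b) - 1)"
    by (simp only: right_diff_distrib mult_1_right)
  then have "cmod (iexp a - iexp b) = cmod (iexp (a - b) - 1)" by (simp add: norm_mult)
  also have "\<dots> \<le> \<bar>a - b\<bar>" using iexp_approx1[of "a - b" 0] by simp
  finally show "cmod (iexp a - iexp b) \<le> \<bar>a - b\<bar>" .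
  show "cmod (iexp a - iexp b) \<le> 2" using norm_triangle_ineq4[of "iexp a" "iexp b"] by simp
qed

text \<open>Outside the event \<open>|Y - Z| > e\<close> the integrand is at most \<open>|t| e\<close>, and on it at most \<open>2\<close>.\<close>

lemma char_diff_null:
  assumes Y: "\<And>n. 1 \<le> n \<Longrightarrow> Y n \<in> borel_measurable (M n)" and Z: "\<And>n. 1 \<le> n \<Longrightarrow> Z n \<in> borel_measurable (M n)"
    and null: "null_in_prob M (\<lambda>n \<omega>. Y n \<omega> - Z n \<omega>)"
  shows "(\<lambda>n. char (distr (M n) borel (Y n)) t - char (distr (M n) borel (Z n)) t) \<longlonglongrightarrow> 0"
proof (rule LIMSEQ_I)
  fix r :: real assume r: "0 < r"
  define e where "e = r / (2 * (\<bar>t\<bar> + 1))"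
  have e: "0 < e" "\<bar>t\<bar> * e \<le> r / 2" using r by (auto simp: e_def field_simps)
  let ?A = "\<lambda>n. {\<omega> \<in> space (M n). e < \<bar>Y n \<omega> - Z n \<omega>\<bar>}"
  have "(\<lambda>n. measure (M n) (?A n)) \<longlonglongrightarrow> 0" using null e by (simp add: null_in_prob_def)
  from order_tendstoD(2)[OF this, of "r / 4"] r
  have "\<forall>\<^sub>F n in sequentially. measure (M n) (?A n) < r / 4" by simp
  then have "\<forall>\<^sub>F n in sequentially. norm (char (distr (M n) borel (Y n)) t - char (distr (M n) borel (Z n)) t - 0) < r"
    using eventually_ge_at_top[of "1::nat"]
  proof eventually_elim
    case (elim n)
    interpret prob_space "M n" using elim prob by simp
    have [measurable]: "Y n \<in> borel_measurable (M n)" "Z n \<in> borel_measurable (M n)" using elim Y Z by auto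
    have int: "integrable (M n) (\<lambda>\<omega>. iexp (t * Y n \<omega>))" "integrable (M n) (\<lambda>\<omega>. iexp (t * Z n \<omega>))"
      by (intro integrable_const_bound[where B = 1]; simp)+
    have "char (distr (M n) borel (Y n)) t - char (distr (M n) borel (Z n)) t =
        (\<integral>\<omega>. iexp (t * Y n \<omega>) - iexp (t * Z n \<omega>) \<partial>M n)"
      using int by (simp add: char_def integral_distr)
    also have "cmod \<dots> \<le> (\<integral>\<omega>. cmod (iexp (t * Y n \<omega>) - iexp (t * Z n \<omega>)) \<partial>M n)"
      by (rule integral_norm_bound)
    also have "\<dots> \<le> (\<integral>\<omega>. r / 2 + 2 * indicat_real (?A n) \<omega> \<partial>M n)"
    proof (rule integral_mono)
      show "integrable (M n) (\<lambda>\<omega>. cmod (iexp (t * Y n \<omega>) - iexp (t * Z n \<omega>)))"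
        using int by (intro integrable_norm Bochner_Integration.integrable_diff)
      show "integrable (M n) (\<lambda>\<omega>. r / 2 + 2 * indicat_real (?A n) \<omega>)"
        by (intro Bochner_Integration.integrable_add integrable_mult_right integrable_const
            integrable_real_indicator) (auto simp: emeasure_eq_measure)
      fix \<omega> assume \<omega>: "\<omega> \<in> space (M n)"
      show "cmod (iexp (t * Y n \<omega>) - iexp (t * Z n \<omega>)) \<le> r / 2 + 2 * indicat_real (?A n) \<omega>"
      proof (cases "\<omega> \<in> ?A n")
        case True
        then show ?thesis using norm_iexp_diff_le(2)[of "t * Y n \<omega>" "t * Z n \<omega>"] r by simp
      next
        case False
        then have "\<bar>Y n \<omega> - Z n \<omega>\<bar> \<le> e" using \<omega> by simp
        have "\<bar>t * Y n \<omega> - t * Z n \<omega>\<bar> = \<bar>t\<bar> * \<bar>Y n \<omega> - Z n \<omega>\<bar>"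
          by (simp add: right_diff_distrib flip: abs_mult)
        also have "\<dots> \<le> \<bar>t\<bar> * e" by (intro mult_left_mono) (use \<open>\<bar>Y n \<omega> - Z n \<omega>\<bar> \<le> e\<close> in auto)
        finally show ?thesis using e(2) norm_iexp_diff_le(1)[of "t * Y n \<omega>" "t * Z n \<omega>"] False
          by simp
      qed
    qed
    also have "\<dots> = r / 2 + 2 * measure (M n) (?A n)"
      by (subst Bochner_Integration.integral_add) (auto simp: prob_space emeasure_eq_measure)
    also have "\<dots> < r" using elim by simp
    finally show ?case by simp
  qed
  then show "\<exists>N. \<forall>n\<ge>N. norm (char (distr (M n) borel (Y n)) t - char (distr (M n) borel (Z n)) t - 0) < r"
    by (simp add: eventually_sequentially)
qed

text \<open>Levy's continuity theorem, after a shift by one that discards the unconstrained space with index \<open>0\<close>.\<close>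

lemma weak_conv_iff_char:
  assumes Z: "\<And>n. 1 \<le> n \<Longrightarrow> Z n \<in> borel_measurable (M n)" and N: "real_distribution N"
  shows "weak_conv_m (\<lambda>n. distr (M n) borel (Z n)) N \<longleftrightarrow>
    (\<forall>t. (\<lambda>n. char (distr (M n) borel (Z n)) t) \<longlonglongrightarrow> char N t)"
proof -
  let ?D = "\<lambda>n. distr (M n) borel (Z n)"
  have D: "real_distribution (?D (Suc n))" for n
    using Z[of "Suc n"] prob[of "Suc n"]
    by (intro prob_space.real_distribution_distr) auto
  have "weak_conv_m ?D N \<longleftrightarrow> weak_conv_m (\<lambda>n. ?D (Suc n)) N"
    unfolding weak_conv_m_def weak_conv_def by (subst filterlim_sequentially_Suc) (rule refl)
  also have "\<dots> \<longleftrightarrow> (\<forall>t. (\<lambda>n. char (?D (Suc n)) t) \<longlonglongrightarrow> char N t)"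
  proof (intro iffI allI)
    show "(\<lambda>n. char (?D (Suc n)) t) \<longlonglongrightarrow> char N t" if "weak_conv_m (\<lambda>n. ?D (Suc n)) N" for t
      by (rule levy_continuity1[OF D N that])
    show "weak_conv_m (\<lambda>n. ?D (Suc n)) N" if "\<forall>t. (\<lambda>n. char (?D (Suc n)) t) \<longlonglongrightarrow> char N t"
      by (rule levy_continuity[OF D N]) (rule that[rule_format])
  qed
  also have "\<dots> \<longleftrightarrow> (\<forall>t. (\<lambda>n. char (?D n) t) \<longlonglongrightarrow> char N t)"
    by (subst filterlim_sequentially_Suc) (rule refl)
  finally show ?thesis .
qed

lemma weak_conv_slutsky:
  assumes Y: "\<And>n. 1 \<le> n \<Longrightarrow> Y n \<in> borel_measurable (M n)" and Z: "\<And>n. 1 \<le> n \<Longrightarrow> Z n \<in> borel_measurable (M n)"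
    and null: "null_in_prob M (\<lambda>n \<omega>. Y n \<omega> - Z n \<omega>)" and N: "real_distribution N"
  shows "weak_conv_m (\<lambda>n. distr (M n) borel (Y n)) N \<longleftrightarrow> weak_conv_m (\<lambda>n. distr (M n) borel (Z n)) N"
proof -
  have "(\<lambda>n. char (distr (M n) borel (Y n)) t) \<longlonglongrightarrow> c \<longleftrightarrow> (\<lambda>n. char (distr (M n) borel (Z n)) t) \<longlonglongrightarrow> c" for t c
    by (rule Lim_transform_eq, rule char_diff_null) (use Y Z null in auto)
  moreover have "weak_conv_m (\<lambda>n. distr (M n) borel (Y n)) N \<longleftrightarrow>
      (\<forall>t. (\<lambda>n. char (distr (M n) borel (Y n)) t) \<longlonglongrightarrow> char N t)"
    by (rule weak_conv_iff_char) (use Y N in auto)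
  moreover have "weak_conv_m (\<lambda>n. distr (M n) borel (Z n)) N \<longleftrightarrow>
      (\<forall>t. (\<lambda>n. char (distr (M n) borel (Z n)) t) \<longlonglongrightarrow> char N t)"
    by (rule weak_conv_iff_char) (use Z N in auto)
  ultimately show ?thesis by simp
qed

lemma weak_conv_const:
  assumes Z: "\<And>n. 1 \<le> n \<Longrightarrow> Z n \<in> borel_measurable (M n)"
    and null: "null_in_prob M (\<lambda>n \<omega>. Z n \<omega> - c)"
  shows "weak_conv_m (\<lambda>n. distr (M n) borel (Z n)) (return borel c)"
proof -
  have N: "real_distribution (return borel c)"
    by (simp add: real_distribution_def real_distribution_axioms_def prob_space_return)
  have "\<forall>\<^sub>F n in sequentially. char (distr (M n) borel (\<lambda>_. c)) t = char (return borel c) t" for t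
  proof (rule eventually_ge_1)
    fix n :: nat assume "1 \<le> n"
    then interpret prob_space "M n" by (rule prob)
    show "char (distr (M n) borel (\<lambda>_. c)) t = char (return borel c) t"
      by simp
  qed
  then have "weak_conv_m (\<lambda>n. distr (M n) borel (\<lambda>_. c)) (return borel c)"
    by (subst weak_conv_iff_char[OF _ N]) (auto intro: tendsto_eventually)
  moreover have "weak_conv_m (\<lambda>n. distr (M n) borel (Z n)) (return borel c) \<longleftrightarrow>
      weak_conv_m (\<lambda>n. distr (M n) borel (\<lambda>_. c)) (return borel c)"
    by (rule weak_conv_slutsky) (use Z null N in auto)
  ultimately show ?thesis by simp
qed

end

section \<open>Second moments of sample means\<close>

lemma (in prob_space) indep_sum_second_moment:
  fixes Z :: "nat \<Rightarrow> 'a \<Rightarrow> real"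
  assumes "finite I" and "indep_vars (\<lambda>_. borel) Z I"
    and "\<And>i. i \<in> I \<Longrightarrow> integrable M (\<lambda>\<omega>. (Z i \<omega>)\<^sup>2)" and "\<And>i. i \<in> I \<Longrightarrow> expectation (Z i) = 0"
  shows "integrable M (\<lambda>\<omega>. (\<Sum>i\<in>I. Z i \<omega>)\<^sup>2) \<and>
    expectation (\<lambda>\<omega>. (\<Sum>i\<in>I. Z i \<omega>)\<^sup>2) = (\<Sum>i\<in>I. expectation (\<lambda>\<omega>. (Z i \<omega>)\<^sup>2))"
  using assms
proof (induction I)
  case (insert k F)
  let ?S = "\<lambda>\<omega>. \<Sum>i\<in>F. Z i \<omega>"
  have ind: "indep_vars (\<lambda>_. borel) Z F" using insert.prems(1) by (rule indep_vars_subset) auto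
  have IH: "integrable M (\<lambda>\<omega>. (?S \<omega>)\<^sup>2)"
    "expectation (\<lambda>\<omega>. (?S \<omega>)\<^sup>2) = (\<Sum>i\<in>F. expectation (\<lambda>\<omega>. (Z i \<omega>)\<^sup>2))"
    using insert.IH[OF ind] insert.prems by auto
  have meas: "Z i \<in> borel_measurable M" if "i \<in> insert k F" for i
    using insert.prems(1) that by (auto simp: indep_vars_def2)
  have i1: "integrable M (Z k)"
    by (rule square_integrable_imp_integrable) (use insert.prems(2)[of k] meas[of k] in auto)
  have i2: "integrable M ?S"
    by (rule square_integrable_imp_integrable) (use IH(1) meas in \<open>auto intro!: borel_measurable_sum\<close>)
  have iv: "indep_var borel (Z k) borel ?S"
    using insert.hyps insert.prems(1) by (intro indep_vars_sum) auto
  have cross: "integrable M (\<lambda>\<omega>. Z k \<omega> * ?S \<omega>)" "expectation (\<lambda>\<omega>. Z k \<omega> * ?S \<omega>) = 0"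
    using indep_var_integrable[OF iv i1 i2] indep_var_lebesgue_integral[OF iv i1 i2] insert.prems(3)[of k] by auto
  have k2: "integrable M (\<lambda>\<omega>. (Z k \<omega>)\<^sup>2)" using insert.prems(2)[of k] by simp
  have eq: "(\<Sum>i\<in>insert k F. Z i \<omega>)\<^sup>2 = (Z k \<omega>)\<^sup>2 + (2 * (Z k \<omega> * ?S \<omega>) + (?S \<omega>)\<^sup>2)" for \<omega>
    using insert.hyps by (simp add: power2_eq_square algebra_simps)
  have "integrable M (\<lambda>\<omega>. (\<Sum>i\<in>insert k F. Z i \<omega>)\<^sup>2)"
    unfolding eq using k2 cross(1) IH(1) by (intro Bochner_Integration.integrable_add integrable_mult_right)
  moreover have "expectation (\<lambda>\<omega>. (\<Sum>i\<in>insert k F. Z i \<omega>)\<^sup>2) =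
      expectation (\<lambda>\<omega>. (Z k \<omega>)\<^sup>2) + (2 * expectation (\<lambda>\<omega>. Z k \<omega> * ?S \<omega>) + expectation (\<lambda>\<omega>. (?S \<omega>)\<^sup>2))"
    unfolding eq using k2 cross(1) IH(1) by simp
  ultimately show ?case using cross(2) IH(2) insert.hyps by simp
qed simp

lemma iid_sample_facts:
  assumes M: "prob_space M" and iid: "iid_sample P M n X" and i: "i < n"
  shows "X i \<in> measurable M P"
    and "\<phi> \<in> borel_measurable P \<Longrightarrow> integrable M (\<lambda>\<omega>. \<phi> (X i \<omega>)) \<longleftrightarrow> integrable P (\<phi> :: _ \<Rightarrow> real)"
    and "\<phi> \<in> borel_measurable P \<Longrightarrow> (\<integral>\<omega>. \<phi> (X i \<omega>) \<partial>M) = (\<integral>x. \<phi> x \<partial>P)"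
proof -
  interpret prob_space M by fact
  have d: "distr M P (X i) = P" using iid i by (simp add: iid_sample_def)
  show X: "X i \<in> measurable M P" using iid i by (auto simp: iid_sample_def indep_vars_def2)
  show "integrable M (\<lambda>\<omega>. \<phi> (X i \<omega>)) \<longleftrightarrow> integrable P \<phi>" if "\<phi> \<in> borel_measurable P"
    using integrable_distr_eq[OF X, of \<phi>] that d by simp
  show "(\<integral>\<omega>. \<phi> (X i \<omega>) \<partial>M) = (\<integral>x. \<phi> x \<partial>P)" if "\<phi> \<in> borel_measurable P"
    using integral_distr[OF X, of \<phi>] that d by simp
qed

lemma iid_mean_square_error:
  assumes P: "prob_space P" and M: "prob_space M" and iid: "iid_sample P M n X" and n: "0 < n"
    and \<phi>: "L2_fun P \<phi>"
  shows "integrable M (\<lambda>\<omega>. ((\<Sum>i<n. \<phi> (X i \<omega>)) / real n - (\<integral>x. \<phi> x \<partial>P))\<^sup>2)"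
    and "(\<integral>\<omega>. ((\<Sum>i<n. \<phi> (X i \<omega>)) / real n - (\<integral>x. \<phi> x \<partial>P))\<^sup>2 \<partial>M) \<le> (\<integral>x. (\<phi> x)\<^sup>2 \<partial>P) / real n"
proof -
  interpret P: prob_space P by fact
  interpret M: prob_space M by fact
  define c where "c = (\<integral>x. \<phi> x \<partial>P)"
  define \<psi> where "\<psi> x = \<phi> x - c" for x
  note X = iid_sample_facts[OF M iid]
  have [measurable]: "\<phi> \<in> borel_measurable P" and sq: "integrable P (\<lambda>x. (\<phi> x)\<^sup>2)"
    using \<phi> by (auto simp: L2_fun_def)
  have int: "integrable P \<phi>" by (rule P.square_integrable_imp_integrable) (use sq in auto)
  have [measurable]: "\<psi> \<in> borel_measurable P" unfolding \<psi>_def by measurable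
  have \<psi>2: "(\<psi> x)\<^sup>2 = (\<phi> x)\<^sup>2 - 2 * c * \<phi> x + c\<^sup>2" for x
    by (simp add: \<psi>_def power2_eq_square algebra_simps)
  have \<psi>int: "integrable P (\<lambda>x. (\<psi> x)\<^sup>2)" unfolding \<psi>2 using sq int by simp
  have \<psi>0: "(\<integral>x. \<psi> x \<partial>P) = 0" unfolding \<psi>_def using int by (simp add: c_def P.prob_space)
  have "(\<integral>x. (\<psi> x)\<^sup>2 \<partial>P) = (\<integral>x. (\<phi> x)\<^sup>2 \<partial>P) - c\<^sup>2"
    unfolding \<psi>2 using sq int by (simp add: c_def[symmetric] P.prob_space power2_eq_square)
  then have \<psi>le: "(\<integral>x. (\<psi> x)\<^sup>2 \<partial>P) \<le> (\<integral>x. (\<phi> x)\<^sup>2 \<partial>P)" by simp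
  have ind: "M.indep_vars (\<lambda>_. borel) (\<lambda>i \<omega>. \<psi> (X i \<omega>)) {..<n}"
    by (rule M.indep_vars_compose2[where M' = "\<lambda>_. P" and X = X]) (use iid in \<open>auto simp: iid_sample_def\<close>)
  have mom: "integrable M (\<lambda>\<omega>. (\<Sum>i<n. \<psi> (X i \<omega>))\<^sup>2)"
    "M.expectation (\<lambda>\<omega>. (\<Sum>i<n. \<psi> (X i \<omega>))\<^sup>2) = (\<Sum>i<n. M.expectation (\<lambda>\<omega>. (\<psi> (X i \<omega>))\<^sup>2))"
    using M.indep_sum_second_moment[OF _ ind] \<psi>int \<psi>0 X(2)[of _ "\<lambda>x. (\<psi> x)\<^sup>2"] X(3)[of _ \<psi>] by auto
  have eq: "((\<Sum>i<n. \<phi> (X i \<omega>)) / real n - (\<integral>x. \<phi> x \<partial>P))\<^sup>2 = (\<Sum>i<n. \<psi> (X i \<omega>))\<^sup>2 / (real n)\<^sup>2" for \<omega>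
    using n by (simp add: \<psi>_def sum_subtractf c_def[symmetric] power_divide[symmetric] diff_divide_distrib)
  show "integrable M (\<lambda>\<omega>. ((\<Sum>i<n. \<phi> (X i \<omega>)) / real n - (\<integral>x. \<phi> x \<partial>P))\<^sup>2)"
    unfolding eq using mom(1) by simp
  have "(\<integral>\<omega>. ((\<Sum>i<n. \<phi> (X i \<omega>)) / real n - (\<integral>x. \<phi> x \<partial>P))\<^sup>2 \<partial>M) = (real n * (\<integral>x. (\<psi> x)\<^sup>2 \<partial>P)) / (real n)\<^sup>2"
    unfolding eq using mom(2) X(3)[of _ "\<lambda>x. (\<psi> x)\<^sup>2"] by simp
  also have "\<dots> = (\<integral>x. (\<psi> x)\<^sup>2 \<partial>P) / real n" using n by (simp add: power2_eq_square)
  also have "\<dots> \<le> (\<integral>x. (\<phi> x)\<^sup>2 \<partial>P) / real n" using \<psi>le by (simp add: divide_right_mono)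
  finally show "(\<integral>\<omega>. ((\<Sum>i<n. \<phi> (X i \<omega>)) / real n - (\<integral>x. \<phi> x \<partial>P))\<^sup>2 \<partial>M) \<le> (\<integral>x. (\<phi> x)\<^sup>2 \<partial>P) / real n" .
qed

section \<open>The Lindeberg-Feller theorem for arrays with i.i.d. rows\<close>

definition standardized :: "'s measure \<Rightarrow> ('s \<Rightarrow> real) \<Rightarrow> bool" where
  "standardized P Y \<longleftrightarrow> L2_fun P Y \<and> (\<integral>x. Y x \<partial>P) = 0 \<and> (\<integral>x. (Y x)\<^sup>2 \<partial>P) = 1"

text \<open>The quantity in the Lindeberg condition, at truncation level \<open>b\<close>.\<close>

definition tail_moment :: "'s measure \<Rightarrow> ('s \<Rightarrow> real) \<Rightarrow> real \<Rightarrow> real" where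
  "tail_moment P Y b = (\<integral>x. (Y x)\<^sup>2 * indicat_real {x. b < \<bar>Y x\<bar>} x \<partial>P)"

lemma tail_moment_integrable:
  assumes "L2_fun P Y"
  shows "integrable P (\<lambda>x. (Y x)\<^sup>2 * indicat_real {x. b < \<bar>Y x\<bar>} x)"
proof (rule Bochner_Integration.integrable_bound)
  have [measurable]: "Y \<in> borel_measurable P" and "integrable P (\<lambda>x. (Y x)\<^sup>2)"
    using assms by (auto simp: L2_fun_def)
  then show "integrable P (\<lambda>x. (Y x)\<^sup>2)" by simp
  have "(\<lambda>x. (Y x)\<^sup>2 * (if b < \<bar>Y x\<bar> then 1 else 0)) \<in> borel_measurable P" by measurable
  then show "(\<lambda>x. (Y x)\<^sup>2 * indicat_real {x. b < \<bar>Y x\<bar>} x) \<in> borel_measurable P"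
    by (simp add: indicator_def)
  show "AE x in P. norm ((Y x)\<^sup>2 * indicat_real {x. b < \<bar>Y x\<bar>} x) \<le> norm ((Y x)\<^sup>2)"
    by (simp add: indicator_def)
qed

lemma tail_moment_nonneg: "0 \<le> tail_moment P Y b"
  unfolding tail_moment_def by (rule Bochner_Integration.integral_nonneg) simp

text \<open>The quantitative step of the Lindeberg half. The third-order error \<open>min (6 Y\<^sup>2) (|s| |Y|\<^sup>3)\<close> at \<open>s = t / \<surd>n\<close> is
  bounded by its first argument on \<open>|Y| > \<delta> \<surd>n\<close> and by its second one elsewhere. The condition \<open>t\<^sup>2 / 4 \<le> n\<close> puts the
  Gaussian factor \<open>1 - t\<^sup>2 / (2 n)\<close> into the unit disc, where powers are Lipschitz with constant \<open>n\<close>.\<close>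

lemma char_power_bound:
  assumes P: "prob_space P" and Y: "standardized P Y" and n: "1 \<le> n" "t\<^sup>2 / 4 \<le> real n" and \<delta>: "0 < \<delta>"
  shows "cmod ((char (distr P borel Y) (t / sqrt n)) ^ n - complex_of_real ((1 + (- (t\<^sup>2) / 2) / real n) ^ n))
    \<le> t\<^sup>2 * tail_moment P Y (\<delta> * sqrt n) + t\<^sup>2 * \<bar>t\<bar> * \<delta> / 6"
proof -
  interpret prob_space P by fact
  have L2: "L2_fun P Y" and [measurable]: "Y \<in> borel_measurable P" and sq: "integrable P (\<lambda>x. (Y x)\<^sup>2)"
    and EY: "expectation Y = 0" "expectation (\<lambda>x. (Y x)\<^sup>2) = 1"
    using Y by (auto simp: standardized_def L2_fun_def)
  have int: "integrable P Y" by (rule square_integrable_imp_integrable) (use sq in auto)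
  define s where "s = t / sqrt n"
  define \<phi> where "\<phi> = char (distr P borel Y) s"
  have sn: "0 < sqrt n" using n by simp
  have s2: "s\<^sup>2 = t\<^sup>2 / real n" by (simp add: s_def power_divide)
  have b1: "cmod (\<phi> - (1 - s\<^sup>2 * 1 / 2)) \<le> (s\<^sup>2 / 6) * expectation (\<lambda>x. min (6 * (Y x)\<^sup>2) (\<bar>s\<bar> * \<bar>Y x\<bar> ^ 3))"
    unfolding \<phi>_def by (rule char_approx3') (use int sq EY in auto)
  have "expectation (\<lambda>x. min (6 * (Y x)\<^sup>2) (\<bar>s\<bar> * \<bar>Y x\<bar> ^ 3)) \<le>
      expectation (\<lambda>x. 6 * ((Y x)\<^sup>2 * indicat_real {x. \<delta> * sqrt n < \<bar>Y x\<bar>} x) + \<bar>t\<bar> * \<delta> * (Y x)\<^sup>2)"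
  proof (rule integral_mono)
    show "integrable P (\<lambda>x. min (6 * (Y x)\<^sup>2) (\<bar>s\<bar> * \<bar>Y x\<bar> ^ 3))"
    proof (rule Bochner_Integration.integrable_bound)
      show "integrable P (\<lambda>x. 6 * (Y x)\<^sup>2)" using sq by simp
    qed (auto simp: min_def)
    show "integrable P (\<lambda>x. 6 * ((Y x)\<^sup>2 * indicat_real {x. \<delta> * sqrt n < \<bar>Y x\<bar>} x) + \<bar>t\<bar> * \<delta> * (Y x)\<^sup>2)"
      by (intro Bochner_Integration.integrable_add integrable_mult_right tail_moment_integrable L2 sq)
    fix x
    show "min (6 * (Y x)\<^sup>2) (\<bar>s\<bar> * \<bar>Y x\<bar> ^ 3) \<le>
        6 * ((Y x)\<^sup>2 * indicat_real {x. \<delta> * sqrt n < \<bar>Y x\<bar>} x) + \<bar>t\<bar> * \<delta> * (Y x)\<^sup>2"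
    proof (cases "\<delta> * sqrt n < \<bar>Y x\<bar>")
      case True
      have "0 \<le> \<bar>t\<bar> * \<delta> * (Y x)\<^sup>2" using \<delta> by simp
      then show ?thesis using True by (simp add: min_le_iff_disj)
    next
      case False
      have "\<bar>s\<bar> * \<bar>Y x\<bar> ^ 3 = \<bar>t\<bar> * (\<bar>Y x\<bar> / sqrt n) * (Y x)\<^sup>2"
        by (simp add: s_def power3_eq_cube power2_eq_square abs_divide)
      also have "\<dots> \<le> \<bar>t\<bar> * \<delta> * (Y x)\<^sup>2"
        using False sn by (intro mult_right_mono mult_left_mono) (auto simp: field_simps)
      finally show ?thesis using False by (auto simp: min_def)
    qed
  qed
  also have "\<dots> = 6 * tail_moment P Y (\<delta> * sqrt n) + \<bar>t\<bar> * \<delta>"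
    unfolding tail_moment_def using tail_moment_integrable[OF L2] sq EY by simp
  finally have b2: "(s\<^sup>2 / 6) * expectation (\<lambda>x. min (6 * (Y x)\<^sup>2) (\<bar>s\<bar> * \<bar>Y x\<bar> ^ 3)) \<le>
      (s\<^sup>2 / 6) * (6 * tail_moment P Y (\<delta> * sqrt n) + \<bar>t\<bar> * \<delta>)"
    by (intro mult_left_mono) simp_all
  have eq1: "complex_of_real (1 + (- (t\<^sup>2) / 2) / real n) = 1 - s\<^sup>2 * 1 / 2"
    by (simp add: s2)
  have n1: "cmod (complex_of_real (1 + (- (t\<^sup>2) / 2) / real n)) \<le> 1"
  proof -
    have "\<bar>1 + (- (t\<^sup>2) / 2) / real n\<bar> \<le> 1" using n by (auto simp: abs_le_iff field_simps)
    then show ?thesis by (simp only: norm_of_real)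
  qed
  have n2: "cmod \<phi> \<le> 1"
    unfolding \<phi>_def by (intro real_distribution.cmod_char_le_1 real_distribution_distr) measurable
  have "cmod (\<phi> ^ n - (complex_of_real (1 + (- (t\<^sup>2) / 2) / real n)) ^ n) \<le>
      real n * cmod (\<phi> - complex_of_real (1 + (- (t\<^sup>2) / 2) / real n))"
    by (rule norm_power_diff[OF n2 n1])
  also have "\<dots> \<le> real n * ((s\<^sup>2 / 6) * (6 * tail_moment P Y (\<delta> * sqrt n) + \<bar>t\<bar> * \<delta>))"
    unfolding eq1 using b1 b2 by (intro mult_left_mono order_trans[OF b1 b2]) simp_all
  also have "\<dots> = t\<^sup>2 * tail_moment P Y (\<delta> * sqrt n) + t\<^sup>2 * \<bar>t\<bar> * \<delta> / 6"
    using n by (simp add: s2 field_simps)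
  finally show ?thesis by (simp add: \<phi>_def s_def)
qed

text \<open>For bounds with a vanishing part and a part proportional to a free truncation parameter \<open>\<delta>\<close>: the limit in \<open>n\<close> is
  taken before \<open>\<delta>\<close> is sent to \<open>0\<close>.\<close>

lemma small_if_arbitrarily_close:
  fixes u :: "nat \<Rightarrow> 'b::real_normed_vector"
  assumes "\<And>\<delta>. 0 < \<delta> \<Longrightarrow> \<exists>v. v \<longlonglongrightarrow> 0 \<and> (\<forall>\<^sub>F n in sequentially. norm (u n) \<le> v n + C * \<delta>)"
    and C: "0 \<le> C"
  shows "u \<longlonglongrightarrow> 0"
proof (rule tendstoI)
  fix e :: real assume e: "0 < e"
  have "C * (e / (2 * (C + 1))) < e"  "0 < e / (2 * (C + 1))"
    using e C by (auto simp: divide_simps)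
  then obtain \<delta> where \<delta>: "0 < \<delta>" "C * \<delta> < e" by blast
  obtain v where v: "v \<longlonglongrightarrow> 0" "\<forall>\<^sub>F n in sequentially. norm (u n) \<le> v n + C * \<delta>"
    using assms(1)[OF \<delta>(1)] by blast
  have "\<forall>\<^sub>F n in sequentially. v n < e - C * \<delta>" using v(1) \<delta>(2) by (intro order_tendstoD) auto
  with v(2) show "\<forall>\<^sub>F n in sequentially. dist (u n) 0 < e"
    by eventually_elim simp
qed

lemma lindeberg_imp_char_tendsto:
  assumes P: "prob_space P" and Y: "\<And>n. 1 \<le> n \<Longrightarrow> standardized P (Y n)"
    and lind: "\<And>\<delta>. 0 < \<delta> \<Longrightarrow> (\<lambda>n. tail_moment P (Y n) (\<delta> * sqrt (real n))) \<longlonglongrightarrow> 0"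
  shows "(\<lambda>n. (char (distr P borel (Y n)) (t / sqrt (real n))) ^ n) \<longlonglongrightarrow> complex_of_real (exp (- (t\<^sup>2) / 2))"
proof -
  have "(\<lambda>n. complex_of_real ((1 + (- (t\<^sup>2) / 2) / real n) ^ n)) \<longlonglongrightarrow> complex_of_real (exp (- (t\<^sup>2) / 2))"
    by (rule isCont_tendsto_compose[OF _ tendsto_exp_limit_sequentially]) auto
  moreover have "(\<lambda>n. (char (distr P borel (Y n)) (t / sqrt (real n))) ^ n -
      complex_of_real ((1 + (- (t\<^sup>2) / 2) / real n) ^ n)) \<longlonglongrightarrow> 0"
  proof (rule small_if_arbitrarily_close[where C = "t\<^sup>2 * \<bar>t\<bar> / 6"])
    fix \<delta> :: real assume \<delta>: "0 < \<delta>"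
    have "(\<lambda>n. t\<^sup>2 * tail_moment P (Y n) (\<delta> * sqrt (real n))) \<longlonglongrightarrow> 0"
      using tendsto_mult_right_zero[OF lind[OF \<delta>]] .
    moreover have "\<forall>\<^sub>F n in sequentially. cmod ((char (distr P borel (Y n)) (t / sqrt (real n))) ^ n -
        complex_of_real ((1 + (- (t\<^sup>2) / 2) / real n) ^ n)) \<le>
        t\<^sup>2 * tail_moment P (Y n) (\<delta> * sqrt (real n)) + t\<^sup>2 * \<bar>t\<bar> / 6 * \<delta>"
      using eventually_ge_at_top[of "1::nat"] eventually_ge_at_top[of "nat \<lceil>t\<^sup>2 / 4\<rceil>"]
    proof eventually_elim
      case (elim n)
      then have "t\<^sup>2 / 4 \<le> real n" by linarith
      from char_power_bound[OF P Y[OF elim(1)] elim(1) this \<delta>] show ?case by simp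
    qed
    ultimately show "\<exists>v. v \<longlonglongrightarrow> 0 \<and> (\<forall>\<^sub>F n in sequentially. cmod ((char (distr P borel (Y n)) (t / sqrt (real n))) ^ n -
        complex_of_real ((1 + (- (t\<^sup>2) / 2) / real n) ^ n)) \<le> v n + t\<^sup>2 * \<bar>t\<bar> / 6 * \<delta>)"
      by blast
  qed simp
  ultimately show ?thesis by (rule Lim_transform)
qed

lemma exp_near_one_plus:
  fixes z :: complex
  assumes "cmod z \<le> 1"
  shows "cmod (exp z - (1 + z)) \<le> 3 * (cmod z)\<^sup>2"
proof -
  have "cmod (exp z - (\<Sum>k\<le>1. z ^ k / fact k)) \<le> exp \<bar>Re z\<bar> * cmod z ^ Suc 1 / fact 1"
    by (rule Taylor_exp)
  also have "\<dots> \<le> 3 * (cmod z)\<^sup>2"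
  proof -
    have "\<bar>Re z\<bar> \<le> 1" using abs_Re_le_cmod[of z] assms by linarith
    then have "exp \<bar>Re z\<bar> \<le> exp 1" by simp
    also have "\<dots> \<le> (3::real)" by (rule exp_le)
    finally show ?thesis by (simp add: power2_eq_square mult_right_mono)
  qed
  finally show ?thesis by simp
qed

lemma one_minus_cos_le: "1 - cos x \<le> x\<^sup>2 / (2::real)"
proof -
  have "1 - cos x = 2 * (sin (x / 2))\<^sup>2" using cos_double_sin[of "x / 2"] by simp
  also have "\<dots> \<le> 2 * (x / 2)\<^sup>2"
    using abs_sin_x_le_abs_x[of "x / 2"] unfolding abs_le_square_iff by simp
  finally show ?thesis by (simp add: power_divide)
qed

text \<open>The first step of the Feller half replaces \<open>\<phi>\<^sup>n\<close> by \<open>exp (n (\<phi> - 1))\<close>, whose modulus is explicit, instead of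
  taking complex logarithms. It works because \<open>\<phi> - 1\<close> is of order \<open>1 / n\<close> and both \<open>\<phi>\<close> and \<open>exp (\<phi> - 1)\<close>
  lie in the unit disc; the latter since the real part of \<open>\<phi> - 1\<close> is not positive.\<close>

lemma char_power_exp_bound:
  assumes P: "prob_space P" and Y: "standardized P Y" and n: "1 \<le> n" "t\<^sup>2 * 2 \<le> real n"
  defines "z \<equiv> char (distr P borel Y) (t / sqrt n) - 1"
  shows "cmod ((1 + z) ^ n - exp (of_nat n * z)) \<le> 12 * t ^ 4 / real n"
    and "Re z = - (\<integral>x. 1 - cos (t * Y x / sqrt n) \<partial>P)"
proof -
  interpret prob_space P by fact
  have L2: "L2_fun P Y" and [measurable]: "Y \<in> borel_measurable P" and sq: "integrable P (\<lambda>x. (Y x)\<^sup>2)"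
    and EY: "expectation Y = 0" "expectation (\<lambda>x. (Y x)\<^sup>2) = 1"
    using Y by (auto simp: standardized_def L2_fun_def)
  have int: "integrable P Y" by (rule square_integrable_imp_integrable) (use sq in auto)
  define s where "s = t / sqrt n"
  have s2: "s\<^sup>2 = t\<^sup>2 / real n" by (simp add: s_def power_divide)
  have sint: "integrable P (\<lambda>x. iexp (s * Y x))"
    by (intro integrable_const_bound[where B = 1]) auto
  have zc: "z = expectation (\<lambda>x. iexp (s * Y x)) - 1"
    by (simp add: z_def char_def integral_distr s_def)
  have "Re z = expectation (\<lambda>x. cos (s * Y x)) - 1"
    unfolding zc using sint by (simp add: Re_exp flip: integral_Re)
  moreover have "integrable P (\<lambda>x. cos (s * Y x))"
    by (intro integrable_const_bound[where B = 1]) auto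
  ultimately show Rez: "Re z = - (\<integral>x. 1 - cos (t * Y x / sqrt n) \<partial>P)"
    by (simp add: s_def prob_space)
  have b1: "cmod (z + 1 - (1 - s\<^sup>2 * 1 / 2)) \<le> (s\<^sup>2 / 6) * expectation (\<lambda>x. min (6 * (Y x)\<^sup>2) (\<bar>s\<bar> * \<bar>Y x\<bar> ^ 3))"
    unfolding z_def s_def[symmetric] diff_add_cancel by (rule char_approx3') (use int sq EY in auto)
  also have "\<dots> \<le> (s\<^sup>2 / 6) * expectation (\<lambda>x. 6 * (Y x)\<^sup>2)"
  proof (intro mult_left_mono integral_mono)
    show i6: "integrable P (\<lambda>x. 6 * (Y x)\<^sup>2)" using sq by simp
    show "integrable P (\<lambda>x. min (6 * (Y x)\<^sup>2) (\<bar>s\<bar> * \<bar>Y x\<bar> ^ 3))"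
      by (rule Bochner_Integration.integrable_bound[OF i6]) (auto simp: min_def)
  qed auto
  also have "\<dots> = s\<^sup>2" using EY by simp
  finally have "cmod (z + of_real (s\<^sup>2 / 2)) \<le> s\<^sup>2" by simp
  moreover have "cmod (of_real (s\<^sup>2 / 2)) = s\<^sup>2 / 2" unfolding norm_of_real by simp
  moreover have "cmod z \<le> cmod (z + of_real (s\<^sup>2 / 2)) + cmod (of_real (s\<^sup>2 / 2))"
    using norm_triangle_ineq4[of "z + of_real (s\<^sup>2 / 2)" "of_real (s\<^sup>2 / 2)"] by simp
  moreover have "0 \<le> s\<^sup>2" by simp
  ultimately have zs: "cmod z \<le> 2 * s\<^sup>2" by linarith
  have "2 * s\<^sup>2 \<le> 1" using n by (simp add: s2 field_simps)
  with zs have z1: "cmod z \<le> 1" by linarith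
  have n1: "cmod (1 + z) \<le> 1"
    unfolding z_def by (simp add: real_distribution.cmod_char_le_1 real_distribution_distr)
  have "Re z \<le> 0" unfolding Rez by (simp add: Bochner_Integration.integral_nonneg)
  then have n2: "cmod (exp z) \<le> 1" by simp
  have "cmod ((1 + z) ^ n - exp z ^ n) \<le> real n * cmod ((1 + z) - exp z)"
    by (rule norm_power_diff[OF n1 n2])
  also have "\<dots> \<le> real n * (3 * (2 * s\<^sup>2)\<^sup>2)"
  proof (rule mult_left_mono)
    have "cmod ((1 + z) - exp z) \<le> 3 * (cmod z)\<^sup>2"
      using exp_near_one_plus[OF z1] by (simp add: norm_minus_commute)
    also have "\<dots> \<le> 3 * (2 * s\<^sup>2)\<^sup>2" using zs by (intro mult_left_mono power_mono) auto
    finally show "cmod ((1 + z) - exp z) \<le> 3 * (2 * s\<^sup>2)\<^sup>2" .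
  qed simp
  also have "\<dots> = 12 * t ^ 4 / real n"
  proof -
    have "(2 * s\<^sup>2)\<^sup>2 = 4 * (t ^ 4 / (real n)\<^sup>2)"
      by (simp add: s2 power_mult_distrib power_divide flip: power_mult)
    then show ?thesis using n by (simp add: power2_eq_square)
  qed
  finally show "cmod ((1 + z) ^ n - exp (of_nat n * z)) \<le> 12 * t ^ 4 / real n"
    by (simp add: exp_of_nat_mult)
qed

text \<open>The second step. The function \<open>t\<^sup>2 Y\<^sup>2 / 2 - n (1 - cos (t Y / \<surd>n))\<close> is nonnegative. On \<open>|Y| > \<delta> \<surd>n\<close> the
  subtracted term is at most \<open>2 n \<le> 2 Y\<^sup>2 / \<delta>\<^sup>2\<close>, so the given value of \<open>t\<close> leaves at least \<open>Y\<^sup>2\<close>.\<close>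

lemma tail_moment_le_cos:
  assumes P: "prob_space P" and Y: "standardized P Y" and n: "1 \<le> n" and \<delta>: "0 < \<delta>"
    and t: "t\<^sup>2 / 2 = 2 / \<delta>\<^sup>2 + 1"
  shows "tail_moment P Y (\<delta> * sqrt n) \<le> t\<^sup>2 / 2 - real n * (\<integral>x. 1 - cos (t * Y x / sqrt n) \<partial>P)"
proof -
  interpret prob_space P by fact
  have L2: "L2_fun P Y" and [measurable]: "Y \<in> borel_measurable P" and sq: "integrable P (\<lambda>x. (Y x)\<^sup>2)"
    and EY: "expectation (\<lambda>x. (Y x)\<^sup>2) = 1"
    using Y by (auto simp: standardized_def L2_fun_def)
  let ?c = "\<lambda>x. 1 - cos (t * Y x / sqrt n)"
  have c: "integrable P ?c"
  proof (rule integrable_const_bound[where B = 2])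
    have "norm (1 - cos y) \<le> 2" for y :: real
      using cos_ge_minus_one[of y] cos_le_one[of y] by (auto simp: abs_le_iff)
    then show "AE x in P. norm (?c x) \<le> 2" by simp
  qed measurable
  have "tail_moment P Y (\<delta> * sqrt n) \<le> expectation (\<lambda>x. t\<^sup>2 / 2 * (Y x)\<^sup>2 - real n * ?c x)"
    unfolding tail_moment_def
  proof (rule integral_mono)
    show "integrable P (\<lambda>x. (Y x)\<^sup>2 * indicat_real {x. \<delta> * sqrt n < \<bar>Y x\<bar>} x)"
      by (rule tail_moment_integrable[OF L2])
    show "integrable P (\<lambda>x. t\<^sup>2 / 2 * (Y x)\<^sup>2 - real n * ?c x)"
      by (rule Bochner_Integration.integrable_diff[OF integrable_mult_right[OF sq] integrable_mult_right[OF c]])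
    fix x
    show "(Y x)\<^sup>2 * indicat_real {x. \<delta> * sqrt n < \<bar>Y x\<bar>} x \<le> t\<^sup>2 / 2 * (Y x)\<^sup>2 - real n * ?c x"
    proof (cases "\<delta> * sqrt n < \<bar>Y x\<bar>")
      case True
      have "(\<delta> * sqrt n)\<^sup>2 \<le> (Y x)\<^sup>2"
        using True \<delta> by (simp flip: abs_le_square_iff)
      then have "real n \<le> (Y x)\<^sup>2 / \<delta>\<^sup>2" using \<delta> by (simp add: power_mult_distrib field_simps)
      moreover have "real n * ?c x \<le> real n * 2"
        using cos_ge_minus_one[of "t * Y x / sqrt n"] by (intro mult_left_mono) auto
      moreover have "t\<^sup>2 / 2 * (Y x)\<^sup>2 = 2 * ((Y x)\<^sup>2 / \<delta>\<^sup>2) + (Y x)\<^sup>2"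
        unfolding t by (simp add: distrib_right)
      ultimately have "(Y x)\<^sup>2 \<le> t\<^sup>2 / 2 * (Y x)\<^sup>2 - real n * ?c x" by linarith
      then show ?thesis using True by simp
    next
      case False
      have "real n * ?c x \<le> real n * ((t * Y x / sqrt n)\<^sup>2 / 2)"
        by (intro mult_left_mono one_minus_cos_le) simp
      also have "\<dots> = t\<^sup>2 / 2 * (Y x)\<^sup>2" using n by (simp add: power_divide power_mult_distrib)
      finally show ?thesis using False by simp
    qed
  qed
  also have "\<dots> = t\<^sup>2 / 2 * 1 - real n * expectation ?c"
    by (simp only: Bochner_Integration.integral_diff[OF integrable_mult_right[OF sq] integrable_mult_right[OF c]]
        integral_mult_right_zero EY)
  finally show ?thesis by simp
qed

text \<open>Taking moduli in \<open>exp (n (\<phi> - 1)) \<rightarrow> exp (- t\<^sup>2 / 2)\<close> gives \<open>n E (1 - cos (t Y / \<surd>n)) \<rightarrow> t\<^sup>2 / 2\<close>, that is, the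
  upper bound of the preceding lemma tends to zero.\<close>

lemma char_tendsto_imp_lindeberg:
  assumes P: "prob_space P" and Y: "\<And>n. 1 \<le> n \<Longrightarrow> standardized P (Y n)"
    and lim: "\<And>t. (\<lambda>n. (char (distr P borel (Y n)) (t / sqrt (real n))) ^ n) \<longlonglongrightarrow> complex_of_real (exp (- (t\<^sup>2) / 2))"
    and \<delta>: "0 < \<delta>"
  shows "(\<lambda>n. tail_moment P (Y n) (\<delta> * sqrt (real n))) \<longlonglongrightarrow> 0"
proof -
  define t where "t = sqrt (2 * (2 / \<delta>\<^sup>2 + 1))"
  have t: "t\<^sup>2 / 2 = 2 / \<delta>\<^sup>2 + 1" using \<delta> by (simp add: t_def)
  define z where "z n = char (distr P borel (Y n)) (t / sqrt (real n)) - 1" for n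
  define I where "I n = (\<integral>x. 1 - cos (t * Y n x / sqrt n) \<partial>P)" for n
  have large: "\<forall>\<^sub>F n in sequentially. 1 \<le> n \<and> t\<^sup>2 * 2 \<le> real n"
    using eventually_ge_at_top[of "1::nat"] eventually_ge_at_top[of "nat \<lceil>t\<^sup>2 * 2\<rceil>"]
    by eventually_elim linarith
  have d: "(\<lambda>n. (1 + z n) ^ n - exp (of_nat n * z n)) \<longlonglongrightarrow> 0"
  proof (rule Lim_null_comparison)
    show "\<forall>\<^sub>F n in sequentially. cmod ((1 + z n) ^ n - exp (of_nat n * z n)) \<le> 12 * t ^ 4 / real n"
      using large by eventually_elim (use char_power_exp_bound(1)[OF P Y] in \<open>auto simp: z_def\<close>)
    show "(\<lambda>n. 12 * t ^ 4 / real n) \<longlonglongrightarrow> 0" by (rule lim_const_over_n)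
  qed
  have "(\<lambda>n. (1 + z n) ^ n) \<longlonglongrightarrow> complex_of_real (exp (- (t\<^sup>2) / 2))"
    using lim[of t] by (simp add: z_def)
  from tendsto_diff[OF this d]
  have "(\<lambda>n. exp (of_nat n * z n)) \<longlonglongrightarrow> complex_of_real (exp (- (t\<^sup>2) / 2))" by simp
  from tendsto_norm[OF this]
  have "(\<lambda>n. exp (real n * Re (z n))) \<longlonglongrightarrow> exp (- (t\<^sup>2) / 2)" by (simp add: norm_of_real)
  from tendsto_ln[OF this] have "(\<lambda>n. real n * Re (z n)) \<longlonglongrightarrow> - (t\<^sup>2) / 2" by simp
  from tendsto_add[OF tendsto_const[of "t\<^sup>2 / 2"] this]
  have lim0: "(\<lambda>n. t\<^sup>2 / 2 + real n * Re (z n)) \<longlonglongrightarrow> 0" by simp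
  show ?thesis
  proof (rule Lim_null_comparison[OF _ lim0])
    show "\<forall>\<^sub>F n in sequentially. norm (tail_moment P (Y n) (\<delta> * sqrt (real n))) \<le> t\<^sup>2 / 2 + real n * Re (z n)"
      using large
    proof eventually_elim
      case (elim n)
      have "Re (z n) = - I n"
        unfolding z_def I_def using char_power_exp_bound(2)[OF P Y[of n]] elim by simp
      with tail_moment_le_cos[OF P Y[of n] _ \<delta> t] elim tail_moment_nonneg[of P "Y n"]
      show ?case by (simp add: I_def)
    qed
  qed
qed

lemma char_iid_sum:
  assumes P: "prob_space P" and M: "prob_space M" and iid: "iid_sample P M n X"
    and [measurable]: "Y \<in> borel_measurable P"
  shows "char (distr M borel (\<lambda>\<omega>. (\<Sum>i<n. Y (X i \<omega>)) / c)) t = (char (distr P borel Y) (t / c)) ^ n"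
proof -
  interpret prob_space M by fact
  note X = iid_sample_facts[OF M iid]
  have "indep_vars (\<lambda>_. borel) (\<lambda>i \<omega>. Y (X i \<omega>) / c) {..<n}"
    by (rule indep_vars_compose2[where M' = "\<lambda>_. P" and X = X]) (use iid in \<open>auto simp: iid_sample_def\<close>)
  from char_distr_sum[OF this]
  have "char (distr M borel (\<lambda>\<omega>. (\<Sum>i<n. Y (X i \<omega>)) / c)) t = (\<Prod>i<n. char (distr M borel (\<lambda>\<omega>. Y (X i \<omega>) / c)) t)"
    by (simp add: sum_divide_distrib)
  also have "\<dots> = (\<Prod>i<n. char (distr P borel Y) (t / c))"
  proof (rule prod.cong)
    fix i assume "i \<in> {..<n}"
    then have i: "i < n" by simp
    have [measurable]: "X i \<in> measurable M P" by (rule X(1)[OF i])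
    have "distr M borel (\<lambda>\<omega>. Y (X i \<omega>) / c) = distr (distr M P (X i)) borel (\<lambda>x. Y x / c)"
      by (simp add: distr_distr comp_def)
    also have "distr M P (X i) = P" using iid i by (simp add: iid_sample_def)
    finally show "char (distr M borel (\<lambda>\<omega>. Y (X i \<omega>) / c)) t = char (distr P borel Y) (t / c)"
      by (simp add: char_def integral_distr)
  qed simp
  finally show ?thesis by simp
qed

text \<open>Levy's theorem turns asymptotic normality into \<open>\<phi>(t / \<surd>n)\<^sup>n \<rightarrow> exp (- t\<^sup>2 / 2)\<close> for the common characteristic
  function \<open>\<phi>\<close> of the terms of a row, and the two halves above settle when this happens.\<close>

theorem lindeberg_feller_iid_rows:
  assumes P: "prob_space P" and M: "\<And>n. 1 \<le> n \<Longrightarrow> prob_space (M n)"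
    and iid: "\<And>n. 1 \<le> n \<Longrightarrow> iid_sample P (M n) n (X n)"
    and Y: "\<And>n. 1 \<le> n \<Longrightarrow> standardized P (Y n)"
  shows "weak_conv_m (\<lambda>n. distr (M n) borel (\<lambda>\<omega>. (\<Sum>i<n. Y n (X n i \<omega>)) / sqrt (real n))) std_normal_distribution
    \<longleftrightarrow> (\<forall>\<delta>>0. (\<lambda>n. tail_moment P (Y n) (\<delta> * sqrt (real n))) \<longlonglongrightarrow> 0)"
proof -
  interpret prob_array M by (rule prob_array.intro) (rule M)
  have Ym: "Y n \<in> borel_measurable P" if "1 \<le> n" for n
    using Y[OF that] by (simp add: standardized_def L2_fun_def)
  have meas: "(\<lambda>\<omega>. (\<Sum>i<n. Y n (X n i \<omega>)) / sqrt (real n)) \<in> borel_measurable (M n)" if "1 \<le> n" for n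
    using measurable_compose[OF iid_sample_facts(1)[OF M[OF that] iid[OF that]] Ym[OF that]]
    by (intro borel_measurable_divide borel_measurable_sum) auto
  have ev: "\<forall>\<^sub>F n in sequentially. char (distr (M n) borel (\<lambda>\<omega>. (\<Sum>i<n. Y n (X n i \<omega>)) / sqrt (real n))) t =
      (char (distr P borel (Y n)) (t / sqrt (real n))) ^ n" for t
    by (rule eventually_ge_1) (rule char_iid_sum[OF P M iid Ym])
  have "weak_conv_m (\<lambda>n. distr (M n) borel (\<lambda>\<omega>. (\<Sum>i<n. Y n (X n i \<omega>)) / sqrt (real n))) std_normal_distribution
    \<longleftrightarrow> (\<forall>t. (\<lambda>n. char (distr (M n) borel (\<lambda>\<omega>. (\<Sum>i<n. Y n (X n i \<omega>)) / sqrt (real n))) t)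
          \<longlonglongrightarrow> char std_normal_distribution t)"
    by (rule weak_conv_iff_char) (use meas real_dist_normal_dist in auto)
  also have "\<dots> \<longleftrightarrow> (\<forall>t. (\<lambda>n. (char (distr P borel (Y n)) (t / sqrt (real n))) ^ n) \<longlonglongrightarrow> complex_of_real (exp (- (t\<^sup>2) / 2)))"
    by (simp only: tendsto_cong[OF ev] char_std_normal_distribution)
  also have "\<dots> \<longleftrightarrow> (\<forall>\<delta>>0. (\<lambda>n. tail_moment P (Y n) (\<delta> * sqrt (real n))) \<longlonglongrightarrow> 0)"
  proof (intro iffI allI impI)
    show "(\<lambda>n. tail_moment P (Y n) (\<delta> * sqrt (real n))) \<longlonglongrightarrow> 0"
      if "\<forall>t. (\<lambda>n. (char (distr P borel (Y n)) (t / sqrt (real n))) ^ n) \<longlonglongrightarrow> complex_of_real (exp (- (t\<^sup>2) / 2))" "0 < \<delta>" for \<delta>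
      by (rule char_tendsto_imp_lindeberg[OF P Y _ that(2)]) (use that(1) in auto)
    show "(\<lambda>n. (char (distr P borel (Y n)) (t / sqrt (real n))) ^ n) \<longlonglongrightarrow> complex_of_real (exp (- (t\<^sup>2) / 2))"
      if "\<forall>\<delta>>0. (\<lambda>n. tail_moment P (Y n) (\<delta> * sqrt (real n))) \<longlonglongrightarrow> 0" for t
      by (rule lindeberg_imp_char_tendsto[OF P Y]) (use that in auto)
  qed
  finally show ?thesis .
qed

section \<open>Consistency of the mean of squares\<close>

text \<open>Truncate: \<open>Y\<^sup>2 = Z + R\<close> with \<open>R\<close> the part on \<open>|Y| > \<delta> \<surd>n\<close>. Then \<open>Z\<^sup>2 \<le> \<delta>\<^sup>2 n Y\<^sup>2\<close>, so the mean of the \<open>Z(X\<^sub>i)\<close> has variance at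
  most \<open>\<delta>\<^sup>2\<close>, while \<open>R\<close> contributes its mean twice, once through the average and once through the centring.\<close>

lemma mean_of_squares_L1_bound:
  assumes P: "prob_space P" and M: "prob_space M" and iid: "iid_sample P M n X" and n: "1 \<le> n"
    and Y: "standardized P Y" and \<delta>: "0 < \<delta>"
  defines "V \<equiv> \<lambda>\<omega>. (\<Sum>i<n. (Y (X i \<omega>))\<^sup>2) / real n - 1"
  shows "integrable M V" and "(\<integral>\<omega>. \<bar>V \<omega>\<bar> \<partial>M) \<le> \<delta> + 2 * tail_moment P Y (\<delta> * sqrt n)"
proof -
  interpret P: prob_space P by fact
  interpret M: prob_space M by fact
  note X = iid_sample_facts[OF M iid]
  have L2: "L2_fun P Y" and [measurable]: "Y \<in> borel_measurable P" and sq: "integrable P (\<lambda>x. (Y x)\<^sup>2)"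
    and EY: "(\<integral>x. (Y x)\<^sup>2 \<partial>P) = 1"
    using Y by (auto simp: standardized_def L2_fun_def)
  define L where "L = tail_moment P Y (\<delta> * sqrt n)"
  define R where "R x = (Y x)\<^sup>2 * indicat_real {x. \<delta> * sqrt n < \<bar>Y x\<bar>} x" for x
  define Z where "Z x = (Y x)\<^sup>2 - R x" for x
  have Rint: "integrable P R" using tail_moment_integrable[OF L2] unfolding R_def .
  have ER: "(\<integral>x. R x \<partial>P) = L" by (simp add: L_def tail_moment_def R_def)
  have Zint: "integrable P Z" unfolding Z_def using sq Rint by (rule Bochner_Integration.integrable_diff)
  have EZ: "(\<integral>x. Z x \<partial>P) = 1 - L" unfolding Z_def using sq Rint ER EY by simp
  have R0: "0 \<le> R x" for x by (simp add: R_def)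
  have Zle: "(Z x)\<^sup>2 \<le> \<delta>\<^sup>2 * real n * (Y x)\<^sup>2" for x
  proof (cases "\<delta> * sqrt n < \<bar>Y x\<bar>")
    case True
    then show ?thesis by (simp add: Z_def R_def)
  next
    case False
    then have "(Y x)\<^sup>2 \<le> (\<delta> * sqrt n)\<^sup>2"
      using \<delta> by (simp flip: abs_le_square_iff)
    then have "(Y x)\<^sup>2 * (Y x)\<^sup>2 \<le> (\<delta> * sqrt n)\<^sup>2 * (Y x)\<^sup>2" by (rule mult_right_mono) simp
    moreover have "(\<delta> * sqrt n)\<^sup>2 = \<delta>\<^sup>2 * real n" by (simp add: power_mult_distrib)
    ultimately show ?thesis using False by (simp add: Z_def R_def power2_eq_square[of "(Y x)\<^sup>2"])
  qed
  have Z2int: "integrable P (\<lambda>x. (Z x)\<^sup>2)"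
    by (rule Bochner_Integration.integrable_bound[OF integrable_mult_right[OF sq, of "\<delta>\<^sup>2 * real n"]])
      (use Zint Zle in auto)
  have Z2: "(\<integral>x. (Z x)\<^sup>2 \<partial>P) \<le> \<delta>\<^sup>2 * real n"
    using integral_mono[OF Z2int integrable_mult_right[OF sq, of "\<delta>\<^sup>2 * real n"] Zle] EY by simp
  have ZL2: "L2_fun P Z" using Z2int Zint by (simp add: L2_fun_def)
  define D where "D \<omega> = (\<Sum>i<n. Z (X i \<omega>)) / real n - (\<integral>x. Z x \<partial>P)" for \<omega>
  have n0: "0 < n" using n by simp
  note mse = iid_mean_square_error[OF P M iid n0 ZL2, folded D_def]
  have ED: "(\<integral>\<omega>. (D \<omega>)\<^sup>2 \<partial>M) \<le> \<delta>\<^sup>2"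
  proof -
    have "(\<integral>x. (Z x)\<^sup>2 \<partial>P) / real n \<le> \<delta>\<^sup>2 * real n / real n"
      using Z2 by (rule divide_right_mono) simp
    with mse(2) n show ?thesis by simp
  qed
  have iY: "integrable M (\<lambda>\<omega>. (Y (X i \<omega>))\<^sup>2)" if "i < n" for i
    using X(2)[OF that, of "\<lambda>x. (Y x)\<^sup>2"] sq by simp
  have iR: "integrable M (\<lambda>\<omega>. R (X i \<omega>))" "(\<integral>\<omega>. R (X i \<omega>) \<partial>M) = L" if "i < n" for i
    using X(2)[OF that, of R] X(3)[OF that, of R] Rint ER by auto
  show Vint: "integrable M V"
    unfolding V_def using iY by (intro Bochner_Integration.integrable_diff integrable_divide Bochner_Integration.integrable_sum) auto
  let ?R = "\<lambda>\<omega>. (\<Sum>i<n. R (X i \<omega>)) / real n"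
  have Rm: "integrable M ?R" using iR by (intro integrable_divide Bochner_Integration.integrable_sum) auto
  have ERm: "(\<integral>\<omega>. ?R \<omega> \<partial>M) = L" using iR n by (simp add: Bochner_Integration.integral_sum)
  have L0: "0 \<le> L" by (simp add: L_def tail_moment_nonneg)
  have VD: "V \<omega> = D \<omega> + ?R \<omega> - L" for \<omega>
    unfolding V_def D_def EZ by (simp add: Z_def sum_subtractf diff_divide_distrib)
  \<comment> \<open>The inequality \<open>|D| \<le> \<delta> / 2 + D\<^sup>2 / (2 \<delta>)\<close> turns the variance bound into an \<open>L\<^sup>1\<close> bound.\<close>
  have bound: "\<bar>V \<omega>\<bar> \<le> (\<delta> / 2 + L) + ((1 / (2 * \<delta>)) * (D \<omega>)\<^sup>2 + ?R \<omega>)" for \<omega>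
  proof -
    have "2 * \<bar>D \<omega>\<bar> * \<delta> \<le> (D \<omega>)\<^sup>2 + \<delta>\<^sup>2"
      using sum_squares_bound[of "\<bar>D \<omega>\<bar>" \<delta>] by simp
    then have "\<bar>D \<omega>\<bar> \<le> ((D \<omega>)\<^sup>2 + \<delta>\<^sup>2) / (2 * \<delta>)" using \<delta> by (simp add: field_simps)
    also have "\<dots> = \<delta> / 2 + (1 / (2 * \<delta>)) * (D \<omega>)\<^sup>2"
      using \<delta> by (simp add: field_simps power2_eq_square)
    finally have "\<bar>D \<omega>\<bar> \<le> \<delta> / 2 + (1 / (2 * \<delta>)) * (D \<omega>)\<^sup>2" .
    moreover have "0 \<le> ?R \<omega>" using R0 by (simp add: sum_nonneg)
    ultimately show ?thesis unfolding VD using L0 by linarith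
  qed
  have "(\<integral>\<omega>. \<bar>V \<omega>\<bar> \<partial>M) \<le> (\<integral>\<omega>. (\<delta> / 2 + L) + ((1 / (2 * \<delta>)) * (D \<omega>)\<^sup>2 + ?R \<omega>) \<partial>M)"
    using Vint mse(1) Rm bound
    by (intro integral_mono integrable_abs Bochner_Integration.integrable_add integrable_mult_right M.integrable_const)
  also have "\<dots> = (\<delta> / 2 + L) + ((1 / (2 * \<delta>)) * (\<integral>\<omega>. (D \<omega>)\<^sup>2 \<partial>M) + L)"
    using mse(1) Rm ERm by (simp add: M.prob_space)
  also have "(1 / (2 * \<delta>)) * (\<integral>\<omega>. (D \<omega>)\<^sup>2 \<partial>M) \<le> (1 / (2 * \<delta>)) * \<delta>\<^sup>2"
    using ED \<delta> by (intro mult_left_mono) auto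
  also have "(1 / (2 * \<delta>)) * \<delta>\<^sup>2 = \<delta> / 2" using \<delta> by (simp add: power2_eq_square)
  finally show "(\<integral>\<omega>. \<bar>V \<omega>\<bar> \<partial>M) \<le> \<delta> + 2 * tail_moment P Y (\<delta> * sqrt n)"
    by (simp add: L_def)
qed

lemma mean_of_squares_consistent:
  assumes P: "prob_space P" and M: "\<And>n. 1 \<le> n \<Longrightarrow> prob_space (M n)"
    and iid: "\<And>n. 1 \<le> n \<Longrightarrow> iid_sample P (M n) n (X n)"
    and Y: "\<And>n. 1 \<le> n \<Longrightarrow> standardized P (Y n)"
    and lind: "\<And>\<delta>. 0 < \<delta> \<Longrightarrow> (\<lambda>n. tail_moment P (Y n) (\<delta> * sqrt (real n))) \<longlonglongrightarrow> 0"
  shows "null_in_prob M (\<lambda>n \<omega>. (\<Sum>i<n. (Y n (X n i \<omega>))\<^sup>2) / real n - 1)"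
proof -
  interpret prob_array M by (rule prob_array.intro) (rule M)
  define V where "V n = (\<lambda>\<omega>. (\<Sum>i<n. (Y n (X n i \<omega>))\<^sup>2) / real n - 1)" for n
  have L1: "integrable (M n) (V n)" "(\<integral>\<omega>. \<bar>V n \<omega>\<bar> \<partial>M n) \<le> \<delta> + 2 * tail_moment P (Y n) (\<delta> * sqrt n)"
    if "1 \<le> n" "0 < \<delta>" for n \<delta>
    unfolding V_def
    using mean_of_squares_L1_bound[OF P M[OF that(1)] iid[OF that(1)] that(1) Y[OF that(1)] that(2)] by auto
  have "(\<lambda>n. \<integral>\<omega>. \<bar>V n \<omega>\<bar> \<partial>M n) \<longlonglongrightarrow> 0"
  proof (rule small_if_arbitrarily_close[where C = 1])
    fix \<delta> :: real assume \<delta>: "0 < \<delta>"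
    have "(\<lambda>n. 2 * tail_moment P (Y n) (\<delta> * sqrt (real n))) \<longlonglongrightarrow> 0"
      using tendsto_mult_right_zero[OF lind[OF \<delta>]] .
    moreover have "\<forall>\<^sub>F n in sequentially. norm (\<integral>\<omega>. \<bar>V n \<omega>\<bar> \<partial>M n) \<le>
        2 * tail_moment P (Y n) (\<delta> * sqrt (real n)) + 1 * \<delta>"
      by (rule eventually_ge_1) (use L1(2)[OF _ \<delta>] in \<open>simp add: add.commute\<close>)
    ultimately show "\<exists>v. v \<longlonglongrightarrow> 0 \<and> (\<forall>\<^sub>F n in sequentially. norm (\<integral>\<omega>. \<bar>V n \<omega>\<bar> \<partial>M n) \<le> v n + 1 * \<delta>)"
      by blast
  qed simp
  moreover have "\<forall>\<^sub>F n in sequentially. integrable (M n) (V n) \<and> (\<integral>\<omega>. \<bar>V n \<omega>\<bar> \<partial>M n) \<le> (\<integral>\<omega>. \<bar>V n \<omega>\<bar> \<partial>M n)"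
    by (rule eventually_ge_1) (use L1(1)[where \<delta> = 1] in simp)
  ultimately have "null_in_prob M V" by (intro null_in_prob_L1)
  then show ?thesis unfolding V_def .
qed

section \<open>Moment bounds for the sampled design\<close>

lemma iid_sum_mean_square_error:
  assumes P: "prob_space P" and M: "prob_space M" and iid: "iid_sample P M n X" and n: "0 < n"
    and \<phi>: "\<And>k. k \<in> I \<Longrightarrow> L2_fun P (\<phi> k)"
  defines "D \<equiv> \<lambda>\<omega>. \<Sum>k\<in>I. ((\<Sum>i<n. \<phi> k (X i \<omega>)) / real n - (\<integral>x. \<phi> k x \<partial>P))\<^sup>2"
  shows "integrable M D" and "(\<integral>\<omega>. D \<omega> \<partial>M) \<le> (\<integral>x. (\<Sum>k\<in>I. (\<phi> k x)\<^sup>2) \<partial>P) / real n"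
proof -
  note mse = iid_mean_square_error[OF P M iid n \<phi>]
  show "integrable M D" unfolding D_def by (intro Bochner_Integration.integrable_sum mse(1))
  have "(\<integral>\<omega>. D \<omega> \<partial>M) = (\<Sum>k\<in>I. \<integral>\<omega>. ((\<Sum>i<n. \<phi> k (X i \<omega>)) / real n - (\<integral>x. \<phi> k x \<partial>P))\<^sup>2 \<partial>M)"
    unfolding D_def by (intro Bochner_Integration.integral_sum mse(1))
  also have "\<dots> \<le> (\<Sum>k\<in>I. (\<integral>x. (\<phi> k x)\<^sup>2 \<partial>P) / real n)"
    by (intro sum_mono mse(2))
  also have "\<dots> = (\<integral>x. (\<Sum>k\<in>I. (\<phi> k x)\<^sup>2) \<partial>P) / real n"
    using \<phi> by (simp add: sum_divide_distrib[symmetric] L2_fun_def)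
  finally show "(\<integral>\<omega>. D \<omega> \<partial>M) \<le> (\<integral>x. (\<Sum>k\<in>I. (\<phi> k x)\<^sup>2) \<partial>P) / real n" .
qed

lemma L2_fun_mult_bounded:
  assumes u: "L2_fun P u" and v: "v \<in> borel_measurable P" and b: "\<And>x. x \<in> space P \<Longrightarrow> (v x)\<^sup>2 \<le> S"
  shows "L2_fun P (\<lambda>x. u x * v x)"
proof -
  have [measurable]: "u \<in> borel_measurable P" "v \<in> borel_measurable P" and sq: "integrable P (\<lambda>x. (u x)\<^sup>2)"
    using u v by (auto simp: L2_fun_def)
  have "integrable P (\<lambda>x. (u x * v x)\<^sup>2)"
  proof (rule Bochner_Integration.integrable_bound)
    show "integrable P (\<lambda>x. (u x)\<^sup>2 * S)" using sq by simp
    have "norm ((u x * v x)\<^sup>2) \<le> norm ((u x)\<^sup>2 * S)" if "x \<in> space P" for x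
      using b[OF that] order_trans[OF zero_le_power2 b[OF that]]
      by (simp add: power_mult_distrib abs_mult mult_left_mono)
    then show "AE x in P. norm ((u x * v x)\<^sup>2) \<le> norm ((u x)\<^sup>2 * S)" by (intro AE_I2)
  qed measurable
  then show ?thesis by (simp add: L2_fun_def)
qed

definition sample_design :: "(nat \<Rightarrow> 'w \<Rightarrow> 's) \<Rightarrow> (nat \<Rightarrow> 's \<Rightarrow> real) \<Rightarrow> 'w \<Rightarrow> nat \<Rightarrow> nat \<Rightarrow> real" where
  "sample_design X g \<omega> k i = g k (X i \<omega>)"

text \<open>One row of the array, with the controls already replaced by an orthonormal basis \<open>g\<close> and with the residual
  normalised to \<open>Y = \<epsilon> / \<sigma>\<close>.\<close>

locale control_sample =
  fixes P :: "'s measure" and M :: "'w measure" and X :: "nat \<Rightarrow> 'w \<Rightarrow> 's" and n m :: nat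
    and g :: "nat \<Rightarrow> 's \<Rightarrow> real" and Y :: "'s \<Rightarrow> real"
  assumes P: "prob_space P" and M: "prob_space M" and iid: "iid_sample P M n X" and n: "0 < n"
    and g: "orthonormal_L2 P m g" and g_mean: "\<And>k. k < m \<Longrightarrow> (\<integral>x. g k x \<partial>P) = 0"
    and Y: "standardized P Y" and Yg: "\<And>k. k < m \<Longrightarrow> (\<integral>x. Y x * g k x \<partial>P) = 0"
begin

lemma g_L2: "k < m \<Longrightarrow> L2_fun P (g k)"
  using g by (simp add: orthonormal_L2_def)

lemma sample_measurable:
  assumes "\<phi> \<in> borel_measurable P" "i < n"
  shows "(\<lambda>\<omega>. \<phi> (X i \<omega>)) \<in> borel_measurable M"
  using measurable_compose[OF iid_sample_facts(1)[OF M iid] assms(1)] assms(2) by simp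

lemma Y_measurable: "i < n \<Longrightarrow> (\<lambda>\<omega>. Y (X i \<omega>)) \<in> borel_measurable M"
  using Y by (intro sample_measurable) (simp_all add: standardized_def L2_fun_def)

lemma design_measurable: "k < m \<Longrightarrow> i < n \<Longrightarrow> (\<lambda>\<omega>. sample_design X g \<omega> k i) \<in> borel_measurable M"
  unfolding sample_design_def using g_L2 by (intro sample_measurable) (simp_all add: L2_fun_def)

lemma cross_moments_measurable:
  assumes "\<And>i. i < n \<Longrightarrow> (\<lambda>\<omega>. z \<omega> i) \<in> borel_measurable M"
  shows "(\<lambda>\<omega>. cross_moments n m (sample_design X g \<omega>) (z \<omega>)) \<in> borel_measurable M"
  unfolding cross_moments_def
  by (intro borel_measurable_sum borel_measurable_power borel_measurable_divide borel_measurable_const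
      sample_ip_measurable assms design_measurable) auto

lemma gram_deviation_measurable: "(\<lambda>\<omega>. gram_deviation n m (sample_design X g \<omega>)) \<in> borel_measurable M"
  unfolding gram_deviation_def case_prod_unfold
  by (intro borel_measurable_sum borel_measurable_power borel_measurable_divide borel_measurable_diff
      borel_measurable_const sample_ip_measurable design_measurable) auto

text \<open>The mean leverage is the number of controls.\<close>

lemma leverage_integral:
  "integrable P (\<lambda>x. \<Sum>k<m. (g k x)\<^sup>2)" "(\<integral>x. (\<Sum>k<m. (g k x)\<^sup>2) \<partial>P) = real m"
proof -
  have i: "integrable P (\<lambda>x. (g k x)\<^sup>2)" "(\<integral>x. (g k x)\<^sup>2 \<partial>P) = 1" if "k < m" for k
    using g that by (auto simp: orthonormal_L2_def L2_fun_def power2_eq_square)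
  then show "integrable P (\<lambda>x. \<Sum>k<m. (g k x)\<^sup>2)" by (intro Bochner_Integration.integrable_sum) auto
  show "(\<integral>x. (\<Sum>k<m. (g k x)\<^sup>2) \<partial>P) = real m"
    using i by (simp add: Bochner_Integration.integral_sum)
qed

lemma cross_moments_one:
  "integrable M (\<lambda>\<omega>. cross_moments n m (sample_design X g \<omega>) (\<lambda>_. 1))"
  "(\<integral>\<omega>. cross_moments n m (sample_design X g \<omega>) (\<lambda>_. 1) \<partial>M) \<le> real m / real n"
proof -
  have "cross_moments n m (sample_design X g \<omega>) (\<lambda>_. 1) =
      (\<Sum>k\<in>{..<m}. ((\<Sum>i<n. g k (X i \<omega>)) / real n - (\<integral>x. g k x \<partial>P))\<^sup>2)" for \<omega>
    using g_mean by (simp add: cross_moments_def sample_ip_def sample_design_def)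
  with iid_sum_mean_square_error[OF P M iid n, of "{..<m}" g] g_L2 leverage_integral(2)
  show "integrable M (\<lambda>\<omega>. cross_moments n m (sample_design X g \<omega>) (\<lambda>_. 1))"
    "(\<integral>\<omega>. cross_moments n m (sample_design X g \<omega>) (\<lambda>_. 1) \<partial>M) \<le> real m / real n"
    by simp_all
qed

context
  fixes S :: real
  assumes S: "\<And>x. x \<in> space P \<Longrightarrow> (\<Sum>k<m. (g k x)\<^sup>2) \<le> S"
begin

lemma g_bounded: "k < m \<Longrightarrow> x \<in> space P \<Longrightarrow> (g k x)\<^sup>2 \<le> S"
  using S[of x] member_le_sum[of k "{..<m}" "\<lambda>k. (g k x)\<^sup>2"] by auto

lemma dimension_le_leverage_bound: "real m \<le> S"
proof -
  interpret P: prob_space P by (rule P)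
  have "(\<integral>x. (\<Sum>k<m. (g k x)\<^sup>2) \<partial>P) \<le> (\<integral>x. S \<partial>P)"
    by (rule integral_mono[OF leverage_integral(1)]) (use S in auto)
  then show ?thesis by (simp add: leverage_integral(2) P.prob_space)
qed

text \<open>The variances of the \<open>P\<^sub>n(Y g\<^sub>k)\<close> add up to at most \<open>P(Y\<^sup>2 q) / n \<le> S / n\<close>.\<close>

lemma cross_moments_residual:
  "integrable M (\<lambda>\<omega>. cross_moments n m (sample_design X g \<omega>) (\<lambda>i. Y (X i \<omega>)))"
  "(\<integral>\<omega>. cross_moments n m (sample_design X g \<omega>) (\<lambda>i. Y (X i \<omega>)) \<partial>M) \<le> S / real n"
proof -
  have YL2: "L2_fun P Y" and sq: "integrable P (\<lambda>x. (Y x)\<^sup>2)" "(\<integral>x. (Y x)\<^sup>2 \<partial>P) = 1"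
    using Y by (auto simp: standardized_def L2_fun_def)
  have L2: "L2_fun P (\<lambda>x. Y x * g k x)" if "k \<in> {..<m}" for k
    using g_L2[of k] g_bounded[of k] that by (intro L2_fun_mult_bounded[OF YL2]) (auto simp: L2_fun_def)
  have eq: "cross_moments n m (sample_design X g \<omega>) (\<lambda>i. Y (X i \<omega>)) =
      (\<Sum>k\<in>{..<m}. ((\<Sum>i<n. Y (X i \<omega>) * g k (X i \<omega>)) / real n - (\<integral>x. Y x * g k x \<partial>P))\<^sup>2)" for \<omega>
    using Yg by (simp add: cross_moments_def sample_ip_def sample_design_def)
  note mse = iid_sum_mean_square_error[OF P M iid n, of "{..<m}" "\<lambda>k x. Y x * g k x", OF L2]
  show "integrable M (\<lambda>\<omega>. cross_moments n m (sample_design X g \<omega>) (\<lambda>i. Y (X i \<omega>)))"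
    unfolding eq using mse(1) by simp
  have "(\<integral>x. (\<Sum>k<m. (Y x * g k x)\<^sup>2) \<partial>P) \<le> (\<integral>x. S * (Y x)\<^sup>2 \<partial>P)"
  proof (rule integral_mono)
    show "integrable P (\<lambda>x. \<Sum>k<m. (Y x * g k x)\<^sup>2)"
      using L2 by (intro Bochner_Integration.integrable_sum) (simp add: L2_fun_def)
    show "integrable P (\<lambda>x. S * (Y x)\<^sup>2)" using sq by simp
    fix x assume "x \<in> space P"
    then show "(\<Sum>k<m. (Y x * g k x)\<^sup>2) \<le> S * (Y x)\<^sup>2"
      using mult_right_mono[OF S, of x "(Y x)\<^sup>2"]
      by (simp add: power_mult_distrib sum_distrib_left[symmetric] mult.commute)
  qed
  also have "\<dots> = S" using sq by simp
  finally have "(\<integral>x. (\<Sum>k<m. (Y x * g k x)\<^sup>2) \<partial>P) \<le> S" .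
  then have "(\<integral>x. (\<Sum>k<m. (Y x * g k x)\<^sup>2) \<partial>P) / real n \<le> S / real n" by (simp add: divide_right_mono)
  with mse(2) show "(\<integral>\<omega>. cross_moments n m (sample_design X g \<omega>) (\<lambda>i. Y (X i \<omega>)) \<partial>M) \<le> S / real n"
    unfolding eq by simp
qed

text \<open>The variances of the entries \<open>P\<^sub>n(g\<^sub>k g\<^sub>l)\<close> add up to at most \<open>P(q\<^sup>2) / n \<le> S P(q) / n = S m / n\<close>.\<close>

lemma gram_deviation_small:
  "integrable M (\<lambda>\<omega>. gram_deviation n m (sample_design X g \<omega>))"
  "(\<integral>\<omega>. gram_deviation n m (sample_design X g \<omega>) \<partial>M) \<le> real m * S / real n"
proof -
  let ?I = "{..<m} \<times> {..<m}" and ?\<phi> = "\<lambda>(k, l) x. g k x * g l x"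
  have L2: "L2_fun P (?\<phi> p)" if "p \<in> ?I" for p
  proof -
    obtain k l where p: "p = (k, l)" "k < m" "l < m" using \<open>p \<in> ?I\<close> by (cases p) auto
    have "L2_fun P (\<lambda>x. g k x * g l x)"
      using g_L2[OF p(3)] g_bounded[OF p(3)] by (intro L2_fun_mult_bounded[OF g_L2[OF p(2)]]) (auto simp: L2_fun_def)
    then show ?thesis by (simp add: p(1))
  qed
  have eq: "gram_deviation n m (sample_design X g \<omega>) =
      (\<Sum>p\<in>?I. ((\<Sum>i<n. ?\<phi> p (X i \<omega>)) / real n - (\<integral>x. ?\<phi> p x \<partial>P))\<^sup>2)" for \<omega>
    unfolding gram_deviation_def using g
    by (intro sum.cong) (auto simp: sample_ip_def sample_design_def orthonormal_L2_def)
  note mse = iid_sum_mean_square_error[OF P M iid n, of ?I ?\<phi>, OF L2]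
  show "integrable M (\<lambda>\<omega>. gram_deviation n m (sample_design X g \<omega>))" unfolding eq using mse(1) by simp
  have "(\<integral>x. (\<Sum>p\<in>?I. (?\<phi> p x)\<^sup>2) \<partial>P) \<le> (\<integral>x. S * (\<Sum>k<m. (g k x)\<^sup>2) \<partial>P)"
  proof (rule integral_mono)
    show "integrable P (\<lambda>x. \<Sum>p\<in>?I. (?\<phi> p x)\<^sup>2)"
      using L2 by (intro Bochner_Integration.integrable_sum) (simp add: L2_fun_def)
    show "integrable P (\<lambda>x. S * (\<Sum>k<m. (g k x)\<^sup>2))" using leverage_integral(1) by (rule integrable_mult_right)
    fix x assume x: "x \<in> space P"
    have "(\<Sum>p\<in>?I. (?\<phi> p x)\<^sup>2) = (\<Sum>k<m. (g k x)\<^sup>2) * (\<Sum>k<m. (g k x)\<^sup>2)"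
      by (simp add: sum_product sum.cartesian_product case_prod_unfold power_mult_distrib)
    also have "\<dots> \<le> S * (\<Sum>k<m. (g k x)\<^sup>2)"
      by (intro mult_right_mono S[OF x] sum_nonneg) simp
    finally show "(\<Sum>p\<in>?I. (?\<phi> p x)\<^sup>2) \<le> S * (\<Sum>k<m. (g k x)\<^sup>2)" .
  qed
  also have "\<dots> = real m * S" using leverage_integral(2) by simp
  finally have "(\<integral>x. (\<Sum>p\<in>?I. (?\<phi> p x)\<^sup>2) \<partial>P) / real n \<le> real m * S / real n" by (simp add: divide_right_mono)
  with mse(2) show "(\<integral>\<omega>. gram_deviation n m (sample_design X g \<omega>) \<partial>M) \<le> real m * S / real n"
    unfolding eq by simp
qed

end

end

section \<open>The central limit theorem for the least squares estimator\<close>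

text \<open>The residual has mean zero because \<open>f - \<mu>\<close> and the controls have.\<close>

lemma standardized_control_residual:
  fixes m :: nat
  assumes P: "prob_space P" and h: "\<And>j. j < m \<Longrightarrow> L2_fun P (h j)"
    and h0: "\<And>j. j < m \<Longrightarrow> (\<integral>x. h j x \<partial>P) = 0"
    and f: "L2_fun P f" and \<mu>: "\<mu> = (\<integral>x. f x \<partial>P)"
    and dec: "\<And>x. x \<in> space P \<Longrightarrow> f x = \<mu> + (\<Sum>j<m. b j * h j x) + e x"
    and \<sigma>: "\<sigma> = sqrt (\<integral>x. (e x)\<^sup>2 \<partial>P)" "0 < \<sigma>"
  shows "standardized P (\<lambda>x. e x / \<sigma>)"
proof -
  interpret P: prob_space P by fact
  interpret semi_inner_functions "{u. L2_fun P u}" "\<lambda>u v. \<integral>x. u x * v x \<partial>P" by (rule L2_semi_inner)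
  let ?s = "\<lambda>x. \<Sum>j<m. b j * h j x"
  have one: "L2_fun P (\<lambda>_. 1)" by (simp add: L2_fun_def)
  have s: "L2_fun P ?s" using sum_closed[of m h b] h by simp
  have fs: "L2_fun P (\<lambda>x. f x - 1 * ?s x)" using diff_closed[of f ?s 1] f s by simp
  have d: "L2_fun P (\<lambda>x. (f x - 1 * ?s x) - \<mu> * 1)"
    using diff_closed[of "\<lambda>x. f x - 1 * ?s x" "\<lambda>_. 1" \<mu>] fs one by simp
  have eq: "e x = (f x - 1 * ?s x) - \<mu> * 1" if "x \<in> space P" for x using dec[OF that] by simp
  have em: "e \<in> borel_measurable P"
    using d by (subst measurable_cong[OF eq]) (simp_all add: L2_fun_def)
  have ei: "integrable P (\<lambda>x. (e x)\<^sup>2)"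
    using d by (subst Bochner_Integration.integrable_cong[OF refl, where g = "\<lambda>x. ((f x - 1 * ?s x) - \<mu> * 1)\<^sup>2"])
      (simp_all add: eq L2_fun_def)
  have "(\<integral>x. e x \<partial>P) = (\<integral>x. ((f x - 1 * ?s x) - \<mu> * 1) * 1 \<partial>P)"
    by (rule Bochner_Integration.integral_cong) (simp_all add: eq)
  also have "\<dots> = (\<integral>x. f x * 1 \<partial>P) - 1 * (\<integral>x. ?s x * 1 \<partial>P) - \<mu> * (\<integral>x. 1 * 1 \<partial>P)"
    using ip_diff[of "\<lambda>x. f x - 1 * ?s x" "\<lambda>_. 1" "\<lambda>_. 1" \<mu>] ip_diff[of f ?s "\<lambda>_. 1" 1] f s fs one by simp
  also have "(\<integral>x. ?s x * 1 \<partial>P) = 0"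
    using ip_sum[of m h "\<lambda>_. 1" b] h h0 one by simp
  finally have e0: "(\<integral>x. e x \<partial>P) = 0" by (simp add: \<mu> P.prob_space)
  have e2: "(\<integral>x. (e x)\<^sup>2 \<partial>P) = \<sigma>\<^sup>2" unfolding \<sigma>(1) by (simp add: Bochner_Integration.integral_nonneg)
  show ?thesis
    using em ei e0 e2 \<sigma>(2) by (auto simp: standardized_def L2_fun_def power_divide)
qed

theorem theorem2:
  fixes P :: "'s measure"
    and M :: "nat \<Rightarrow> 'w measure"
    and X :: "nat \<Rightarrow> nat \<Rightarrow> 'w \<Rightarrow> 's"
    and m :: "nat \<Rightarrow> nat"
    and h :: "nat \<Rightarrow> nat \<Rightarrow> 's \<Rightarrow> real"
    and f eps :: "nat \<Rightarrow> 's \<Rightarrow> real"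
    and mu sigma :: "nat \<Rightarrow> real"
    and beta :: "nat \<Rightarrow> real Matrix.vec"
  assumes "prob_space P"
    and "\<And>n. n \<ge> 1 \<Longrightarrow> prob_space (M n)"
    and "\<And>n. n \<ge> 1 \<Longrightarrow> iid_sample P (M n) n (X n)"
    and "\<And>n. n \<ge> 1 \<Longrightarrow> m n \<ge> 1"
    and "filterlim m at_top sequentially"
    and "\<And>n j. n \<ge> 1 \<Longrightarrow> j < m n \<Longrightarrow> L2_fun P (h n j)"
    and "\<And>n j. n \<ge> 1 \<Longrightarrow> j < m n \<Longrightarrow> (\<integral>x. h n j x \<partial>P) = 0"
    and "\<And>n. n \<ge> 1 \<Longrightarrow> lin_indep_L2 P (m n) (h n)"
    and "\<And>n. n \<ge> 1 \<Longrightarrow> L2_fun P (f n)"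
    and "\<And>n. n \<ge> 1 \<Longrightarrow> mu n = (\<integral>x. f n x \<partial>P)"
    and "\<And>n. n \<ge> 1 \<Longrightarrow> beta n \<in> carrier_vec (m n)"
    and "\<And>n x. n \<ge> 1 \<Longrightarrow> x \<in> space P \<Longrightarrow>
           f n x = mu n + scalar_prod (beta n) (control_vec (m n) (h n) x) + eps n x"
    and "\<And>n j. n \<ge> 1 \<Longrightarrow> j < m n \<Longrightarrow> (\<integral>x. eps n x * h n j x \<partial>P) = 0"
    and "\<And>n. n \<ge> 1 \<Longrightarrow> sigma n = sqrt (\<integral>x. (eps n x)\<^sup>2 \<partial>P)"
    and "\<And>n. n \<ge> 1 \<Longrightarrow> sigma n > 0"
    and L_finite: "\<forall>\<^sub>F n in sequentially. bdd_above (leverage P (m n) (h n) ` space P)"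
    and L: "(\<lambda>n. SUP x\<in>space P. leverage P (m n) (h n) x) \<in> o(\<lambda>n. real n / real (m n))"
  defines "lindeberg \<equiv> (\<forall>\<delta>>0.
      (\<lambda>n. \<integral>x. (eps n x / sigma n)\<^sup>2 * indicat_real {x. \<bar>eps n x / sigma n\<bar> > \<delta> * sqrt (real n)} x \<partial>P)
        \<in> o(\<lambda>_. 1))"
    and "mu_hat \<equiv> (\<lambda>n \<omega>. ols_estimator (f n) (m n) (h n) n (\<lambda>i. X n i \<omega>))"
    and "sigma2_hat \<equiv> (\<lambda>n \<omega>. ols_variance (f n) (m n) (h n) n (\<lambda>i. X n i \<omega>))"
  shows "(lindeberg \<longleftrightarrow>
        weak_conv_m
          (\<lambda>n. distr (M n) borel (\<lambda>\<omega>. sqrt (real n) / sigma n * (mu_hat n \<omega> - mu n)))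
          std_normal_distribution)
    \<and> (lindeberg \<longrightarrow>
        weak_conv_m
          (\<lambda>n. distr (M n) borel (\<lambda>\<omega>. sigma2_hat n \<omega> / (sigma n)\<^sup>2))
          (return borel 1)
      \<and> weak_conv_m
          (\<lambda>n. distr (M n) borel
            (\<lambda>\<omega>. sqrt (real n) / sqrt (sigma2_hat n \<omega>) * (mu_hat n \<omega> - mu n)))
          std_normal_distribution)"
proof -
  interpret prob_array M by (rule prob_array.intro) (rule assms(2))
  note P = assms(1) and Mn = assms(2) and iid = assms(3) and h = assms(6) and \<sigma> = assms(15)
  define Y where "Y n = (\<lambda>x. eps n x / sigma n)" for n
  define b where "b n j = vec_index (beta n) j" for n j
  have dec: "f n x = mu n + (\<Sum>j<m n. b n j * h n j x) + eps n x" if "1 \<le> n" "x \<in> space P" for n x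
    using assms(12)[OF that] assms(11)[OF that(1)]
    by (simp add: scalar_prod_def control_vec_def b_def atLeast0LessThan)
  have Y: "standardized P (Y n)" if "1 \<le> n" for n
    unfolding Y_def using assms(6,7,9,10,14,15) dec that
    by (intro standardized_control_residual[OF P, where m = "m n" and h = "h n" and f = "f n" and \<mu> = "mu n" and b = "b n"]) auto

  define basis where "basis n g \<longleftrightarrow> orthonormal_L2 P (m n) g \<and>
      (\<exists>A. \<forall>k<m n. \<forall>x. g k x = (\<Sum>j<m n. A k j * h n j x)) \<and>
      (\<exists>B. \<forall>j<m n. \<forall>x. h n j x = (\<Sum>k<m n. B j k * g k x)) \<and>
      (\<forall>x. leverage P (m n) (h n) x = (\<Sum>k<m n. (g k x)\<^sup>2))" for n g
  have "\<exists>g. 1 \<le> n \<longrightarrow> basis n g" for n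
  proof (cases "1 \<le> n")
    case True
    show ?thesis
    proof (rule control_orthonormal_basis[of "m n" P "h n"])
      fix g A B
      assume "orthonormal_L2 P (m n) g" "\<And>k x. k < m n \<Longrightarrow> g k x = (\<Sum>j<m n. A k j * h n j x)"
        "\<And>j x. j < m n \<Longrightarrow> h n j x = (\<Sum>k<m n. B j k * g k x)"
        "\<And>x. leverage P (m n) (h n) x = (\<Sum>k<m n. (g k x)\<^sup>2)"
      then show "\<exists>g. 1 \<le> n \<longrightarrow> basis n g" unfolding basis_def by blast
    qed (fact h[OF True], fact assms(8)[OF True])
  qed simp
  then obtain g where g: "\<And>n. 1 \<le> n \<Longrightarrow> basis n (g n)" by metis

  have g_orth: "orthonormal_L2 P (m n) (g n)"
    and g_comb: "\<exists>A. \<forall>k<m n. \<forall>x. g n k x = (\<Sum>j<m n. A k j * h n j x)"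
    and h_comb: "\<exists>B. \<forall>j<m n. \<forall>x. h n j x = (\<Sum>k<m n. B j k * g n k x)"
    and g_lev: "leverage P (m n) (h n) x = (\<Sum>k<m n. (g n k x)\<^sup>2)" if "1 \<le> n" for n x
    using g[OF that] unfolding basis_def by blast+
  have cs: "control_sample P (M n) (X n) n (m n) (g n) (Y n)" if n: "1 \<le> n" for n
  proof (rule control_sample.intro)
    interpret semi_inner_functions "{u. L2_fun P u}" "\<lambda>u v. \<integral>x. u x * v x \<partial>P" by (rule L2_semi_inner)
    interpret PP: prob_space P by (rule P)
    obtain A where "\<And>k x. k < m n \<Longrightarrow> g n k x = (\<Sum>j<m n. A k j * h n j x)"
      using g_comb[OF n] by blast
    then have A: "g n k = (\<lambda>x. \<Sum>j<m n. A k j * h n j x)" if "k < m n" for k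
      using that by blast
    have ip: "(\<integral>x. g n k x * u x \<partial>P) = (\<Sum>j<m n. A k j * (\<integral>x. h n j x * u x \<partial>P))" if "L2_fun P u" "k < m n" for u k
      using ip_sum[of "m n" "h n" u "A k"] h[OF n] that A[OF that(2)] by simp
    show "orthonormal_L2 P (m n) (g n)" by (rule g_orth[OF n])
    show "(\<integral>x. g n k x \<partial>P) = 0" if "k < m n" for k
      using ip[of "\<lambda>_. 1" k] that assms(7)[OF n] by (simp add: L2_fun_def)
    show "(\<integral>x. Y n x * g n k x \<partial>P) = 0" if "k < m n" for k
    proof -
      have "(\<integral>x. h n j x * Y n x \<partial>P) = 0" if "j < m n" for j
        using assms(13)[OF n that] by (simp add: Y_def mult.commute)
      with ip[of "Y n" k] that Y[OF n] show ?thesis by (simp add: standardized_def mult.commute)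
    qed
      show "0 < n" using n by simp
  qed (fact P, fact Mn[OF n], fact iid[OF n], fact Y[OF n])

  define D where "D n \<omega> = gram_deviation n (m n) (sample_design (X n) (g n) \<omega>)" for n \<omega>
  define a where "a n \<omega> = cross_moments n (m n) (sample_design (X n) (g n) \<omega>) (\<lambda>_. 1)" for n \<omega>
  define c where "c n \<omega> = cross_moments n (m n) (sample_design (X n) (g n) \<omega>) (\<lambda>i. Y n (X n i \<omega>))" for n \<omega>
  define T where "T n \<omega> = (\<Sum>i<n. Y n (X n i \<omega>)) / sqrt (real n)" for n \<omega>
  define V where "V n \<omega> = (\<Sum>i<n. (Y n (X n i \<omega>))\<^sup>2) / real n - 1" for n \<omega>
  define T' where "T' n \<omega> = sqrt (real n) / sigma n * (mu_hat n \<omega> - mu n)" for n \<omega>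
  define s where "s n \<omega> = sigma2_hat n \<omega> / (sigma n)\<^sup>2" for n \<omega>
  define S where "S n = (SUP x\<in>space P. leverage P (m n) (h n) x)" for n
  define \<kappa> where "\<kappa> n = real (m n) * S n / real n" for n

  have nonneg: "0 \<le> D n \<omega>" "0 \<le> a n \<omega>" "0 \<le> c n \<omega>" for n \<omega>
    by (simp_all add: D_def a_def c_def gram_deviation_nonneg cross_moments_nonneg)

  have meas: "D n \<in> borel_measurable (M n)" "a n \<in> borel_measurable (M n)" "c n \<in> borel_measurable (M n)"
      "T n \<in> borel_measurable (M n)" "V n \<in> borel_measurable (M n)" "T' n \<in> borel_measurable (M n)"
      "s n \<in> borel_measurable (M n)" if n1: "1 \<le> n" for n
  proof -
    interpret control_sample P "M n" "X n" n "m n" "g n" "Y n" by (rule cs[OF n1])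
    have [measurable]: "mu_hat n \<in> borel_measurable (M n)" "sigma2_hat n \<in> borel_measurable (M n)"
      unfolding mu_hat_def sigma2_hat_def
      using ols_measurable[of "f n" P "m n" "h n" n "X n" "M n"] assms(9)[OF n1] h[OF n1]
        iid_sample_facts(1)[OF control_sample.M[OF cs[OF n1]] control_sample.iid[OF cs[OF n1]]] by (auto simp: L2_fun_def)
    note Y_measurable [measurable]
    show "D n \<in> borel_measurable (M n)" unfolding D_def by (rule gram_deviation_measurable)
    show "a n \<in> borel_measurable (M n)" unfolding a_def by (rule cross_moments_measurable) simp
    show "c n \<in> borel_measurable (M n)" unfolding c_def by (rule cross_moments_measurable) (rule Y_measurable)
    show "T n \<in> borel_measurable (M n)" unfolding T_def by (intro borel_measurable_divide borel_measurable_sum) auto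
    show "V n \<in> borel_measurable (M n)" unfolding V_def
      by (intro borel_measurable_diff borel_measurable_divide borel_measurable_sum borel_measurable_power) auto
    show "T' n \<in> borel_measurable (M n)" unfolding T'_def by measurable
    show "s n \<in> borel_measurable (M n)" unfolding s_def by measurable
  qed

  have \<kappa>0: "\<kappa> \<longlonglongrightarrow> 0"
    using smalloD_tendsto[OF L] by (simp add: \<kappa>_def[abs_def] S_def mult.commute)
  have bounds: "\<forall>\<^sub>F n in sequentially. 1 \<le> n \<and> (\<forall>x\<in>space P. (\<Sum>k<m n. (g n k x)\<^sup>2) \<le> S n)"
    using L_finite eventually_ge_at_top[of "1::nat"]
  proof eventually_elim
    case (elim n)
    have "leverage P (m n) (h n) x \<le> S n" if "x \<in> space P" for x
      unfolding S_def using that elim(1) by (rule cSUP_upper)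
    then show ?case using g_lev[of n] elim(2) by simp
  qed
  have L1: "\<forall>\<^sub>F n in sequentially. integrable (M n) (D n) \<and> (\<integral>\<omega>. \<bar>D n \<omega>\<bar> \<partial>M n) \<le> \<kappa> n"
    "\<forall>\<^sub>F n in sequentially. integrable (M n) (a n) \<and> (\<integral>\<omega>. \<bar>a n \<omega>\<bar> \<partial>M n) \<le> \<kappa> n"
    "\<forall>\<^sub>F n in sequentially. integrable (M n) (\<lambda>\<omega>. real (m n) * c n \<omega>) \<and>
      (\<integral>\<omega>. \<bar>real (m n) * c n \<omega>\<bar> \<partial>M n) \<le> \<kappa> n"
  proof -
    have main: "integrable (M n) (D n) \<and> (\<integral>\<omega>. \<bar>D n \<omega>\<bar> \<partial>M n) \<le> \<kappa> n"
      "integrable (M n) (a n) \<and> (\<integral>\<omega>. \<bar>a n \<omega>\<bar> \<partial>M n) \<le> \<kappa> n"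
      "integrable (M n) (\<lambda>\<omega>. real (m n) * c n \<omega>) \<and> (\<integral>\<omega>. \<bar>real (m n) * c n \<omega>\<bar> \<partial>M n) \<le> \<kappa> n"
      if n1: "1 \<le> n \<and> (\<forall>x\<in>space P. (\<Sum>k<m n. (g n k x)\<^sup>2) \<le> S n)" for n
    proof -
      interpret control_sample P "M n" "X n" n "m n" "g n" "Y n" using n1 by (intro cs) simp
      have Sb: "\<And>x. x \<in> space P \<Longrightarrow> (\<Sum>k<m n. (g n k x)\<^sup>2) \<le> S n" using n1 by simp
      note D_small = gram_deviation_small[OF Sb] and c_small = cross_moments_residual[OF Sb]
      \<comment> \<open>The mean leverage \<open>m\<close> is at least \<open>1\<close> and at most the supremum \<open>S\<close>; hence \<open>m / n \<le> m S / n = \<kappa>\<close>.\<close>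
      have "real (m n) \<le> S n" by (rule dimension_le_leverage_bound[OF Sb])
      moreover have "1 \<le> real (m n)" using assms(4) n1 by simp
      ultimately have "real (m n) * 1 \<le> real (m n) * S n" by (intro mult_left_mono) auto
      then have m\<kappa>: "real (m n) / real n \<le> \<kappa> n" unfolding \<kappa>_def by (intro divide_right_mono) auto
      show "integrable (M n) (D n) \<and> (\<integral>\<omega>. \<bar>D n \<omega>\<bar> \<partial>M n) \<le> \<kappa> n"
        using D_small by (simp add: D_def[abs_def] \<kappa>_def gram_deviation_nonneg)
      show "integrable (M n) (a n) \<and> (\<integral>\<omega>. \<bar>a n \<omega>\<bar> \<partial>M n) \<le> \<kappa> n"
        using cross_moments_one m\<kappa> by (simp add: a_def[abs_def] cross_moments_nonneg)
      have "real (m n) * (\<integral>\<omega>. c n \<omega> \<partial>M n) \<le> real (m n) * (S n / real n)"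
        using c_small(2) unfolding c_def by (intro mult_left_mono) auto
      then show "integrable (M n) (\<lambda>\<omega>. real (m n) * c n \<omega>) \<and> (\<integral>\<omega>. \<bar>real (m n) * c n \<omega>\<bar> \<partial>M n) \<le> \<kappa> n"
        using c_small(1) nonneg(3)[of n] by (simp add: c_def[abs_def] \<kappa>_def abs_mult)
    qed
    show "\<forall>\<^sub>F n in sequentially. integrable (M n) (D n) \<and> (\<integral>\<omega>. \<bar>D n \<omega>\<bar> \<partial>M n) \<le> \<kappa> n"
      by (rule eventually_mono[OF bounds main(1)])
    show "\<forall>\<^sub>F n in sequentially. integrable (M n) (a n) \<and> (\<integral>\<omega>. \<bar>a n \<omega>\<bar> \<partial>M n) \<le> \<kappa> n"
      by (rule eventually_mono[OF bounds main(2)])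
    show "\<forall>\<^sub>F n in sequentially. integrable (M n) (\<lambda>\<omega>. real (m n) * c n \<omega>) \<and>
      (\<integral>\<omega>. \<bar>real (m n) * c n \<omega>\<bar> \<partial>M n) \<le> \<kappa> n"
      by (rule eventually_mono[OF bounds main(3)])
  qed
  note nD = null_in_prob_L1[OF L1(1) \<kappa>0] and na = null_in_prob_L1[OF L1(2) \<kappa>0]
  note nmc = null_in_prob_L1[OF L1(3) \<kappa>0]
  have mc_meas: "(\<lambda>\<omega>. real (m n) * c n \<omega>) \<in> borel_measurable (M n)" if "1 \<le> n" for n
    using meas(3)[OF that] by (intro borel_measurable_times) auto
  \<comment> \<open>The product \<open>n a c\<close> is split as \<open>(n a / m) (m c)\<close>: a factor bounded in mean times a null one.\<close>
  have nsqrt: "null_in_prob M (\<lambda>n \<omega>. sqrt (real (m n) * c n \<omega>))"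
  proof (rule null_in_prob_dominated[where F = "{\<lambda>n \<omega>. real (m n) * c n \<omega>}"])
    fix e :: real assume e: "0 < e"
    have "\<bar>sqrt (real (m n) * c n \<omega>)\<bar> \<le> e" if "\<bar>real (m n) * c n \<omega>\<bar> \<le> e\<^sup>2" for n \<omega>
      using that e nonneg(3)[of n \<omega>] by (simp add: real_le_lsqrt)
    then show "\<exists>d>0. \<forall>n\<ge>1. \<forall>\<omega>\<in>space (M n). (\<forall>W\<in>{\<lambda>n \<omega>. real (m n) * c n \<omega>}. \<bar>W n \<omega>\<bar> \<le> d) \<longrightarrow>
        \<bar>sqrt (real (m n) * c n \<omega>)\<bar> \<le> e"
      using e by (intro exI[of _ "e\<^sup>2"]) simp
  qed (use nmc mc_meas in auto)
  have nc: "null_in_prob M c"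
  proof (rule null_in_prob_dominated[where F = "{\<lambda>n \<omega>. real (m n) * c n \<omega>}"])
    fix e :: real assume e: "0 < e"
    have "\<bar>c n \<omega>\<bar> \<le> e" if "1 \<le> n" "\<bar>real (m n) * c n \<omega>\<bar> \<le> e" for n \<omega>
    proof -
      have "1 * c n \<omega> \<le> real (m n) * c n \<omega>"
        using assms(4)[OF that(1)] nonneg(3) by (intro mult_right_mono) auto
      then show ?thesis using that nonneg(3)[of n \<omega>] by simp
    qed
    then show "\<exists>d>0. \<forall>n\<ge>1. \<forall>\<omega>\<in>space (M n). (\<forall>W\<in>{\<lambda>n \<omega>. real (m n) * c n \<omega>}. \<bar>W n \<omega>\<bar> \<le> d) \<longrightarrow> \<bar>c n \<omega>\<bar> \<le> e"
      using e by (intro exI[of _ e]) auto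
  qed (use nmc mc_meas in auto)
  have na2: "(\<lambda>\<omega>. sqrt (real n * a n \<omega> / real (m n))) \<in> borel_measurable (M n) \<and>
      integrable (M n) (\<lambda>\<omega>. (sqrt (real n * a n \<omega> / real (m n)))\<^sup>2) \<and>
      (\<integral>\<omega>. (sqrt (real n * a n \<omega> / real (m n)))\<^sup>2 \<partial>M n) \<le> 1" if n1: "1 \<le> n" for n
  proof -
    interpret control_sample P "M n" "X n" n "m n" "g n" "Y n" by (rule cs[OF n1])
    have [measurable]: "a n \<in> borel_measurable (M n)" by (rule meas(2)[OF n1])
    have sq: "(sqrt (real n * a n \<omega> / real (m n)))\<^sup>2 = real n / real (m n) * a n \<omega>" for \<omega>
      using nonneg(2)[of n \<omega>] by simp
    have "real n / real (m n) * (\<integral>\<omega>. a n \<omega> \<partial>M n) \<le> real n / real (m n) * (real (m n) / real n)"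
      using cross_moments_one(2) unfolding a_def by (intro mult_left_mono) auto
    also have "\<dots> = 1" using n1 assms(4)[OF n1] by simp
    finally show ?thesis
      unfolding sq using cross_moments_one(1) by (simp add: a_def[abs_def])
  qed
  have nac: "null_in_prob M (\<lambda>n \<omega>. sqrt (real n * a n \<omega> * c n \<omega>))"
  proof (rule null_in_prob_dominated[where F = "{\<lambda>n \<omega>. sqrt (real n * a n \<omega> / real (m n)) * sqrt (real (m n) * c n \<omega>)}"])
    have "null_in_prob M (\<lambda>n \<omega>. sqrt (real n * a n \<omega> / real (m n)) * sqrt (real (m n) * c n \<omega>))"
      by (rule null_in_prob_mult_L2_bounded[OF na2 nsqrt]) (use mc_meas in auto)
    then show "\<And>W. W \<in> {\<lambda>n \<omega>. sqrt (real n * a n \<omega> / real (m n)) * sqrt (real (m n) * c n \<omega>)} \<Longrightarrow> null_in_prob M W"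
      by simp
    fix e :: real assume e: "0 < e"
    have "sqrt (real n * a n \<omega> * c n \<omega>) = sqrt (real n * a n \<omega> / real (m n)) * sqrt (real (m n) * c n \<omega>)"
      if "1 \<le> n" for n \<omega>
      using assms(4)[OF that] by (simp add: real_sqrt_mult[symmetric])
    then show "\<exists>d>0. \<forall>n\<ge>1. \<forall>\<omega>\<in>space (M n).
        (\<forall>W\<in>{\<lambda>n \<omega>. sqrt (real n * a n \<omega> / real (m n)) * sqrt (real (m n) * c n \<omega>)}. \<bar>W n \<omega>\<bar> \<le> d) \<longrightarrow>
        \<bar>sqrt (real n * a n \<omega> * c n \<omega>)\<bar> \<le> e"
      using e by (intro exI[of _ e]) auto
  qed (use na2 mc_meas in \<open>auto intro!: borel_measurable_times\<close>)
  have ac_meas: "(\<lambda>\<omega>. sqrt (real n * a n \<omega> * c n \<omega>)) \<in> borel_measurable (M n)" if "1 \<le> n" for n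
    using meas(2,3)[OF that] by measurable

  have TL2: "T n \<in> borel_measurable (M n) \<and> integrable (M n) (\<lambda>\<omega>. (T n \<omega>)\<^sup>2) \<and> (\<integral>\<omega>. (T n \<omega>)\<^sup>2 \<partial>M n) \<le> 1"
    if n: "1 \<le> n" for n
  proof -
    have n0: "0 < n" using n by simp
    have YL2: "L2_fun P (Y n)" and EY: "(\<integral>x. Y n x \<partial>P) = 0" "(\<integral>x. (Y n x)\<^sup>2 \<partial>P) = 1"
      using Y[OF n] by (auto simp: standardized_def)
    note mse = iid_mean_square_error[OF P Mn[OF n] iid[OF n] n0 YL2, unfolded EY]
    have eq: "(T n \<omega>)\<^sup>2 = real n * ((\<Sum>i<n. Y n (X n i \<omega>)) / real n - 0)\<^sup>2" for \<omega>
      using n by (simp add: T_def power_divide power2_eq_square)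
    have "real n * (\<integral>\<omega>. ((\<Sum>i<n. Y n (X n i \<omega>)) / real n - 0)\<^sup>2 \<partial>M n) \<le> real n * (1 / real n)"
      using mse(2) by (intro mult_left_mono) auto
    then show ?thesis
      unfolding eq using meas(4)[OF n] integrable_mult_right[OF mse(1), of "real n"] n by simp
  qed
  have nTa: "null_in_prob M (\<lambda>n \<omega>. T n \<omega> * a n \<omega>)"
    by (rule null_in_prob_mult_L2_bounded[OF TL2 na]) (auto intro: meas)
  have Ta_meas: "(\<lambda>\<omega>. T n \<omega> * a n \<omega>) \<in> borel_measurable (M n)" if "1 \<le> n" for n
    using meas(2,4)[OF that] by (rule borel_measurable_times[rotated])

  \<comment> \<open>On the event \<open>D, a \<le> 1/4\<close>, whose probability tends to \<open>1\<close>, both estimators are linearised.\<close>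
  have lin: "\<bar>T' n \<omega> - T n \<omega>\<bar> \<le> 4 * (\<bar>T n \<omega> * a n \<omega>\<bar> + sqrt (real n * a n \<omega> * c n \<omega>)) \<and>
      \<bar>s n \<omega> - 1\<bar> \<le> \<bar>V n \<omega>\<bar> + 6 * c n \<omega> + 4 * ((T n \<omega>)\<^sup>2 / real n)"
    if n: "1 \<le> n" and \<omega>: "\<omega> \<in> space (M n)" and small: "D n \<omega> \<le> 1 / 4" "a n \<omega> \<le> 1 / 4" for n \<omega>
  proof -
    obtain B where B: "\<And>j x. j < m n \<Longrightarrow> h n j x = (\<Sum>k<m n. B j k * g n k x)"
      using h_comb[OF n] by blast
    have sp: "X n i \<omega> \<in> space P" if "i < n" for i
      using measurable_space[OF iid_sample_facts(1)[OF Mn[OF n] iid[OF n] that] \<omega>] .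
    note R = ols_linearization[where f = "f n" and x = "\<lambda>i. X n i \<omega>" and \<mu> = "mu n" and b = "b n" and h = "h n"
        and E = "\<lambda>i. eps n (X n i \<omega>)" and n = n and m = "m n" and \<sigma> = "sigma n" and B = B
        and G = "sample_design (X n) (g n) \<omega>"]
    show ?thesis
      unfolding T'_def s_def T_def V_def a_def c_def Y_def mu_hat_def sigma2_hat_def
      using small n dec[OF n sp] \<sigma>[OF n] B
      by (intro conjI R) (auto simp: D_def a_def sample_design_def)
  qed

  have \<Delta>: "null_in_prob M (\<lambda>n \<omega>. T' n \<omega> - T n \<omega>)"
  proof (rule null_in_prob_dominated[where F = "{D, a, \<lambda>n \<omega>. T n \<omega> * a n \<omega>, \<lambda>n \<omega>. sqrt (real n * a n \<omega> * c n \<omega>)}"])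
    fix e :: real assume e: "0 < e"
    have "\<bar>T' n \<omega> - T n \<omega>\<bar> \<le> e" if n: "1 \<le> n" and \<omega>: "\<omega> \<in> space (M n)"
      and D: "\<bar>D n \<omega>\<bar> \<le> min (1 / 4) (e / 8)" and a: "\<bar>a n \<omega>\<bar> \<le> min (1 / 4) (e / 8)"
      and q: "\<bar>T n \<omega> * a n \<omega>\<bar> \<le> min (1 / 4) (e / 8)" "\<bar>sqrt (real n * a n \<omega> * c n \<omega>)\<bar> \<le> min (1 / 4) (e / 8)" for n \<omega>
    proof -
      have small: "D n \<omega> \<le> 1 / 4" "a n \<omega> \<le> 1 / 4" using D a nonneg(1,2)[of n \<omega>] by (simp_all only: min.bounded_iff abs_of_nonneg)
      have "\<bar>T' n \<omega> - T n \<omega>\<bar> \<le> 4 * (\<bar>T n \<omega> * a n \<omega>\<bar> + sqrt (real n * a n \<omega> * c n \<omega>))"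
        using lin[OF n \<omega> small] by (rule conjunct1)
      also have "\<dots> \<le> 4 * (e / 8 + e / 8)" by (intro mult_left_mono add_mono) (use q in auto)
      finally show ?thesis by simp
    qed
    then show "\<exists>d>0. \<forall>n\<ge>1. \<forall>\<omega>\<in>space (M n).
        (\<forall>W\<in>{D, a, \<lambda>n \<omega>. T n \<omega> * a n \<omega>, \<lambda>n \<omega>. sqrt (real n * a n \<omega> * c n \<omega>)}. \<bar>W n \<omega>\<bar> \<le> d) \<longrightarrow> \<bar>T' n \<omega> - T n \<omega>\<bar> \<le> e"
      using e by (intro exI[of _ "min (1 / 4) (e / 8)"]) simp
  qed (use nD na nTa nac meas Ta_meas ac_meas in auto)

  have T'_iff_T: "weak_conv_m (\<lambda>n. distr (M n) borel (T' n)) std_normal_distribution \<longleftrightarrow>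
      weak_conv_m (\<lambda>n. distr (M n) borel (T n)) std_normal_distribution"
    by (rule weak_conv_slutsky[OF meas(6) meas(4) \<Delta> real_dist_normal_dist])
  have lind_iff: "lindeberg \<longleftrightarrow> (\<forall>\<delta>>0. (\<lambda>n. tail_moment P (Y n) (\<delta> * sqrt (real n))) \<longlonglongrightarrow> 0)"
    unfolding lindeberg_def tail_moment_def Y_def
    by (auto dest!: smalloD_tendsto intro!: smalloI_tendsto)
  have T_iff: "weak_conv_m (\<lambda>n. distr (M n) borel (T n)) std_normal_distribution \<longleftrightarrow> lindeberg"
    unfolding lind_iff T_def by (rule lindeberg_feller_iid_rows[OF P Mn iid Y])

  have part2: "weak_conv_m (\<lambda>n. distr (M n) borel (s n)) (return borel 1) \<and>
      weak_conv_m (\<lambda>n. distr (M n) borel (\<lambda>\<omega>. sqrt (real n) / sqrt (sigma2_hat n \<omega>) * (mu_hat n \<omega> - mu n)))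
        std_normal_distribution"
    if lind: lindeberg
  proof -
    have nV: "null_in_prob M V"
      unfolding V_def by (rule mean_of_squares_consistent[OF P Mn iid Y]) (use lind lind_iff in auto)
    have nT2: "null_in_prob M (\<lambda>n \<omega>. (T n \<omega>)\<^sup>2 / real n)"
    proof (rule null_in_prob_L1)
      show "\<forall>\<^sub>F n in sequentially. integrable (M n) (\<lambda>\<omega>. (T n \<omega>)\<^sup>2 / real n) \<and>
          (\<integral>\<omega>. \<bar>(T n \<omega>)\<^sup>2 / real n\<bar> \<partial>M n) \<le> 1 / real n"
        by (rule eventually_ge_1) (use TL2 in \<open>simp add: divide_right_mono\<close>)
    qed (rule lim_const_over_n)
    have T2_meas: "(\<lambda>\<omega>. (T n \<omega>)\<^sup>2 / real n) \<in> borel_measurable (M n)" if "1 \<le> n" for n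
      using meas(4)[OF that] by measurable
    have ns: "null_in_prob M (\<lambda>n \<omega>. s n \<omega> - 1)"
    proof (rule null_in_prob_dominated[where F = "{D, a, c, V, \<lambda>n \<omega>. (T n \<omega>)\<^sup>2 / real n}"])
      fix e :: real assume e: "0 < e"
      have "\<bar>s n \<omega> - 1\<bar> \<le> e" if n: "1 \<le> n" and \<omega>: "\<omega> \<in> space (M n)"
        and D: "\<bar>D n \<omega>\<bar> \<le> min (1 / 4) (e / 11)" and a: "\<bar>a n \<omega>\<bar> \<le> min (1 / 4) (e / 11)"
        and q: "\<bar>c n \<omega>\<bar> \<le> min (1 / 4) (e / 11)" "\<bar>V n \<omega>\<bar> \<le> min (1 / 4) (e / 11)"
          "\<bar>(T n \<omega>)\<^sup>2 / real n\<bar> \<le> min (1 / 4) (e / 11)" for n \<omega>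
      proof -
        have small: "D n \<omega> \<le> 1 / 4" "a n \<omega> \<le> 1 / 4" using D a nonneg(1,2)[of n \<omega>] by (simp_all only: min.bounded_iff abs_of_nonneg)
        have "\<bar>s n \<omega> - 1\<bar> \<le> \<bar>V n \<omega>\<bar> + 6 * c n \<omega> + 4 * ((T n \<omega>)\<^sup>2 / real n)"
          using lin[OF n \<omega> small] by (rule conjunct2)
        also have "\<dots> \<le> e / 11 + 6 * (e / 11) + 4 * (e / 11)"
          by (intro mult_left_mono add_mono) (use q in auto)
        finally show ?thesis by simp
      qed
      then show "\<exists>d>0. \<forall>n\<ge>1. \<forall>\<omega>\<in>space (M n).
          (\<forall>W\<in>{D, a, c, V, \<lambda>n \<omega>. (T n \<omega>)\<^sup>2 / real n}. \<bar>W n \<omega>\<bar> \<le> d) \<longrightarrow> \<bar>s n \<omega> - 1\<bar> \<le> e"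
        using e by (intro exI[of _ "min (1 / 4) (e / 11)"]) simp
    qed (use nD na nc nV nT2 meas T2_meas in auto)
    have s1_meas: "(\<lambda>\<omega>. s n \<omega> - 1) \<in> borel_measurable (M n)" if "1 \<le> n" for n
      using meas(7)[OF that] by measurable
    \<comment> \<open>The studentised error is \<open>T' / \<surd>s\<close>; its distance to \<open>T'\<close> is \<open>T' \<rho>\<close>, split as \<open>T \<rho> + (T' - T) \<rho>\<close>.\<close>
    define \<rho> where "\<rho> n \<omega> = 1 / sqrt (s n \<omega>) - 1" for n \<omega>
    have \<rho>_meas: "\<rho> n \<in> borel_measurable (M n)" if "1 \<le> n" for n
      unfolding \<rho>_def using meas(7)[OF that] by measurable
    have n\<rho>: "null_in_prob M \<rho>"
    proof (rule null_in_prob_dominated[where F = "{\<lambda>n \<omega>. s n \<omega> - 1}"])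
      fix e :: real assume e: "0 < e"
      have "isCont (\<lambda>u::real. 1 / sqrt u) 1" by (intro continuous_intros) auto
      from this[unfolded continuous_at_eps_delta, rule_format, OF e]
      obtain d where d: "0 < d" "\<And>u. \<bar>u - 1\<bar> < d \<Longrightarrow> \<bar>1 / sqrt u - 1\<bar> < e"
        by (auto simp: dist_real_def)
      have "\<bar>\<rho> n \<omega>\<bar> \<le> e" if "\<bar>s n \<omega> - 1\<bar> \<le> d / 2" for n \<omega>
        using d(2)[of "s n \<omega>"] that d(1) by (simp add: \<rho>_def)
      then show "\<exists>d>0. \<forall>n\<ge>1. \<forall>\<omega>\<in>space (M n). (\<forall>W\<in>{\<lambda>n \<omega>. s n \<omega> - 1}. \<bar>W n \<omega>\<bar> \<le> d) \<longrightarrow> \<bar>\<rho> n \<omega>\<bar> \<le> e"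
        using d(1) by (intro exI[of _ "d / 2"]) simp
    qed (use ns s1_meas in auto)
    define Z where "Z n \<omega> = sqrt (real n) / sqrt (sigma2_hat n \<omega>) * (mu_hat n \<omega> - mu n)" for n \<omega>
    have Z: "Z n \<omega> = T' n \<omega> * (1 + \<rho> n \<omega>)" if "1 \<le> n" for n \<omega>
      using \<sigma>[OF that] by (simp add: Z_def T'_def \<rho>_def s_def real_sqrt_divide)
    have Z_meas: "Z n \<in> borel_measurable (M n)" if "1 \<le> n" for n
    proof -
      have "Z n = (\<lambda>\<omega>. T' n \<omega> * (1 + \<rho> n \<omega>))" using Z[OF that] by auto
      then show ?thesis using meas(6)[OF that] \<rho>_meas[OF that] by simp
    qed
    have nT\<rho>: "null_in_prob M (\<lambda>n \<omega>. T n \<omega> * \<rho> n \<omega>)"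
      by (rule null_in_prob_mult_L2_bounded[OF TL2 n\<rho>]) (auto intro: \<rho>_meas)
    have T\<rho>_meas: "(\<lambda>\<omega>. T n \<omega> * \<rho> n \<omega>) \<in> borel_measurable (M n)" if "1 \<le> n" for n
      using meas(4)[OF that] \<rho>_meas[OF that] by measurable
    have \<Delta>_meas: "(\<lambda>\<omega>. T' n \<omega> - T n \<omega>) \<in> borel_measurable (M n)" if "1 \<le> n" for n
      using meas(4,6)[OF that] by measurable
    have nZ: "null_in_prob M (\<lambda>n \<omega>. Z n \<omega> - T' n \<omega>)"
    proof (rule null_in_prob_dominated[where F = "{\<lambda>n \<omega>. T n \<omega> * \<rho> n \<omega>, \<lambda>n \<omega>. T' n \<omega> - T n \<omega>, \<rho>}"])
      fix e :: real assume e: "0 < e"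
      have "\<bar>Z n \<omega> - T' n \<omega>\<bar> \<le> e" if n: "1 \<le> n"
        and q: "\<bar>T n \<omega> * \<rho> n \<omega>\<bar> \<le> min 1 (e / 2)" "\<bar>T' n \<omega> - T n \<omega>\<bar> \<le> min 1 (e / 2)" "\<bar>\<rho> n \<omega>\<bar> \<le> min 1 (e / 2)" for n \<omega>
      proof -
        have "Z n \<omega> - T' n \<omega> = T n \<omega> * \<rho> n \<omega> + (T' n \<omega> - T n \<omega>) * \<rho> n \<omega>"
          using Z[OF n] by (simp add: algebra_simps)
        then have "\<bar>Z n \<omega> - T' n \<omega>\<bar> \<le> \<bar>T n \<omega> * \<rho> n \<omega>\<bar> + \<bar>T' n \<omega> - T n \<omega>\<bar> * \<bar>\<rho> n \<omega>\<bar>"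
          by (simp only: abs_mult[symmetric] abs_triangle_ineq)
        also have "\<dots> \<le> e / 2 + e / 2 * 1"
          by (intro add_mono mult_mono) (use q e in auto)
        finally show ?thesis by simp
      qed
      then show "\<exists>d>0. \<forall>n\<ge>1. \<forall>\<omega>\<in>space (M n).
          (\<forall>W\<in>{\<lambda>n \<omega>. T n \<omega> * \<rho> n \<omega>, \<lambda>n \<omega>. T' n \<omega> - T n \<omega>, \<rho>}. \<bar>W n \<omega>\<bar> \<le> d) \<longrightarrow> \<bar>Z n \<omega> - T' n \<omega>\<bar> \<le> e"
        using e by (intro exI[of _ "min 1 (e / 2)"]) simp
    qed (use nT\<rho> \<Delta> n\<rho> T\<rho>_meas \<Delta>_meas \<rho>_meas in auto)
    have "weak_conv_m (\<lambda>n. distr (M n) borel (Z n)) std_normal_distribution"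
      using weak_conv_slutsky[OF Z_meas meas(6) nZ real_dist_normal_dist] T'_iff_T T_iff lind by simp
    moreover have "weak_conv_m (\<lambda>n. distr (M n) borel (s n)) (return borel 1)"
      by (rule weak_conv_const[OF meas(7) ns])
    ultimately show ?thesis unfolding Z_def by simp
  qed
  have "lindeberg \<longleftrightarrow> weak_conv_m (\<lambda>n. distr (M n) borel (T' n)) std_normal_distribution"
    using T'_iff_T T_iff by simp
  with part2 show ?thesis unfolding T'_def s_def by simp
qed

end
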